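(* Let $n\geq 2$ be an integer and let $\varphi=(\varphi_{1},\ldots,\varphi_{n})$ be a continuous mapping of $\mathbb{S}^{n-1}$ into $\mathbb{R}^{n}$ with $|\varphi|=1$ on $\mathbb{S}^{n-1}$. For $\alpha\in[0,\infty)$, let $f=(P_{\alpha}[\varphi_{1}],\ldots,P_{\alpha}[\varphi_{n}])$. (1) If $\alpha=0$ and $f(0)=0$, then for every $\zeta$ with $|\zeta|=1$, $$\liminf_{r\rightarrow1^{-}}\frac{|f(\zeta)-f(r\zeta)|}{1-r}\geq \frac{n!\left[1+n-(n-2)F\left(\frac{1}{2},1;\frac{n+3}{2};-1\right)\right]}{2^{\frac{3n}{2}} \Gamma\left(\frac{n+1}{2}\right)\Gamma\left(\frac{n+3}{2}\right)},$$ and this inequality is sharp (i.e. the constant on the right-hand side cannot be replaced by a larger one). (2) If $\alpha>n-2$, then for every $\zeta$ with $|\zeta|=1$, $$\liminf_{r\rightarrow1^{-}}\frac{|f(\zeta)-f(r\zeta)|}{1-r}\geq\frac{\alpha}{2}+1-\frac{n}{2}.$$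
   Context: Notation: $\mathbb{B}^{n}=\{x\in\mathbb{R}^n: |x|<1\}$ is the open Euclidean unit ball and $\mathbb{S}^{n-1}=\partial\mathbb{B}^{n}$ is the unit sphere, where $|\cdot|$ is the Euclidean norm; $\sigma$ is the rotation-invariant positive Borel measure on $\mathbb{S}^{n-1}$ with $\sigma(\mathbb{S}^{n-1})=1$; $\Gamma$ is the Gamma function. Dirichlet solution: for $\alpha>-1$ and $x\in\mathbb{B}^n$, let $\delta_{\alpha}(x)=(1-|x|^{2})^{\alpha}$ and let $$\Delta_{\alpha}=\mathrm{div}(\delta_{\alpha}^{-1}\nabla)+\alpha(n-2-\alpha)\delta_{\alpha+1}^{-1}.$$ For a real-valued function $\psi$ on $\mathbb{S}^{n-1}$, $P_{\alpha}[\psi]$ denotes the Dirichlet solution of $\psi$ over $\mathbb{B}^n$ for $\Delta_\alpha$, that is, $\Delta_{\alpha}P_{\alpha}[\psi]=0$ in $\mathbb{B}^{n}$ and $P_{\alpha}[\psi]=\psi$ on $\mathbb{S}^{n-1}$. For $\psi\in C(\mathbb{S}^{n-1})$ it is given by $$P_{\alpha}[\psi](x)=\int_{\mathbb{S}^{n-1}}\mathbf{P}_{\alpha}(x,\zeta)\psi(\zeta)\,d\sigma(\zeta),\quad x\in\mathbb{B}^{n},$$ where $$\mathbf{P}_{\alpha}(x,\zeta)=C_{\alpha}\frac{(1-|x|^{2})^{1+\alpha}}{|x-\zeta|^{n+\alpha}},\qquad C_{\alpha}=\frac{\Gamma\left(\frac{n+\alpha}{2}\right)\Gamma\left(1+\frac{\alpha}{2}\right)}{\Gamma\left(\frac{n}{2}\right)\Gamma(1+\alpha)},$$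 and $P_\alpha[\psi]$ is continuous on $\overline{\mathbb{B}^n}$. In particular $f=\varphi$ on $\mathbb{S}^{n-1}$, so $f(\zeta)=\varphi(\zeta)$ for $|\zeta|=1$. For $\alpha=0$, $P_0[\psi]$ is the usual harmonic Poisson integral of $\psi$. Hypergeometric function: for $a,b,c\in\mathbb{R}$ with $c\neq 0,-1,-2,\ldots$, $$F(a,b;c;x)=\sum_{k=0}^{\infty}\frac{(a)_{k}(b)_{k}}{(c)_{k}}\frac{x^{k}}{k!},\quad |x|<1,$$ where $(a)_{0}=1$ and $(a)_{k}=a(a+1)\cdots(a+k-1)$ for $k\geq1$; the value $F\left(\frac12,1;\frac{n+3}{2};-1\right)$ is the sum of this series at $x=-1$, where it converges. *)

theory Defs
  imports "HOL-Analysis.Analysis"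
begin

text \<open>Rotations are the elements of \<open>SO(n)\<close>. The three conditions determine \<open>\<sigma>\<close> uniquely when
  \<open>n \<ge> 2\<close>, so a statement for every such \<open>\<sigma>\<close> is a statement about the normalized surface measure;
  existence is \<open>normalized_rotation_invariant_exists\<close> below.\<close>

definition normalized_rotation_invariant :: "(real ^ 'n) measure \<Rightarrow> bool" where
  "normalized_rotation_invariant \<sigma> \<longleftrightarrow>
     sets \<sigma> = sets (restrict_space borel (sphere 0 1)) \<and>
     emeasure \<sigma> (sphere 0 1) = 1 \<and>
     (\<forall>R A. rotation_matrix R \<longrightarrow> A \<in> sets \<sigma> \<longrightarrow> emeasure \<sigma> ((\<lambda>x. R *v x) ` A) = emeasure \<sigma> A)"

definition poisson_const :: "nat \<Rightarrow> real \<Rightarrow> real" where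
  "poisson_const n \<alpha> =
     Gamma ((real n + \<alpha>) / 2) * Gamma (1 + \<alpha> / 2) / (Gamma (real n / 2) * Gamma (1 + \<alpha>))"

definition poisson_kernel :: "real \<Rightarrow> real ^ 'n \<Rightarrow> real ^ 'n \<Rightarrow> real" where
  "poisson_kernel \<alpha> x \<zeta> =
     poisson_const CARD('n) \<alpha> * (1 - (norm x)\<^sup>2) powr (1 + \<alpha>) / norm (x - \<zeta>) powr (real CARD('n) + \<alpha>)"

text \<open>The Dirichlet solution for continuous boundary data \<open>\<psi>\<close>: the Poisson integral in the open ball,
  and \<open>\<psi>\<close> itself on the unit sphere. Points outside the closed ball are irrelevant.\<close>

definition dirichlet_solution ::
  "(real ^ 'n) measure \<Rightarrow> real \<Rightarrow> (real ^ 'n \<Rightarrow> real) \<Rightarrow> real ^ 'n \<Rightarrow> real" where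
  "dirichlet_solution \<sigma> \<alpha> \<psi> x =
     (if norm x < 1 then (\<integral>\<zeta>. poisson_kernel \<alpha> x \<zeta> * \<psi> \<zeta> \<partial>\<sigma>) else \<psi> x)"

definition dirichlet_solution_vec ::
  "(real ^ 'n) measure \<Rightarrow> real \<Rightarrow> (real ^ 'n \<Rightarrow> real ^ 'n) \<Rightarrow> real ^ 'n \<Rightarrow> real ^ 'n" where
  "dirichlet_solution_vec \<sigma> \<alpha> \<phi> x = (\<chi> i. dirichlet_solution \<sigma> \<alpha> (\<lambda>\<zeta>. \<phi> \<zeta> $ i) x)"

definition sphere_self_map :: "(real ^ 'n \<Rightarrow> real ^ 'n) \<Rightarrow> bool" where
  "sphere_self_map \<phi> \<longleftrightarrow> continuous_on (sphere 0 1) \<phi> \<and> (\<forall>\<zeta>. norm \<zeta> = 1 \<longrightarrow> norm (\<phi> \<zeta>) = 1)"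

definition boundary_liminf :: "(real ^ 'n \<Rightarrow> real ^ 'n) \<Rightarrow> real ^ 'n \<Rightarrow> ereal" where
  "boundary_liminf f \<zeta> = Liminf (at_left 1) (\<lambda>r::real. ereal (norm (f \<zeta> - f (r *\<^sub>R \<zeta>)) / (1 - r)))"

definition hypergeometric :: "real \<Rightarrow> real \<Rightarrow> real \<Rightarrow> real \<Rightarrow> real" where
  "hypergeometric a b c x =
     (\<Sum>k. pochhammer a k * pochhammer b k / pochhammer c k * x ^ k / fact k)"

definition harmonic_boundary_const :: "nat \<Rightarrow> real" where
  "harmonic_boundary_const n =
     fact n * (1 + real n - (real n - 2) * hypergeometric (1 / 2) 1 ((real n + 3) / 2) (- 1)) /
     (2 powr (3 * real n / 2) * Gamma ((real n + 1) / 2) * Gamma ((real n + 3) / 2))"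

lemma nn_integral_lborel_isometric_shift:
  fixes f :: "'a::euclidean_space \<Rightarrow> ennreal"
  assumes [measurable]: "f \<in> borel_measurable borel" and c: "\<bar>c\<bar> = 1"
  shows "(\<integral>\<^sup>+y. f (t + c *\<^sub>R y) \<partial>lborel) = (\<integral>\<^sup>+y. f y \<partial>lborel)"
proof -
  have "(\<integral>\<^sup>+y. f y \<partial>lborel) = (\<integral>\<^sup>+y. f y \<partial>(distr lborel borel (\<lambda>x. t + c *\<^sub>R x)))"
    by (subst lborel_affine[of c t]) (use c in \<open>auto simp: nn_integral_density\<close>)
  also have "\<dots> = (\<integral>\<^sup>+y. f (t + c *\<^sub>R y) \<partial>lborel)"
    by (subst nn_integral_distr) auto
  finally show ?thesis by simp
qed

text \<open>The library states this only for well-ordered index types.\<close>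

lemma emeasure_lborel_orthogonal_vimage:
  fixes R Q :: "'a::euclidean_space \<Rightarrow> 'a"
  assumes R: "linear R" "\<And>x. norm (R x) = norm x" and Q: "\<And>x. R (Q x) = x"
    and A[measurable]: "A \<in> sets borel"
  shows "emeasure lborel (R -` A) = emeasure lborel A"
proof -
  define B :: "'a set" where "B = ball 0 1"
  have [measurable]: "B \<in> sets borel" by (simp add: B_def)
  have Rm[measurable]: "R \<in> borel_measurable borel"
    using R(1) by (intro borel_measurable_continuous_onI linear_continuous_on)
                  (simp add: linear_conv_bounded_linear[symmetric])
  have pre: "(\<integral>\<^sup>+y. indicator X (R y) \<partial>lborel) = emeasure lborel (R -` X)" if [measurable]: "X \<in> sets borel" for X
  proof -
    have "R -` X \<in> sets borel" using measurable_sets[OF Rm that] by simp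
    moreover have "(\<lambda>y. indicator X (R y) :: ennreal) = indicator (R -` X)" by (auto simp: indicator_def)
    ultimately show ?thesis by simp
  qed
  have RB: "R -` B = B" using R(2) by (auto simp: B_def)
  define I where "I = (\<integral>\<^sup>+y. \<integral>\<^sup>+x. indicator A x * indicator B (x + R y) \<partial>lborel \<partial>(lborel::'a measure))"
  have "I = (\<integral>\<^sup>+x. \<integral>\<^sup>+y. indicator A x * indicator B (x + R y) \<partial>lborel \<partial>lborel)"
    unfolding I_def by (rule lborel_pair.Fubini') measurable
  also have "\<dots> = (\<integral>\<^sup>+x. indicator A x * emeasure lborel B \<partial>lborel)"
  proof (rule nn_integral_cong)
    fix x :: 'a
    have "x + R y = R (Q x + 1 *\<^sub>R y)" for y by (simp add: linear_add[OF R(1)] Q)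
    then have "(\<integral>\<^sup>+y. indicator B (x + R y) \<partial>lborel) = (\<integral>\<^sup>+y. (indicator B (R (Q x + 1 *\<^sub>R y)) :: ennreal) \<partial>lborel)"
      by presburger
    also have "\<dots> = (\<integral>\<^sup>+y. indicator B (R y) \<partial>lborel)"
      by (rule nn_integral_lborel_isometric_shift) auto
    also have "\<dots> = emeasure lborel B" using pre[of B] RB by simp
    finally show "(\<integral>\<^sup>+y. indicator A x * indicator B (x + R y) \<partial>lborel) = indicator A x * emeasure lborel B"
      by (subst nn_integral_cmult) auto
  qed
  also have "\<dots> = emeasure lborel A * emeasure lborel B"
    by (subst nn_integral_multc) auto
  finally have 1: "I = emeasure lborel A * emeasure lborel B" .
  have "I = (\<integral>\<^sup>+y. \<integral>\<^sup>+x. indicator A (x - R y) * indicator B x \<partial>lborel \<partial>lborel)"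
    unfolding I_def
  proof (rule nn_integral_cong)
    fix y :: 'a
    have "(\<integral>\<^sup>+x. indicator A x * indicator B (x + R y) \<partial>lborel) =
      (\<integral>\<^sup>+x. (\<lambda>x. indicator A (x - R y) * indicator B x :: ennreal) (R y + 1 *\<^sub>R x) \<partial>lborel)"
      by (simp add: add.commute)
    also have "\<dots> = (\<integral>\<^sup>+x. indicator A (x - R y) * indicator B x \<partial>lborel)"
      by (rule nn_integral_lborel_isometric_shift) auto
    finally show "(\<integral>\<^sup>+x. indicator A x * indicator B (x + R y) \<partial>lborel) =
      (\<integral>\<^sup>+x. (indicator A (x - R y) * indicator B x :: ennreal) \<partial>lborel)" .
  qed
  also have "\<dots> = (\<integral>\<^sup>+x. \<integral>\<^sup>+y. indicator A (x - R y) * indicator B x \<partial>lborel \<partial>lborel)"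
    by (rule lborel_pair.Fubini') measurable
  also have "\<dots> = (\<integral>\<^sup>+x. emeasure lborel (R -` A) * indicator B x \<partial>lborel)"
  proof (rule nn_integral_cong)
    fix x :: 'a
    have "x - R y = R (Q x + (- 1) *\<^sub>R y)" for y by (simp add: linear_diff[OF R(1)] Q)
    then have "(\<integral>\<^sup>+y. indicator A (x - R y) \<partial>lborel) = (\<integral>\<^sup>+y. (indicator A (R (Q x + (- 1) *\<^sub>R y)) :: ennreal) \<partial>lborel)"
      by presburger
    also have "\<dots> = (\<integral>\<^sup>+y. indicator A (R y) \<partial>lborel)"
      by (rule nn_integral_lborel_isometric_shift) auto
    also have "\<dots> = emeasure lborel (R -` A)" by (rule pre) fact
    finally show "(\<integral>\<^sup>+y. indicator A (x - R y) * indicator B x \<partial>lborel) = emeasure lborel (R -` A) * indicator B x"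
      by (subst nn_integral_multc) auto
  qed
  also have "\<dots> = emeasure lborel (R -` A) * emeasure lborel B"
    by (subst nn_integral_cmult) auto
  finally have 2: "I = emeasure lborel (R -` A) * emeasure lborel B" .
  have "emeasure lborel B \<noteq> 0" "emeasure lborel B \<noteq> top"
    using unit_ball_vol_pos[of "real DIM('a)"] by (auto simp: B_def emeasure_ball simp del: unit_ball_vol_pos)
  then show ?thesis
    using 1 2 by (metis ennreal_mult_cancel_left mult.commute)
qed

lemma normalized_rotation_invariant_exists:
  "\<exists>\<sigma> :: (real ^ 'n) measure. normalized_rotation_invariant \<sigma>"
proof -
  define B :: "(real ^ 'n) set" where "B = ball 0 1 - {0}"
  define g :: "real ^ 'n \<Rightarrow> real ^ 'n"
    where "g x = (if x = 0 then axis undefined 1 else x /\<^sub>R norm x)" for x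
  define S where "S = restrict_space (borel :: (real ^ 'n) measure) (sphere 0 1)"
  define \<sigma> where "\<sigma> = distr (uniform_measure lborel B) S g"
  have gS: "g x \<in> sphere 0 1" for x by (simp add: g_def)
  have gm: "g \<in> measurable (uniform_measure lborel B) S"
    unfolding S_def
  proof (rule measurable_restrict_space2)
    have "g \<in> borel_measurable borel" unfolding g_def[abs_def] by measurable
    then show "g \<in> borel_measurable (uniform_measure lborel B)"
      by (simp add: uniform_measure_def)
  qed (use gS in auto)
  have Bm [measurable]: "B \<in> sets borel" by (simp add: B_def)
  have B0: "emeasure lborel B = emeasure lborel (ball (0 :: real ^ 'n) 1)"
    unfolding B_def by (subst emeasure_Diff_null_set) (auto simp: null_sets_def)
  have Bpos: "emeasure lborel B \<noteq> 0"
    using B0 unit_ball_vol_pos[of "real CARD('n)"] by (simp add: emeasure_ball del: unit_ball_vol_pos)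
  have Bfin: "emeasure lborel B \<noteq> \<infinity>"
    using B0 by (simp add: emeasure_ball)
  have eq: "emeasure \<sigma> A = emeasure lborel (B \<inter> g -` A) / emeasure lborel B" if "A \<in> sets S" for A
  proof -
    have "g -` A \<in> sets borel"
      using measurable_sets[OF gm that] by simp
    then show ?thesis
      unfolding \<sigma>_def using that by (subst emeasure_distr[OF gm]) auto
  qed
  have rot: "emeasure \<sigma> ((\<lambda>x. R *v x) ` A) = emeasure \<sigma> A"
    if R: "rotation_matrix R" and A: "A \<in> sets S" for R :: "real ^ 'n ^ 'n" and A
  proof -
    have ot: "orthogonal_transformation ((*v) R)"
      using R by (simp add: rotation_matrix_def orthogonal_transformation_matrix)
    have nrm: "norm (R *v x) = norm x" for x
      using ot by (simp add: orthogonal_transformation)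
    have inj: "inj ((*v) R)" and bij: "bij ((*v) R)"
      using ot orthogonal_transformation_inj orthogonal_transformation_bij by blast+
    have Ab: "A \<in> sets borel" and As: "A \<subseteq> sphere 0 1"
      using A by (auto simp: S_def sets_restrict_space)
    have lin: "linear ((*v) R)" by simp
    obtain Q where Q: "Q ** R = mat 1" "R ** Q = mat 1"
      using R by (auto simp: rotation_matrix_def orthogonal_matrix_def)
    have imm: "(*v) R ` X \<in> sets borel" if "X \<in> sets borel" for X
    proof -
      have "Q *v (R *v x) = x" "R *v (Q *v x) = x" for x
        by (simp_all add: matrix_vector_mul_assoc Q)
      then have "(*v) R ` X = (*v) Q -` X" unfolding set_eq_iff image_iff vimage_eq by metis
      moreover have "(*v) Q \<in> borel_measurable borel"
        by (intro borel_measurable_continuous_onI linear_continuous_on)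
           (simp add: linear_conv_bounded_linear[symmetric])
      ultimately show ?thesis
        using that measurable_sets[of "(*v) Q" borel borel X] by simp
    qed
    have "(*v) R ` A \<subseteq> sphere 0 1" using As by (auto simp: nrm)
    then have RA: "(\<lambda>x. R *v x) ` A \<in> sets S"
      using imm[OF Ab] by (simp add: S_def sets_restrict_space_iff)
    have gR: "g (R *v x) = R *v g x" if "x \<noteq> 0" for x
    proof -
      have "R *v x \<noteq> 0" using nrm[of x] that by auto
      then show ?thesis using that by (simp add: g_def nrm scaleR_matrix_vector_assoc matrix_vector_mult_scaleR)
    qed
    have im: "B \<inter> g -` ((*v) R ` A) = (*v) R ` (B \<inter> g -` A)" (is "?L = ?Q")
    proof (intro equalityI subsetI)
      fix y assume y: "y \<in> ?L"
      obtain x where x: "y = R *v x" using bij by (metis bij_pointE)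
      have "x \<in> B" using y x nrm[of x] by (auto simp: B_def)
      then show "y \<in> ?Q" using y x gR[of x] inj by (auto simp: B_def inj_image_mem_iff)
    next
      fix y assume "y \<in> ?Q"
      then obtain x where x: "y = R *v x" "x \<in> B" "g x \<in> A" by auto
      moreover have "y \<in> B" using x nrm[of x] by (auto simp: B_def)
      ultimately show "y \<in> ?L" using gR[of x] by (auto simp: B_def)
    qed
    have gA: "g -` A \<in> sets borel" using measurable_sets[OF gm A] by simp
    have BA: "B \<inter> g -` A \<in> sets borel" using gA Bm by auto
    have "emeasure lborel ((*v) R -` ((*v) R ` (B \<inter> g -` A))) = emeasure lborel ((*v) R ` (B \<inter> g -` A))"
      by (rule emeasure_lborel_orthogonal_vimage[where Q = "(*v) Q"])
         (use lin nrm imm[OF BA] in \<open>auto simp: matrix_vector_mul_assoc Q\<close>)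
    then have "emeasure lborel ((*v) R ` (B \<inter> g -` A)) = emeasure lborel (B \<inter> g -` A)"
      by (simp add: inj_vimage_image_eq[OF inj])
    then show ?thesis using eq[OF RA] eq[OF A] im by simp
  qed
  have sp: "sphere 0 1 \<in> sets S" by (simp add: S_def sets_restrict_space_iff)
  have "g -` sphere 0 1 = UNIV" using gS by auto
  then have "emeasure \<sigma> (sphere 0 1) = 1"
    using eq[OF sp] Bpos Bfin by (simp add: ennreal_divide_self top.not_eq_extremum)
  moreover have "sets \<sigma> = sets S" by (simp add: \<sigma>_def)
  ultimately show ?thesis
    unfolding normalized_rotation_invariant_def using rot S_def by (intro exI[of _ \<sigma>]) auto
qed

end

theory Submission
  imports Defs
begin

text \<open>Write \<open>t = \<eta> \<bullet> z\<close> for the latitude of a point \<open>\<eta>\<close> of the sphere with respect to a pole \<open>z\<close>. At \<open>x = r z\<close> the Poisson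
kernel depends on \<open>\<eta>\<close> through \<open>t\<close> only, because \<open>|r z - \<eta>|\<^sup>2 = 1 + r\<^sup>2 - 2 r t\<close> (\<open>sphere_dist2\<close>), so every
estimate becomes one for integrals over \<open>-1 < t < 1\<close> against the weight \<open>(1 - t\<^sup>2) powr ((n - 3) / 2)\<close>.
That reduction, \<open>zonal_integral\<close>, rests on the invariance and the total mass of \<open>\<sigma>\<close> alone: transitivity of
the rotations makes \<open>\<integral> (\<eta> \<bullet> y) ^ m \<partial>\<sigma>\<close> a multiple of \<open>|y| ^ m\<close>, comparing coefficients at \<open>y = a + b c\<close> with
orthonormal \<open>a\<close> and \<open>c\<close> gives the recurrence of the moments, and the weight satisfies the same recurrence.

\<^emph>\<open>Upper bounds for the solution.\<close> Let \<open>f\<close> be the solution. As \<open>|f \<zeta>| = 1\<close>, the difference quotient is at least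
\<open>(1 - |f (r \<zeta>)|) / (1 - r)\<close>. For \<open>\<alpha> > n - 2\<close> the trivial bound of \<open>|f (r \<zeta>)|\<close> by the mass of the kernel
suffices. The conformal involution of the ball that exchanges \<open>0\<close> and \<open>r \<zeta>\<close> turns this mass into a constant multiple of the mean of
\<open>|r \<zeta> - \<eta>| powr (\<alpha> + 2 - n)\<close> (\<open>moebius_substitution\<close>), whose left derivative at \<open>r = 1\<close> is \<open>(\<alpha> + 2 - n) / 2\<close>
times the value there, and this value is \<open>1\<close> by the choice of the constant
(\<open>weighted_poisson_mass_derivative\<close>). For \<open>\<alpha> = 0\<close> and \<open>f 0 = 0\<close> any constant may be subtracted from the kernel.
Subtracting its value \<open>p\<close> on the equator gives \<open>|f (r \<zeta>)| \<le> \<integral> |P - p| \<partial>\<sigma>\<close>, and since \<open>P\<close> has mass \<open>1\<close> this is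
\<open>1 - 2 \<integral> P \<partial>\<sigma>\<close> with the last integral taken over the hemisphere \<open>t \<le> 0\<close> only (\<open>zonal_mean_poisson_deviation\<close>).
There \<open>P / (1 - r)\<close> stays bounded as \<open>r \<rightarrow> 1\<close>, so the limit may be taken under the integral.

\<^emph>\<open>The mass of the harmonic kernel\<close> is computed without potential theory. The directions in which the points of the
sphere are seen from \<open>r z\<close> fill a whole sphere, so \<open>\<integral> (1 - r t) / |r z - \<eta>| ^ n \<partial>\<sigma> = 1\<close>
(\<open>solid_angle_substitution\<close>); as \<open>2 (1 - r t) = (1 - r\<^sup>2) + |r z - \<eta>|\<^sup>2\<close> and the conformal involution shows that
both summands contribute equally, each contributes \<open>1\<close> (\<open>zonal_mean_poisson\<close>).

\<^emph>\<open>The constant\<close> is a Beta type integral over a hemisphere. Integration by parts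
(\<open>has_integral_cap\<close>) relates it to the Euler integral of the hypergeometric series
(\<open>has_integral_hypergeometric\<close>).

\<^emph>\<open>Sharpness.\<close> Equality in these integral bounds would need \<open>\<phi> \<eta> = \<zeta>\<close> for \<open>t > 0\<close> and \<open>\<phi> \<eta> = - \<zeta>\<close> for \<open>t < 0\<close>. The maps \<open>extremal_map \<epsilon>\<close> agree
with this outside the belt \<open>|t| < \<epsilon>\<close> and turn continuously inside it. Since
\<open>|\<zeta> - f (r \<zeta>)| \<le> \<integral> P |\<zeta> - \<phi>| \<partial>\<sigma>\<close> and the integrand vanishes near \<open>\<zeta>\<close>, the limit as \<open>r \<rightarrow> 1\<close> can be taken under the
integral, and then the limit as \<open>\<epsilon> \<rightarrow> 0\<close> gives the constant.\<close>

section \<open>Integration against a rotation invariant measure\<close>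

lemma rotation_invariant_space:
  fixes \<sigma> :: "(real ^ 'n) measure"
  assumes "normalized_rotation_invariant \<sigma>"
  shows "space \<sigma> = sphere 0 1" "finite_measure \<sigma>" "sets \<sigma> = sets (restrict_space borel (sphere 0 1))"
proof -
  show s: "sets \<sigma> = sets (restrict_space borel (sphere 0 1))"
    using assms by (simp add: normalized_rotation_invariant_def)
  show sp: "space \<sigma> = sphere 0 1"
    using sets_eq_imp_space_eq[OF s] by (simp add: space_restrict_space)
  show "finite_measure \<sigma>"
    using assms by (intro finite_measureI) (simp add: sp normalized_rotation_invariant_def)
qed

lemma integrable_continuous_sphere:
  fixes \<sigma> :: "(real ^ 'n) measure" and f :: "real ^ 'n \<Rightarrow> real"
  assumes "normalized_rotation_invariant \<sigma>" "continuous_on (sphere 0 1) f"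
  shows "integrable \<sigma> f"
proof -
  interpret finite_measure \<sigma> using rotation_invariant_space(2)[OF assms(1)] .
  have m: "f \<in> borel_measurable \<sigma>"
    using borel_measurable_continuous_on_restrict[OF assms(2)]
    by (simp cong: measurable_cong_sets add: rotation_invariant_space(3)[OF assms(1)])
  have "compact (f ` sphere 0 1)" using assms(2) by (intro compact_continuous_image) auto
  then obtain B where "\<forall>y\<in>f ` sphere 0 1. \<bar>y\<bar> \<le> B"
    using compact_imp_bounded[of "f ` sphere 0 1"] by (auto simp: bounded_iff)
  then show ?thesis
    using m by (intro integrable_const_bound[where B = B])
      (auto intro!: AE_I2 simp: rotation_invariant_space(1)[OF assms(1)])
qed

lemma rotation_matrix_norm:
  assumes "rotation_matrix (R :: real ^ 'n ^ 'n)"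
  shows "norm (R *v x) = norm x" "(R *v x) \<bullet> (R *v y) = x \<bullet> y"
proof -
  have "orthogonal_transformation ((*v) R)"
    using assms by (simp add: rotation_matrix_def orthogonal_transformation_matrix)
  then show "norm (R *v x) = norm x" "(R *v x) \<bullet> (R *v y) = x \<bullet> y"
    using orthogonal_transformation by (blast, simp add: orthogonal_transformation_def)
qed

text \<open>Invariance is a statement about images \<open>R ` A\<close>; as \<open>R\<close> permutes the sphere it says that \<open>\<sigma>\<close> is its own image
measure under \<open>R\<close>.\<close>

lemma integral_rotation_invariant:
  fixes \<sigma> :: "(real ^ 'n) measure" and f :: "real ^ 'n \<Rightarrow> real"
  assumes \<sigma>: "normalized_rotation_invariant \<sigma>" and f: "continuous_on (sphere 0 1) f"
    and R: "rotation_matrix R"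
  shows "(\<integral>x. f (R *v x) \<partial>\<sigma>) = (\<integral>x. f x \<partial>\<sigma>)"
proof -
  note sp = rotation_invariant_space[OF \<sigma>]
  note nrm = rotation_matrix_norm[OF R]
  have cR: "(*v) R \<in> borel_measurable borel"
    by (intro borel_measurable_continuous_onI linear_continuous_on)
       (simp add: linear_conv_bounded_linear[symmetric])
  have Rm: "(*v) R \<in> measurable \<sigma> \<sigma>"
  proof -
    have "(*v) R \<in> measurable (restrict_space borel (sphere 0 1)) (restrict_space borel (sphere 0 1))"
      by (intro measurable_restrict_space2 measurable_restrict_space1 cR)
         (auto simp: space_restrict_space nrm)
    then show ?thesis using sp(3) by (simp cong: measurable_cong_sets)
  qed
  have onto: "\<exists>y. norm y = 1 \<and> R *v y = x" if "norm x = 1" for x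
  proof -
    obtain Q where "R ** Q = mat 1" using R by (auto simp: rotation_matrix_def orthogonal_matrix_def)
    then have "R *v (Q *v x) = x" by (simp add: matrix_vector_mul_assoc)
    then show ?thesis using nrm(1)[of "Q *v x"] that by metis
  qed
  have "distr \<sigma> \<sigma> ((*v) R) = \<sigma>"
  proof (rule measure_eqI)
    fix A assume "A \<in> sets (distr \<sigma> \<sigma> ((*v) R))"
    then have A: "A \<in> sets \<sigma>" by simp
    define B where "B = (*v) R -` A \<inter> space \<sigma>"
    have B: "B \<in> sets \<sigma>" unfolding B_def by (rule measurable_sets[OF Rm A])
    have "(*v) R ` B = A"
    proof (intro equalityI subsetI)
      fix x assume x: "x \<in> A"
      then have "norm x = 1" using sets.sets_into_space[OF A] sp(1) by auto
      then obtain y where "norm y = 1" "R *v y = x" using onto by blast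
      then show "x \<in> (*v) R ` B" using x by (auto simp: B_def sp(1))
    qed (auto simp: B_def)
    moreover have "emeasure \<sigma> ((*v) R ` B) = emeasure \<sigma> B"
      using \<sigma> R B by (simp add: normalized_rotation_invariant_def)
    ultimately show "emeasure (distr \<sigma> \<sigma> ((*v) R)) A = emeasure \<sigma> A"
      using emeasure_distr[OF Rm A] by (simp add: B_def)
  qed simp
  moreover have "f \<in> borel_measurable \<sigma>"
    using integrable_continuous_sphere[OF \<sigma> f] by simp
  ultimately show ?thesis
    using integral_distr[OF Rm, of f] by simp
qed

lemma inner_sphere_interval:
  assumes "norm \<eta> = 1" "norm y = 1"
  shows "\<eta> \<bullet> y \<in> {-1..1}"
  using Cauchy_Schwarz_ineq2[of \<eta> y] assms by (simp add: abs_le_iff)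

lemma continuous_zonal:
  assumes h: "continuous_on {-1..1} h" and z: "norm (z :: real ^ 'n) = 1"
  shows "continuous_on (sphere 0 1) (\<lambda>\<eta>. h (\<eta> \<bullet> z))"
  by (rule continuous_on_compose2[OF h])
     (use inner_sphere_interval[OF _ z] in \<open>auto intro!: continuous_intros\<close>)

text \<open>A rotation carrying \<open>z\<close> to \<open>y\<close> carries one integrand to the other. Such rotations, of determinant \<open>1\<close>, exist
because the dimension is at least \<open>2\<close>. Taking \<open>y = - z\<close> gives the symmetry of latitudes.\<close>

lemma zonal_integral_direction:
  fixes \<sigma> :: "(real ^ 'n) measure" and h :: "real \<Rightarrow> real"
  assumes n: "CARD('n) \<ge> 2" and \<sigma>: "normalized_rotation_invariant \<sigma>"
    and h: "continuous_on {-1..1} h" and y: "norm y = 1" "norm z = 1"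
  shows "(\<integral>\<eta>. h (\<eta> \<bullet> y) \<partial>\<sigma>) = (\<integral>\<eta>. h (\<eta> \<bullet> z) \<partial>\<sigma>)"
proof -
  obtain g where g: "orthogonal_transformation g" "det (matrix g) = 1" "g z = y"
    using rotation_exists[of z y] n y by auto
  define R where "R = matrix g"
  have lin: "linear g" using g(1) by (simp add: orthogonal_transformation_def)
  have Rg: "R *v x = g x" for x
    unfolding R_def using lin by (simp add: matrix_vector_mul)
  have R: "rotation_matrix R"
    using g orthogonal_transformation_matrix[of g] by (auto simp: rotation_matrix_def R_def)
  have "(\<integral>\<eta>. h (\<eta> \<bullet> z) \<partial>\<sigma>) = (\<integral>\<eta>. h ((R *v \<eta>) \<bullet> y) \<partial>\<sigma>)"
    using rotation_matrix_norm(2)[OF R, of _ z] Rg[of z] g(3) by simp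
  also have "\<dots> = (\<integral>\<eta>. h (\<eta> \<bullet> y) \<partial>\<sigma>)"
    by (rule integral_rotation_invariant[OF \<sigma> continuous_zonal[OF h y(1)] R])
  finally show ?thesis by simp
qed

section \<open>The ultraspherical weight\<close>

text \<open>Up to normalization, the density of the latitude \<open>\<eta> \<bullet> z\<close> of a uniformly distributed point \<open>\<eta>\<close> of the sphere in
dimension \<open>n\<close>.\<close>

definition zonal_weight :: "real \<Rightarrow> real \<Rightarrow> real" where
  "zonal_weight n t = (1 - t\<^sup>2) powr ((n - 3) / 2)"

definition zonal_mass :: "real \<Rightarrow> real" where
  "zonal_mass n = integral {-1<..<1} (zonal_weight n)"

definition zonal_mean :: "real \<Rightarrow> (real \<Rightarrow> real) \<Rightarrow> real" where
  "zonal_mean n h = integral {-1<..<1} (\<lambda>t. h t * zonal_weight n t) / zonal_mass n"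

lemma zonal_weight_nonneg [simp]: "zonal_weight n t \<ge> 0"
  by (simp add: zonal_weight_def)

text \<open>The substitution \<open>x = (1 + t) / 2\<close> makes this the Beta integral. Besides the total mass (\<open>s = 0\<close>) it provides the
normalization of the Poisson kernel and the integrable majorants with a singularity at the pole \<open>t = 1\<close>.\<close>

lemma has_integral_power_zonal_weight:
  assumes n: "n > 1" and s: "s + (n - 1) / 2 > 0"
  shows "((\<lambda>t. (2 - 2 * t) powr s * zonal_weight n t) has_integral
           2 powr (2 * s + n - 2) * Beta ((n - 1) / 2) (s + (n - 1) / 2)) {-1<..<1}"
proof -
  define a where "a = (n - 1) / 2"
  define b where "b = s + (n - 1) / 2"
  have ab: "a > 0" "b > 0" using n s by (auto simp: a_def b_def)
  have "((\<lambda>x. x powr (a - 1) * (1 - x) powr (b - 1)) has_integral Beta a b) (cbox 0 1)"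
    using has_integral_Beta_real[OF ab] by simp
  from has_integral_affinity[OF this, of "1/2" "1/2"]
  have "((\<lambda>t. (t / 2 + 1 / 2) powr (a - 1) * (1 - (t / 2 + 1 / 2)) powr (b - 1)) has_integral
      2 * Beta a b) ((\<lambda>x. 2 * x - 1) ` {0..1})"
    by (simp add: field_simps)
  moreover have "(\<lambda>x. 2 * x - 1) ` {0..1} = {-1..1::real}"
    using image_affinity_atLeastAtMost[of 2 "-1" 0 "1::real"] by simp
  ultimately have "((\<lambda>t. (t / 2 + 1 / 2) powr (a - 1) * (1 - (t / 2 + 1 / 2)) powr (b - 1)) has_integral
      2 * Beta a b) {-1<..<1}"
    by (simp add: has_integral_Icc_iff_Ioo)
  from has_integral_mult_right[OF this, of "2 powr (s + a + b - 2)"]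
  have int: "((\<lambda>t. 2 powr (s + a + b - 2) * ((t / 2 + 1 / 2) powr (a - 1) * (1 - (t / 2 + 1 / 2)) powr (b - 1)))
      has_integral 2 powr (s + a + b - 2) * (2 * Beta a b)) {-1<..<1}" .
  have eq: "2 powr (s + a + b - 2) * ((t / 2 + 1 / 2) powr (a - 1) * (1 - (t / 2 + 1 / 2)) powr (b - 1))
      = (2 - 2 * t) powr s * zonal_weight n t" if t: "t \<in> {-1<..<1}" for t
  proof -
    have e1: "(t / 2 + 1 / 2) powr (a - 1) = (1 + t) powr (a - 1) / 2 powr (a - 1)"
      using t by (subst powr_divide[symmetric]) (auto simp: field_simps)
    have e2: "(1 - (t / 2 + 1 / 2)) powr (b - 1) = (1 - t) powr (b - 1) / 2 powr (b - 1)"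
      using t by (subst powr_divide[symmetric]) (auto simp: field_simps)
    have f: "2 - 2 * t = 2 * (1 - t)" "1 - t\<^sup>2 = (1 + t) * (1 - t)"
      by (auto simp: algebra_simps power2_eq_square)
    have e3: "(2 - 2 * t) powr s * zonal_weight n t
        = 2 powr s * (1 - t) powr s * ((1 + t) powr (a - 1) * (1 - t) powr (a - 1))"
    proof -
      have e: "(n - 3) / 2 = a - 1" by (simp add: a_def field_simps)
      show ?thesis unfolding zonal_weight_def f e
        using t by (simp add: powr_mult del: right_diff_distrib_numeral)
    qed
    have e4: "(1 - t) powr s * (1 - t) powr (a - 1) = (1 - t) powr (b - 1)"
      by (subst powr_add[symmetric]) (simp add: a_def b_def algebra_simps)
    have e5: "2 powr (s + a + b - 2) = 2 powr s * 2 powr (a - 1) * (2::real) powr (b - 1)"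
      by (subst powr_add[symmetric])+ (simp add: algebra_simps)
    show ?thesis unfolding e1 e2 e3 e5 using e4 by (simp add: field_simps)
  qed
  have val: "2 powr (s + a + b - 2) * (2 * Beta a b) = 2 powr (2 * s + n - 2) * Beta a b"
  proof -
    have "2 powr (s + a + b - 2) * 2 = (2::real) powr (s + a + b - 2) * 2 powr 1" by simp
    also have "\<dots> = 2 powr (2 * s + n - 2)"
    proof (subst powr_add[symmetric])
      have "s + a + b - 2 + 1 = 2 * s + n - 2" by (simp add: a_def b_def field_simps)
      then show "2 powr (s + a + b - 2 + 1) = (2::real) powr (2 * s + n - 2)" by (simp only:)
    qed
    finally show ?thesis by simp
  qed
  show ?thesis
    using has_integral_eq[OF eq int] unfolding val unfolding a_def b_def .
qed

lemma has_integral_zonal_weight: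
  assumes "n > 1"
  shows "(zonal_weight n has_integral 2 powr (n - 2) * Beta ((n - 1) / 2) ((n - 1) / 2)) {-1<..<1}"
  using has_integral_power_zonal_weight[of n 0] assms
  by (subst has_integral_cong[where g = "\<lambda>t. (2 - 2 * t) powr 0 * zonal_weight n t"]) auto

lemma zonal_mass:
  assumes "n > 1"
  shows "zonal_mass n = 2 powr (n - 2) * Beta ((n - 1) / 2) ((n - 1) / 2)" "zonal_mass n > 0"
proof -
  show *: "zonal_mass n = 2 powr (n - 2) * Beta ((n - 1) / 2) ((n - 1) / 2)"
    using has_integral_zonal_weight[OF assms] by (simp add: zonal_mass_def integral_unique)
  show "zonal_mass n > 0"
    unfolding * using assms by (simp add: Beta_def Gamma_real_pos)
qed

lemma absolutely_integrable_mult_zonal_weight: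
  assumes n: "n > 1" and g: "g \<in> borel_measurable borel" and B: "\<And>t. t \<in> {-1<..<1} \<Longrightarrow> \<bar>g t\<bar> \<le> B"
  shows "(\<lambda>t. g t * zonal_weight n t) absolutely_integrable_on {-1<..<1}"
proof (rule absolutely_integrable_bounded_measurable_product_real)
  show "g \<in> borel_measurable (lebesgue_on {-1<..<1})"
    using g by (intro measurable_restrict_space1 measurable_completion) simp
  show "bounded (g ` {-1<..<1})" using B by (auto simp: bounded_iff intro!: exI[of _ B])
  show "zonal_weight n absolutely_integrable_on {-1<..<1}"
    using has_integral_zonal_weight[OF n]
    by (intro nonnegative_absolutely_integrable_1) (auto simp: integrable_on_def)
qed auto

lemma integrable_mult_zonal_weight:
  assumes "n > 1" "g \<in> borel_measurable borel" "\<And>t. t \<in> {-1<..<1} \<Longrightarrow> \<bar>g t\<bar> \<le> B"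
  shows "(\<lambda>t. g t * zonal_weight n t) integrable_on {-1<..<1}"
  using absolutely_integrable_mult_zonal_weight[OF assms] set_lebesgue_integral_eq_integral(1) by blast

lemma integrable_continuous_mult_zonal_weight:
  assumes n: "n > 1" and g: "continuous_on {-1..1} g"
  shows "(\<lambda>t. g t * zonal_weight n t) integrable_on {-1<..<1}"
proof -
  define g' where "g' t = indicator {-1..1} t *\<^sub>R g t" for t
  have "compact (g ` {-1..1})" using g by (intro compact_continuous_image) auto
  then obtain B where "\<forall>y\<in>g ` {-1..1}. \<bar>y\<bar> \<le> B"
    using compact_imp_bounded[of "g ` {-1..1}"] by (auto simp: bounded_iff)
  then have B: "\<bar>g t\<bar> \<le> B" if "t \<in> {-1..1}" for t using that by blast
  have "g' \<in> borel_measurable borel"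
    unfolding g'_def using borel_measurable_continuous_on_indicator[OF _ g] by simp
  moreover have "\<bar>g' t\<bar> \<le> B" if "t \<in> {-1<..<1}" for t using B[of t] that by (auto simp: g'_def)
  ultimately have "(\<lambda>t. g' t * zonal_weight n t) integrable_on {-1<..<1}"
    by (rule integrable_mult_zonal_weight[OF n])
  then show ?thesis
    by (subst integrable_cong[where g = "\<lambda>t. g' t * zonal_weight n t"]) (auto simp: g'_def)
qed

text \<open>Integrate the derivative of \<open>t ^ k * (1 - t\<^sup>2) powr ((n - 1) / 2)\<close>, which vanishes at both ends. For \<open>k = 0\<close> this
says that the first moment is zero; the truncated exponent \<open>k - 1\<close> is then multiplied by zero.\<close>

lemma zonal_mean_moment_recurrence:
  assumes n: "n > 1"
  shows "(n - 1 + real k) * zonal_mean n (\<lambda>t. t ^ (k + 1)) = real k * zonal_mean n (\<lambda>t. t ^ (k - 1))"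
proof -
  let ?I = "{-1<..<1::real}"
  define G where "G t = t ^ k * (1 - t\<^sup>2) powr ((n - 1) / 2)" for t :: real
  have "((\<lambda>t. (real k * t ^ (k - 1) * (1 - t\<^sup>2) - (n - 1) * t ^ (k + 1)) * zonal_weight n t) has_integral
      (G 1 - G (-1))) {-1..1}"
  proof (rule fundamental_theorem_of_calculus_interior)
    show "continuous_on {-1..1} G"
      unfolding G_def using n
      by (intro continuous_intros continuous_on_powr') (auto simp: abs_square_le_1 abs_le_iff)
    fix t :: real assume t: "t \<in> {-1<..<1}"
    then have pos: "1 - t\<^sup>2 > 0" by (simp add: abs_square_less_1 abs_less_iff)
    have w: "(1 - t\<^sup>2) powr ((n - 1) / 2) = (1 - t\<^sup>2) * zonal_weight n t"
    proof -
      have "(1 - t\<^sup>2) powr ((n - 1) / 2) = (1 - t\<^sup>2) powr (1 + (n - 3) / 2)" by (simp add: field_simps)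
      then show ?thesis using pos by (simp only: powr_add zonal_weight_def) simp
    qed
    have w': "(1 - t\<^sup>2) powr ((n - 1) / 2 - 1) = zonal_weight n t"
      by (simp add: zonal_weight_def field_simps)
    have "(G has_real_derivative
        real k * t ^ (k - 1) * (1 - t\<^sup>2) powr ((n - 1) / 2)
         + t ^ k * (((n - 1) / 2) * (1 - t\<^sup>2) powr ((n - 1) / 2 - 1) * (- 2 * t))) (at t)"
      unfolding G_def using pos by (auto intro!: derivative_eq_intros)
    moreover have "real k * t ^ (k - 1) * (1 - t\<^sup>2) powr ((n - 1) / 2)
         + t ^ k * (((n - 1) / 2) * (1 - t\<^sup>2) powr ((n - 1) / 2 - 1) * (- 2 * t))
       = (real k * t ^ (k - 1) * (1 - t\<^sup>2) - (n - 1) * t ^ (k + 1)) * zonal_weight n t"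
      unfolding w w' by (simp add: field_simps)
    ultimately show "(G has_vector_derivative
        (real k * t ^ (k - 1) * (1 - t\<^sup>2) - (n - 1) * t ^ (k + 1)) * zonal_weight n t) (at t)"
      by (simp add: has_real_derivative_iff_has_vector_derivative)
  qed simp
  then have z: "((\<lambda>t. (real k * t ^ (k - 1) * (1 - t\<^sup>2) - (n - 1) * t ^ (k + 1)) * zonal_weight n t) has_integral 0) ?I"
    using n by (simp add: G_def has_integral_Icc_iff_Ioo)
  define m where "m j = integral ?I (\<lambda>t. t ^ j * zonal_weight n t)" for j
  have m: "((\<lambda>t. t ^ j * zonal_weight n t) has_integral m j) ?I" for j
    unfolding m_def by (intro integrable_integral integrable_continuous_mult_zonal_weight[OF n] continuous_intros)
  have "((\<lambda>t. real k * (t ^ (k - 1) * zonal_weight n t) - (n - 1 + real k) * (t ^ (k + 1) * zonal_weight n t))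
      has_integral (real k * m (k - 1) - (n - 1 + real k) * m (k + 1))) ?I"
    by (intro has_integral_diff has_integral_mult_right m)
  moreover have "real k * (t ^ (k - 1) * zonal_weight n t) - (n - 1 + real k) * (t ^ (k + 1) * zonal_weight n t)
     = (real k * t ^ (k - 1) * (1 - t\<^sup>2) - (n - 1) * t ^ (k + 1)) * zonal_weight n t" for t
    by (cases k) (auto simp: algebra_simps power2_eq_square)
  ultimately have "((\<lambda>t. (real k * t ^ (k - 1) * (1 - t\<^sup>2) - (n - 1) * t ^ (k + 1)) * zonal_weight n t)
      has_integral (real k * m (k - 1) - (n - 1 + real k) * m (k + 1))) ?I"
    by (simp only:)
  from has_integral_unique[OF this z] have "real k * m (k - 1) - (n - 1 + real k) * m (k + 1) = 0" .
  then have "(n - 1 + real k) * m (k + 1) / zonal_mass n = real k * m (k - 1) / zonal_mass n" by simp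
  then show ?thesis unfolding zonal_mean_def m_def by (simp only: times_divide_eq_right)
qed

lemma zonal_mean_const:
  assumes "n > 1" shows "zonal_mean n (\<lambda>t. c) = c"
  using zonal_mass(2)[OF assms] by (simp add: zonal_mean_def zonal_mass_def[symmetric])

lemma zonal_mean_add:
  assumes "n > 1" "continuous_on {-1..1} f" "continuous_on {-1..1} g"
  shows "zonal_mean n (\<lambda>t. f t + g t) = zonal_mean n f + zonal_mean n g"
  using assms by (simp add: zonal_mean_def ring_distribs integral_add
    integrable_continuous_mult_zonal_weight add_divide_distrib)

lemma zonal_mean_cmult:
  assumes "n > 1"
  shows "zonal_mean n (\<lambda>t. c * f t) = c * zonal_mean n f"
  by (simp add: zonal_mean_def mult.assoc)

lemma zonal_mean_sum:
  assumes "n > 1" "finite A" "\<And>i. i \<in> A \<Longrightarrow> continuous_on {-1..1} (f i)"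
  shows "zonal_mean n (\<lambda>t. \<Sum>i\<in>A. f i t) = (\<Sum>i\<in>A. zonal_mean n (f i))"
  using assms(2,3)
proof (induction A rule: finite_induct)
  case (insert x F)
  have "zonal_mean n (\<lambda>t. f x t + (\<Sum>i\<in>F. f i t)) = zonal_mean n (f x) + zonal_mean n (\<lambda>t. \<Sum>i\<in>F. f i t)"
    using insert.prems by (intro zonal_mean_add assms(1) continuous_on_sum) auto
  then show ?case using insert by simp
qed (simp add: zonal_mean_const[OF assms(1)])

lemma zonal_mean_mono:
  assumes n: "n > 1" and f: "continuous_on {-1..1} f" and g: "continuous_on {-1..1} g"
    and le: "\<And>t. t \<in> {-1<..<1} \<Longrightarrow> f t \<le> g t"
  shows "zonal_mean n f \<le> zonal_mean n g"
  unfolding zonal_mean_def using zonal_mass(2)[OF n] le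
  by (intro divide_right_mono integral_le integrable_continuous_mult_zonal_weight n f g mult_right_mono) auto

section \<open>The zonal integration formula\<close>

lemma zonal_moment_odd:
  fixes \<sigma> :: "(real ^ 'n) measure"
  assumes n: "CARD('n) \<ge> 2" and \<sigma>: "normalized_rotation_invariant \<sigma>" and z: "norm z = 1" and m: "odd m"
  shows "(\<integral>\<eta>. (\<eta> \<bullet> z) ^ m \<partial>\<sigma>) = 0"
proof -
  have "(\<integral>\<eta>. (\<eta> \<bullet> z) ^ m \<partial>\<sigma>) = (\<integral>\<eta>. (\<eta> \<bullet> (-z)) ^ m \<partial>\<sigma>)"
    by (rule zonal_integral_direction[OF n \<sigma>]) (use z in \<open>auto intro!: continuous_intros\<close>)
  also have "\<dots> = - (\<integral>\<eta>. (\<eta> \<bullet> z) ^ m \<partial>\<sigma>)" using m by simp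
  finally show ?thesis by simp
qed

text \<open>By transitivity \<open>\<integral> (\<eta> \<bullet> y) ^ (2 * j) \<partial>\<sigma>\<close> equals \<open>(y \<bullet> y) ^ j\<close> times its value \<open>M\<close> at a unit vector. For \<open>y = a + b c\<close> both
sides are polynomials in \<open>b\<close>, and the coefficients of \<open>b\<^sup>2\<close> give the claim.\<close>

lemma mixed_moment:
  fixes \<sigma> :: "(real ^ 'n) measure"
  assumes n: "CARD('n) \<ge> 2" and \<sigma>: "normalized_rotation_invariant \<sigma>"
    and a: "norm a = 1" and c: "norm c = 1" and ac: "a \<bullet> c = 0" and j: "j \<ge> 1"
  shows "real (2 * j - 1) * (\<integral>\<eta>. (\<eta> \<bullet> a) ^ (2 * j - 2) * (\<eta> \<bullet> c)\<^sup>2 \<partial>\<sigma>) = (\<integral>\<eta>. (\<eta> \<bullet> a) ^ (2 * j) \<partial>\<sigma>)"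
proof -
  define M where "M = (\<integral>\<eta>. (\<eta> \<bullet> a) ^ (2 * j) \<partial>\<sigma>)"
  define X where "X i = (\<integral>\<eta>. (\<eta> \<bullet> a) ^ (2 * j - i) * (\<eta> \<bullet> c) ^ i \<partial>\<sigma>)" for i
  have int: "integrable \<sigma> (\<lambda>\<eta>. (\<eta> \<bullet> a) ^ k * (\<eta> \<bullet> c) ^ i)" for k i
    by (intro integrable_continuous_sphere[OF \<sigma>] continuous_intros)
  have scaled: "(\<integral>\<eta>. (\<eta> \<bullet> y) ^ (2 * j) \<partial>\<sigma>) = (y \<bullet> y) ^ j * M" if y: "y \<noteq> 0" for y
  proof -
    have "(\<integral>\<eta>. (\<eta> \<bullet> y) ^ (2 * j) \<partial>\<sigma>) = (\<integral>\<eta>. norm y ^ (2 * j) * (\<eta> \<bullet> (y /\<^sub>R norm y)) ^ (2 * j) \<partial>\<sigma>)"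
      using y by (simp add: power_mult_distrib[symmetric] mult.assoc[symmetric])
    also have "\<dots> = norm y ^ (2 * j) * (\<integral>\<eta>. (\<eta> \<bullet> (y /\<^sub>R norm y)) ^ (2 * j) \<partial>\<sigma>)" by simp
    also have "(\<integral>\<eta>. (\<eta> \<bullet> (y /\<^sub>R norm y)) ^ (2 * j) \<partial>\<sigma>) = M"
      unfolding M_def by (rule zonal_integral_direction[OF n \<sigma>]) (use y a in \<open>auto intro!: continuous_intros\<close>)
    finally show ?thesis by (simp add: power_mult power2_norm_eq_inner)
  qed
  \<comment> \<open>the two binomial expansions, of \<open>(\<eta> \<bullet> a + b * (\<eta> \<bullet> c)) ^ (2 * j)\<close> and of \<open>(1 + b\<^sup>2) ^ j\<close>\<close>
  have eq: "(\<Sum>i\<le>2*j. (real (2 * j choose i) * X i) * b ^ i) =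
        (\<Sum>i\<le>2*j. (if even i then real (j choose (i div 2)) * M else 0) * b ^ i)" for b
  proof -
    have bc: "(a + b *\<^sub>R c) \<bullet> (a + b *\<^sub>R c) = 1 + b\<^sup>2"
      using a c ac by (simp add: inner_add_left inner_add_right norm_eq_1 power2_eq_square inner_commute[of c a])
    have nz: "a + b *\<^sub>R c \<noteq> 0"
    proof
      assume "a + b *\<^sub>R c = 0"
      then have "1 + b\<^sup>2 = 0" using bc by simp
      then show False using zero_le_power2[of b] by linarith
    qed
    have "(\<Sum>i\<le>2*j. (real (2 * j choose i) * X i) * b ^ i)
        = (\<Sum>i\<le>2*j. \<integral>\<eta>. real (2 * j choose i) * b ^ i * ((\<eta> \<bullet> a) ^ (2 * j - i) * (\<eta> \<bullet> c) ^ i) \<partial>\<sigma>)"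
      unfolding X_def by (subst Bochner_Integration.integral_mult_right_zero) (simp only: mult_ac)
    also have "\<dots> = (\<integral>\<eta>. (\<Sum>i\<le>2*j. real (2 * j choose i) * b ^ i * ((\<eta> \<bullet> a) ^ (2 * j - i) * (\<eta> \<bullet> c) ^ i)) \<partial>\<sigma>)"
      by (intro Bochner_Integration.integral_sum[symmetric] integrable_mult_right int)
    also have "\<dots> = (\<integral>\<eta>. (\<eta> \<bullet> (a + b *\<^sub>R c)) ^ (2 * j) \<partial>\<sigma>)"
    proof (rule Bochner_Integration.integral_cong[OF refl])
      fix \<eta>
      have "(\<eta> \<bullet> (a + b *\<^sub>R c)) ^ (2 * j) = (b * (\<eta> \<bullet> c) + \<eta> \<bullet> a) ^ (2 * j)"
        by (simp add: inner_add_right add.commute)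
      also have "\<dots> = (\<Sum>i\<le>2*j. real (2 * j choose i) * b ^ i * ((\<eta> \<bullet> a) ^ (2 * j - i) * (\<eta> \<bullet> c) ^ i))"
        by (subst binomial_ring) (simp add: power_mult_distrib mult_ac)
      finally show "(\<Sum>i\<le>2*j. real (2 * j choose i) * b ^ i * ((\<eta> \<bullet> a) ^ (2 * j - i) * (\<eta> \<bullet> c) ^ i))
          = (\<eta> \<bullet> (a + b *\<^sub>R c)) ^ (2 * j)" by simp
    qed
    also have "\<dots> = (b\<^sup>2 + 1) ^ j * M" using scaled[OF nz] bc by (simp add: add.commute)
    also have "\<dots> = (\<Sum>i\<le>j. real (j choose i) * M * b ^ (2 * i))"
      by (subst binomial_ring) (simp add: sum_distrib_left power_mult[symmetric] mult_ac)
    also have "\<dots> = (\<Sum>i\<in>(\<lambda>i. 2 * i) ` {..j}. (real (j choose (i div 2)) * M) * b ^ i)"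
      by (subst sum.reindex) (auto simp: inj_on_def)
    also have "\<dots> = (\<Sum>i\<le>2*j. (if even i then real (j choose (i div 2)) * M else 0) * b ^ i)"
      by (intro sum.mono_neutral_cong_left) (auto elim!: evenE)
    finally show ?thesis .
  qed
  have "real (2 * j choose 2) * X 2 = real (j choose 1) * M"
    using polyfun_eq_coeffs[of "\<lambda>i. real (2 * j choose i) * X i" "2 * j"
      "\<lambda>i. if even i then real (j choose (i div 2)) * M else 0"] eq j
    by (auto dest!: spec[of _ 2])
  moreover have "real (2 * j choose 2) = real j * real (2 * j - 1)"
    by (simp add: choose_two)
  ultimately show ?thesis using j by (simp add: X_def M_def)
qed

text \<open>Insert \<open>\<Sum>i. (\<eta> $ i)\<^sup>2 = 1\<close> into the lower moment; every coordinate other than the pole contributes the same mixed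
moment.\<close>

lemma zonal_moment_recurrence:
  fixes \<sigma> :: "(real ^ 'n) measure"
  assumes n: "CARD('n) \<ge> 2" and \<sigma>: "normalized_rotation_invariant \<sigma>" and z: "norm z = 1" and j: "j \<ge> 1"
  shows "real (CARD('n) + 2 * j - 2) * (\<integral>\<eta>. (\<eta> \<bullet> z) ^ (2 * j) \<partial>\<sigma>)
        = real (2 * j - 1) * (\<integral>\<eta>. (\<eta> \<bullet> z) ^ (2 * j - 2) \<partial>\<sigma>)"
proof -
  define k :: 'n where "k = undefined"
  define e where "e i = (axis i 1 :: real ^ 'n)" for i
  have e: "norm (e i) = 1" "\<eta> \<bullet> e i = \<eta> $ i" for i \<eta>
    by (simp_all add: e_def inner_axis)
  define M where "M m = (\<integral>\<eta>. (\<eta> \<bullet> e k) ^ m \<partial>\<sigma>)" for m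
  have M: "(\<integral>\<eta>. (\<eta> \<bullet> z) ^ m \<partial>\<sigma>) = M m" for m
    unfolding M_def by (rule zonal_integral_direction[OF n \<sigma>]) (use z e in \<open>auto intro!: continuous_intros\<close>)
  have int: "integrable \<sigma> (\<lambda>\<eta>. (\<eta> \<bullet> e k) ^ m * (\<eta> \<bullet> e i) ^ l)" for m i l
    by (intro integrable_continuous_sphere[OF \<sigma>] continuous_intros)
  have mixed: "real (2 * j - 1) * (\<integral>\<eta>. (\<eta> \<bullet> e k) ^ (2 * j - 2) * (\<eta> \<bullet> e i)\<^sup>2 \<partial>\<sigma>) = M (2 * j)" if "i \<noteq> k" for i
    unfolding M_def using that
    by (intro mixed_moment[OF n \<sigma> e(1) e(1) _ j]) (simp add: e(2), simp add: e_def axis_def)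
  have diag: "(\<integral>\<eta>. (\<eta> \<bullet> e k) ^ (2 * j - 2) * (\<eta> \<bullet> e k)\<^sup>2 \<partial>\<sigma>) = M (2 * j)"
  proof -
    have "2 * j - 2 + 2 = 2 * j" using j by simp
    then show ?thesis unfolding M_def power_add[symmetric] by (simp only:)
  qed
  have "M (2 * j - 2) = (\<integral>\<eta>. (\<Sum>i\<in>UNIV. (\<eta> \<bullet> e k) ^ (2 * j - 2) * (\<eta> \<bullet> e i)\<^sup>2) \<partial>\<sigma>)"
    unfolding M_def
  proof (rule Bochner_Integration.integral_cong[OF refl])
    fix \<eta> assume "\<eta> \<in> space \<sigma>"
    then have "\<eta> \<bullet> \<eta> = 1" by (simp add: rotation_invariant_space(1)[OF \<sigma>] norm_eq_1)
    then have "(\<Sum>i\<in>UNIV. (\<eta> \<bullet> e i)\<^sup>2) = 1"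
      unfolding e(2) by (simp add: inner_vec_def power2_eq_square)
    then show "(\<eta> \<bullet> e k) ^ (2 * j - 2) = (\<Sum>i\<in>UNIV. (\<eta> \<bullet> e k) ^ (2 * j - 2) * (\<eta> \<bullet> e i)\<^sup>2)"
      by (simp add: sum_distrib_left[symmetric])
  qed
  also have "\<dots> = (\<Sum>i\<in>UNIV. \<integral>\<eta>. (\<eta> \<bullet> e k) ^ (2 * j - 2) * (\<eta> \<bullet> e i)\<^sup>2 \<partial>\<sigma>)"
    by (rule Bochner_Integration.integral_sum) (rule int)
  also have "\<dots> = M (2 * j) + (\<Sum>i\<in>UNIV-{k}. \<integral>\<eta>. (\<eta> \<bullet> e k) ^ (2 * j - 2) * (\<eta> \<bullet> e i)\<^sup>2 \<partial>\<sigma>)"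
    by (subst sum.remove[of _ k]) (simp_all add: diag)
  finally have "real (2 * j - 1) * M (2 * j - 2)
      = real (2 * j - 1) * M (2 * j) + (\<Sum>i\<in>UNIV-{k}. M (2 * j))"
    using mixed by (simp add: ring_distribs sum_distrib_left)
  also have "\<dots> = real (CARD('n) + 2 * j - 2) * M (2 * j)"
    using n j by (simp add: card_Diff_singleton of_nat_diff algebra_simps)
  finally show ?thesis by (simp add: M)
qed

text \<open>Both sides have vanishing odd moments and obey the same two-step recurrence.\<close>

lemma zonal_moment:
  fixes \<sigma> :: "(real ^ 'n) measure"
  assumes n: "CARD('n) \<ge> 2" and \<sigma>: "normalized_rotation_invariant \<sigma>" and z: "norm z = 1"
  shows "(\<integral>\<eta>. (\<eta> \<bullet> z) ^ m \<partial>\<sigma>) = zonal_mean CARD('n) (\<lambda>t. t ^ m)"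
proof (induction m rule: induct_nat_012)
  case 0
  then show ?case
    using \<sigma> n zonal_mean_const[of "real CARD('n)" 1]
    by (simp add: measure_def rotation_invariant_space(1) normalized_rotation_invariant_def)
next
  case 1
  then show ?case
    using zonal_moment_odd[OF n \<sigma> z, of 1] zonal_mean_moment_recurrence[of "real CARD('n)" 0] n by simp
next
  case (ge2 m)
  have rec: "(real CARD('n) + real m) * zonal_mean CARD('n) (\<lambda>t. t ^ (m + 2))
      = (real m + 1) * zonal_mean CARD('n) (\<lambda>t. t ^ m)"
    using zonal_mean_moment_recurrence[of "real CARD('n)" "m + 1"] n by (simp add: algebra_simps)
  have "(real CARD('n) + real m) * (\<integral>\<eta>. (\<eta> \<bullet> z) ^ (m + 2) \<partial>\<sigma>) = (real m + 1) * (\<integral>\<eta>. (\<eta> \<bullet> z) ^ m \<partial>\<sigma>)"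
  proof (cases "even m")
    case True
    then obtain i where "m = 2 * i" by (elim evenE)
    then show ?thesis using zonal_moment_recurrence[OF n \<sigma> z, of "i + 1"] by (simp add: algebra_simps)
  next
    case False
    then show ?thesis using zonal_moment_odd[OF n \<sigma> z, of m] zonal_moment_odd[OF n \<sigma> z, of "m + 2"] by simp
  qed
  then have "(real CARD('n) + real m) * (\<integral>\<eta>. (\<eta> \<bullet> z) ^ (m + 2) \<partial>\<sigma>)
      = (real CARD('n) + real m) * zonal_mean CARD('n) (\<lambda>t. t ^ (m + 2))"
    using rec ge2 by simp
  then show ?case using n by (simp add: add_pos_nonneg)
qed

text \<open>Equality of moments extends to continuous functions by uniform polynomial approximation.\<close>

lemma zonal_integral:
  fixes \<sigma> :: "(real ^ 'n) measure" and h :: "real \<Rightarrow> real"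
  assumes n: "CARD('n) \<ge> 2" and \<sigma>: "normalized_rotation_invariant \<sigma>" and z: "norm z = 1"
    and h: "continuous_on {-1..1} h"
  shows "(\<integral>\<eta>. h (\<eta> \<bullet> z) \<partial>\<sigma>) = zonal_mean CARD('n) h"
proof -
  interpret finite_measure \<sigma> using rotation_invariant_space(2)[OF \<sigma>] .
  have m1: "measure \<sigma> (space \<sigma>) = 1"
    using \<sigma> by (simp add: measure_def rotation_invariant_space(1)[OF \<sigma>] normalized_rotation_invariant_def)
  have n1: "real CARD('n) > 1" using n by simp
  note int = integrable_continuous_sphere[OF \<sigma> continuous_zonal[OF _ z]]
  have "\<bar>(\<integral>\<eta>. h (\<eta> \<bullet> z) \<partial>\<sigma>) - zonal_mean CARD('n) h\<bar> \<le> 2 * e" if e: "e > 0" for e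
  proof -
    obtain p where p: "real_polynomial_function p" "\<And>x. x \<in> {-1..1} \<Longrightarrow> \<bar>h x - p x\<bar> < e"
      using Stone_Weierstrass_real_polynomial_function[OF _ h e] by blast
    then obtain a N where pa: "p = (\<lambda>x. \<Sum>i\<le>N. a i * x ^ i)"
      by (auto simp: real_polynomial_function_iff_sum)
    have cp: "continuous_on {-1..1} p" unfolding pa by (intro continuous_intros)
    have "(\<integral>\<eta>. p (\<eta> \<bullet> z) \<partial>\<sigma>) = (\<Sum>i\<le>N. a i * (\<integral>\<eta>. (\<eta> \<bullet> z) ^ i \<partial>\<sigma>))"
      unfolding pa
      by (subst Bochner_Integration.integral_sum) (auto intro!: integrable_mult_right int continuous_intros)
    also have "\<dots> = (\<Sum>i\<le>N. zonal_mean CARD('n) (\<lambda>t. a i * t ^ i))"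
      by (simp add: zonal_moment[OF n \<sigma> z] zonal_mean_cmult[OF n1])
    also have "\<dots> = zonal_mean CARD('n) p"
      unfolding pa by (rule zonal_mean_sum[OF n1, symmetric]) (auto intro!: continuous_intros)
    finally have eq: "(\<integral>\<eta>. p (\<eta> \<bullet> z) \<partial>\<sigma>) = zonal_mean CARD('n) p" .
    have "\<bar>(\<integral>\<eta>. h (\<eta> \<bullet> z) \<partial>\<sigma>) - (\<integral>\<eta>. p (\<eta> \<bullet> z) \<partial>\<sigma>)\<bar> = \<bar>\<integral>\<eta>. h (\<eta> \<bullet> z) - p (\<eta> \<bullet> z) \<partial>\<sigma>\<bar>"
      by (simp add: int h cp)
    also have "\<dots> \<le> (\<integral>\<eta>. \<bar>h (\<eta> \<bullet> z) - p (\<eta> \<bullet> z)\<bar> \<partial>\<sigma>)"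
      by (rule integral_abs_bound)
    also have "\<dots> \<le> (\<integral>\<eta>. e \<partial>\<sigma>)"
      using p(2) inner_sphere_interval[OF _ z]
      by (intro integral_mono) (auto intro!: int[of "\<lambda>t. \<bar>h t - p t\<bar>"] continuous_intros h cp less_imp_le
        simp: rotation_invariant_space(1)[OF \<sigma>] simp del: atLeastAtMost_iff)
    finally have 1: "\<bar>(\<integral>\<eta>. h (\<eta> \<bullet> z) \<partial>\<sigma>) - (\<integral>\<eta>. p (\<eta> \<bullet> z) \<partial>\<sigma>)\<bar> \<le> e" by (simp add: m1)
    have p_le: "h t \<le> p t + e \<and> p t - e \<le> h t" if "- 1 < t" "t < 1" for t
      using p(2)[of t] that by (simp add: abs_less_iff)
    have "zonal_mean CARD('n) h \<le> zonal_mean CARD('n) (\<lambda>t. p t + e)"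
      by (intro zonal_mean_mono n1 h continuous_intros cp) (auto dest!: p_le)
    moreover have "zonal_mean CARD('n) (\<lambda>t. p t - e) \<le> zonal_mean CARD('n) h"
      by (intro zonal_mean_mono n1 h continuous_intros cp) (auto dest!: p_le)
    moreover have "zonal_mean CARD('n) (\<lambda>t. p t + e) = zonal_mean CARD('n) p + e"
      "zonal_mean CARD('n) (\<lambda>t. p t - e) = zonal_mean CARD('n) p - e"
      using zonal_mean_add[OF n1 cp, of "\<lambda>t. e"] zonal_mean_add[OF n1 cp, of "\<lambda>t. - e"]
      by (simp_all add: zonal_mean_const[OF n1])
    ultimately show ?thesis using 1 eq by linarith
  qed
  note close = this
  have "\<bar>(\<integral>\<eta>. h (\<eta> \<bullet> z) \<partial>\<sigma>) - zonal_mean CARD('n) h\<bar> \<le> 0"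
  proof (rule field_le_epsilon)
    fix e :: real assume "e > 0"
    then show "\<bar>(\<integral>\<eta>. h (\<eta> \<bullet> z) \<partial>\<sigma>) - zonal_mean CARD('n) h\<bar> \<le> 0 + e"
      using close[of "e / 2"] by simp
  qed
  then show ?thesis by simp
qed

section \<open>The mass of the Poisson kernel\<close>

text \<open>This is \<open>|r z - \<eta>|\<^sup>2\<close> for unit vectors with \<open>\<eta> \<bullet> z = t\<close>.\<close>

definition sphere_dist2 :: "real \<Rightarrow> real \<Rightarrow> real" where
  "sphere_dist2 r t = 1 + r\<^sup>2 - 2 * r * t"

lemma sphere_dist2_pos_off_pole:
  assumes "t \<in> {-1..<1}" "0 \<le> r"
  shows "sphere_dist2 r t > 0"
proof -
  have "sphere_dist2 r t = (1 - r)\<^sup>2 + 2 * r * (1 - t)"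
    by (simp add: sphere_dist2_def power2_eq_square algebra_simps)
  then show ?thesis using assms by (cases "r = 0") (auto intro!: add_nonneg_pos simp: sphere_dist2_def)
qed

lemma sphere_dist2_pos_inside:
  assumes "t \<in> {-1..1}" "0 \<le> r" "r < 1"
  shows "sphere_dist2 r t > 0"
proof -
  have "sphere_dist2 r t = (1 - r)\<^sup>2 + 2 * r * (1 - t)"
    by (simp add: sphere_dist2_def power2_eq_square algebra_simps)
  moreover have "(1 - r)\<^sup>2 > 0" "2 * r * (1 - t) \<ge> 0" using assms by auto
  ultimately show ?thesis by linarith
qed

lemma continuous_sphere_dist2_powr:
  assumes "0 \<le> r" "r < 1"
  shows "continuous_on {-1..1} (\<lambda>t. sphere_dist2 r t powr p)"
proof -
  have "sphere_dist2 r t \<noteq> 0" if "t \<in> {-1..1}" for t using sphere_dist2_pos_inside[OF that assms] by simp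
  then show ?thesis unfolding sphere_dist2_def by (intro continuous_intros) auto
qed

text \<open>Absolute integrability makes the substitution valid for integrands that are unbounded at the ends of the interval,
as the weight is for \<open>n < 3\<close>.\<close>

lemma integral_change_of_variable:
  fixes g g' :: "real \<Rightarrow> real"
  assumes der: "\<And>t. t \<in> {-1<..<1} \<Longrightarrow> (g has_real_derivative g' t) (at t)"
    and inj: "inj_on g {-1<..<1}" and onto: "g ` {-1<..<1} = {-1<..<1}"
    and eq: "\<And>t. t \<in> {-1<..<1} \<Longrightarrow> \<bar>g' t\<bar> * f (g t) = h t"
    and f: "f absolutely_integrable_on {-1<..<1}"
  shows "integral {-1<..<1} h = integral {-1<..<1} f"
proof -
  have "integral {-1<..<1} (\<lambda>x. \<bar>g' x\<bar> * f (g x)) = integral {-1<..<1} f"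
    using has_absolute_integral_change_of_variables_1'[of "{-1<..<1}" g g' f "integral {-1<..<1} f"]
      der inj onto f by (auto intro: has_field_derivative_at_within)
  then show ?thesis using eq by (metis (no_types, lifting) integral_cong)
qed

text \<open>Let \<open>D\<close> stand for \<open>sphere_dist2 r\<close>. The Moebius involution of the ball that exchanges \<open>0\<close> and \<open>r z\<close> acts on
latitudes by \<open>T t = (2 r - (1 + r\<^sup>2) t) / D t\<close>. It satisfies \<open>D (T t) * D t = (1 - r\<^sup>2)\<^sup>2\<close>, and it transforms the surface
measure by the factor \<open>((1 - r\<^sup>2) / D t) ^ (n - 1)\<close>. With \<open>b = (n + \<alpha>) / 2\<close> it removes the factor
\<open>(1 - r\<^sup>2) powr (1 + \<alpha>)\<close> of the Poisson kernel, so that the limit \<open>r \<rightarrow> 1\<close> becomes accessible.\<close>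

lemma moebius_substitution:
  assumes n: "n > 1" and r: "0 \<le> r" "r < 1"
  shows "zonal_mean n (\<lambda>t. sphere_dist2 r t powr (- b))
       = (1 - r\<^sup>2) powr (n - 1 - 2 * b) * zonal_mean n (\<lambda>t. sphere_dist2 r t powr (b - (n - 1)))"
proof -
  let ?I = "{-1<..<1::real}" and ?D = "sphere_dist2 r"
  define T where "T t = (2 * r - (1 + r\<^sup>2) * t) / ?D t" for t
  define q where "q = 1 - r\<^sup>2"
  have q: "q > 0" using r by (simp add: q_def abs_square_less_1)
  have D: "?D t > 0" if "t \<in> ?I" for t using sphere_dist2_pos_inside[of t r] r that by auto
  have one_minus: "1 - T t = (1 - r)\<^sup>2 * (1 + t) / ?D t" if "t \<in> ?I" for t
    using D[OF that] by (simp add: T_def field_simps) (simp add: sphere_dist2_def algebra_simps power2_eq_square)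
  have one_plus: "1 + T t = (1 + r)\<^sup>2 * (1 - t) / ?D t" if "t \<in> ?I" for t
    using D[OF that] by (simp add: T_def field_simps) (simp add: sphere_dist2_def algebra_simps power2_eq_square)
  have TI: "T t \<in> ?I" if "t \<in> ?I" for t
  proof -
    have "(1 - r)\<^sup>2 * (1 + t) / ?D t > 0" "(1 + r)\<^sup>2 * (1 - t) / ?D t > 0"
      using D[OF that] that r by (auto intro!: divide_pos_pos mult_pos_pos)
    then have "1 - T t > 0" "1 + T t > 0" using one_minus[OF that] one_plus[OF that] by simp_all
    then show ?thesis by simp
  qed
  have DT: "?D (T t) = q\<^sup>2 / ?D t" if "t \<in> ?I" for t
  proof -
    have "?D (T t) = ((1 + r\<^sup>2) * ?D t - 2 * r * (2 * r - (1 + r\<^sup>2) * t)) / ?D t"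
      using D[OF that] by (simp add: T_def sphere_dist2_def[of r "_ / _"] field_simps)
    also have "(1 + r\<^sup>2) * ?D t - 2 * r * (2 * r - (1 + r\<^sup>2) * t) = q\<^sup>2"
      by (simp add: sphere_dist2_def q_def algebra_simps power2_eq_square)
    finally show ?thesis .
  qed
  \<comment> \<open>as an involution of the interval, \<open>T\<close> is injective and onto\<close>
  have TT: "T (T t) = t" if "t \<in> ?I" for t
  proof -
    have "2 * r - (1 + r\<^sup>2) * T t = (2 * r * ?D t - (1 + r\<^sup>2) * (2 * r - (1 + r\<^sup>2) * t)) / ?D t"
      using D[OF that] by (simp add: T_def field_simps)
    also have "2 * r * ?D t - (1 + r\<^sup>2) * (2 * r - (1 + r\<^sup>2) * t) = q\<^sup>2 * t"
      by (simp add: sphere_dist2_def q_def algebra_simps power2_eq_square)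
    finally have "2 * r - (1 + r\<^sup>2) * T t = q\<^sup>2 * t / ?D t" .
    then show ?thesis using DT[OF that] D[OF that] q by (simp add: T_def[of "T t"])
  qed
  have der: "(T has_real_derivative - q\<^sup>2 / (?D t)\<^sup>2) (at t)" if "t \<in> ?I" for t
  proof -
    have "(T has_real_derivative ((- (1 + r\<^sup>2)) * ?D t - (2 * r - (1 + r\<^sup>2) * t) * (- 2 * r)) / (?D t * ?D t)) (at t)"
      unfolding T_def using D[OF that]
      by (intro DERIV_divide) (auto simp: sphere_dist2_def intro!: derivative_eq_intros)
    moreover have "(- (1 + r\<^sup>2)) * ?D t - (2 * r - (1 + r\<^sup>2) * t) * (- 2 * r) = - q\<^sup>2"
      by (simp add: sphere_dist2_def q_def algebra_simps power2_eq_square)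
    ultimately show ?thesis by (simp add: power2_eq_square)
  qed
  have f: "(\<lambda>t. ?D t powr (- b) * zonal_weight n t) absolutely_integrable_on ?I"
    using integrable_continuous_mult_zonal_weight[OF n continuous_sphere_dist2_powr[OF r]]
    by (intro nonnegative_absolutely_integrable_1) auto
  have "integral ?I (\<lambda>t. q powr (n - 1 - 2 * b) * (?D t powr (b - (n - 1)) * zonal_weight n t))
      = integral ?I (\<lambda>t. ?D t powr (- b) * zonal_weight n t)"
  proof (rule integral_change_of_variable[OF der _ _ _ f])
    show "inj_on T ?I" by (rule inj_on_inverseI[of _ T]) (rule TT)
    show "T ` ?I = ?I"
    proof (intro equalityI subsetI)
      fix t :: real assume "t \<in> ?I"
      then show "t \<in> T ` ?I" using TT TI by (metis image_eqI)
    qed (use TI in auto)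
    fix t :: real assume t: "t \<in> ?I"
    have "1 - (T t)\<^sup>2 = (1 - T t) * (1 + T t)" by (simp add: power2_eq_square algebra_simps)
    also have "\<dots> = q\<^sup>2 * (1 - t\<^sup>2) / (?D t)\<^sup>2"
      unfolding one_minus[OF t] one_plus[OF t] by (simp add: q_def power2_eq_square algebra_simps)
    finally have w: "1 - (T t)\<^sup>2 = q\<^sup>2 * (1 - t\<^sup>2) / (?D t)\<^sup>2" .
    have t2: "1 - t\<^sup>2 > 0" using t by (simp add: abs_square_less_1 abs_less_iff)
    define m where "m = (n - 3) / 2"
    have n3: "n = 2 * m + 3" by (simp add: m_def field_simps)
    have sq: "x\<^sup>2 powr p = x powr (2 * p)" if "x > 0" for x p :: real
      using that by (simp add: powr_powr powr_numeral[symmetric] del: powr_numeral)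
    have "\<bar>- q\<^sup>2 / (?D t)\<^sup>2\<bar> = q powr 2 * ?D t powr (-2)"
      using D[OF t] q by (simp add: powr_minus_divide)
    moreover have "?D (T t) powr (- b) = q powr (- 2 * b) * ?D t powr b"
      unfolding DT[OF t] using D[OF t] q by (simp add: powr_divide sq powr_minus_divide)
    moreover have "zonal_weight n (T t) = q powr (2 * m) * (1 - t\<^sup>2) powr m * ?D t powr (- 2 * m)"
      unfolding zonal_weight_def w m_def[symmetric]
      using D[OF t] q t2 by (simp add: powr_divide powr_mult sq powr_minus_divide)
    ultimately have "\<bar>- q\<^sup>2 / (?D t)\<^sup>2\<bar> * (?D (T t) powr (- b) * zonal_weight n (T t))
       = q powr 2 * ?D t powr (-2) * ((q powr (- 2 * b) * ?D t powr b) * (q powr (2 * m) * (1 - t\<^sup>2) powr m * ?D t powr (- 2 * m)))"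
      by (simp only:)
    also have "\<dots> = (q powr 2 * q powr (- 2 * b) * q powr (2 * m)) * ((?D t powr (-2) * ?D t powr b * ?D t powr (- 2 * m)) * (1 - t\<^sup>2) powr m)"
      by (simp only: mult_ac)
    also have "\<dots> = q powr (n - 1 - 2 * b) * (?D t powr (b - (n - 1)) * zonal_weight n t)"
    proof -
      have e: "2 + - 2 * b + 2 * m = n - 1 - 2 * b" "- 2 + b + - 2 * m = b - (n - 1)"
        by (simp_all add: n3)
      show ?thesis unfolding powr_add[symmetric] e by (simp only: zonal_weight_def m_def)
    qed
    finally show "\<bar>- q\<^sup>2 / (?D t)\<^sup>2\<bar> * (?D (T t) powr (- b) * zonal_weight n (T t))
       = q powr (n - 1 - 2 * b) * (?D t powr (b - (n - 1)) * zonal_weight n t)" .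
  qed
  then show ?thesis by (simp add: zonal_mean_def q_def)
qed

text \<open>Seen from the interior point \<open>r z\<close>, the point of latitude \<open>t\<close> lies in a direction whose angle with the axis has
cosine \<open>S t = (t - r) / sqrt (D t)\<close>, where \<open>D\<close> is \<open>sphere_dist2 r\<close>. The integrand is the density of the solid angle,
so the mean is that of \<open>1\<close> over the sphere of directions.\<close>

lemma solid_angle_substitution:
  assumes n: "n > 1" and r: "0 \<le> r" "r < 1"
  shows "zonal_mean n (\<lambda>t. (1 - r * t) * sphere_dist2 r t powr (- n / 2)) = 1"
proof -
  let ?I = "{-1<..<1::real}" and ?D = "sphere_dist2 r"
  define S where "S t = (t - r) * ?D t powr (-1/2)" for t
  have D': "?D t > 0" if "t \<in> {-1..1}" for t using sphere_dist2_pos_inside[OF that r] .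
  then have D: "?D t > 0" if "t \<in> ?I" for t using that by auto
  have rt: "1 - r * t > 0" if "t \<in> ?I" for t
  proof -
    have "r * t \<le> r * 1" using r that by (intro mult_left_mono) auto
    then show ?thesis using r by simp
  qed
  have w: "1 - (S t)\<^sup>2 = (1 - t\<^sup>2) / ?D t" if "t \<in> ?I" for t
  proof -
    have "(?D t powr (-1/2))\<^sup>2 = ?D t powr (-1/2 + -1/2)"
      unfolding power2_eq_square powr_add ..
    also have "\<dots> = 1 / ?D t" using D[OF that] by (simp add: powr_minus_divide)
    finally have "(S t)\<^sup>2 = (t - r)\<^sup>2 / ?D t" by (simp add: S_def power_mult_distrib)
    then have "1 - (S t)\<^sup>2 = (?D t - (t - r)\<^sup>2) / ?D t" using D[OF that] by (simp add: diff_divide_distrib)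
    moreover have "?D t - (t - r)\<^sup>2 = 1 - t\<^sup>2" by (simp add: sphere_dist2_def power2_eq_square algebra_simps)
    ultimately show ?thesis by simp
  qed
  have der: "(S has_real_derivative (1 - r * t) * ?D t powr (-3/2)) (at t)" if "t \<in> ?I" for t
  proof -
    have "(S has_real_derivative 1 * ?D t powr (-1/2) + ((-1/2) * ?D t powr (-1/2 - 1) * (- 2 * r)) * (t - r)) (at t)"
      unfolding S_def using D[OF that]
      by (intro DERIV_mult) (auto simp: sphere_dist2_def intro!: derivative_eq_intros)
    moreover have "?D t powr (-1/2) = ?D t * ?D t powr (-3/2)"
    proof -
      have "?D t powr (-1/2) = ?D t powr (1 + -3/2)" by simp
      then show ?thesis using D[OF that] by (simp only: powr_add) simp
    qed
    moreover have "?D t powr (-1/2 - 1) = ?D t powr (-3/2)" by simp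
    moreover have "?D t * X + ((-1/2) * X * (- 2 * r)) * (t - r) = (1 - r * t) * X" for X
      by (simp add: sphere_dist2_def power2_eq_square algebra_simps)
    ultimately show ?thesis by (simp only: mult_1)
  qed
  have cont: "continuous_on {-1..1} S"
    unfolding S_def by (intro continuous_intros continuous_sphere_dist2_powr r)
  have mono: "S x < S y" if "-1 \<le> x" "x < y" "y \<le> 1" for x y
  proof (rule DERIV_pos_imp_increasing_open[OF that(2)])
    fix z assume z: "x < z" "z < y"
    then have "z \<in> ?I" using that by simp
    then show "\<exists>d. (S has_real_derivative d) (at z) \<and> d > 0"
      using der[of z] rt[of z] D[of z] by (intro exI[of _ "(1 - r * z) * ?D z powr (-3/2)"]) simp
  qed (rule continuous_on_subset[OF cont], use that in auto)
  have ends: "S 1 = 1" "S (-1) = -1"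
  proof -
    have e: "?D 1 = (1 - r)\<^sup>2" "?D (-1) = (1 + r)\<^sup>2"
      by (simp_all add: sphere_dist2_def power2_eq_square algebra_simps)
    have p: "(x\<^sup>2) powr (-1/2) = 1 / x" if "x > 0" for x :: real
      using that by (simp add: powr_minus_divide powr_half_sqrt)
    show "S 1 = 1" using r p[of "1 - r"] by (simp add: S_def e)
    have "(-1 - r) * (1 / (1 + r)) = -1" using r by (simp add: field_simps)
    then show "S (-1) = -1" using r p[of "1 + r"] unfolding S_def e by simp
  qed
  have "integral ?I (\<lambda>t. (1 - r * t) * ?D t powr (- n / 2) * zonal_weight n t) = integral ?I (zonal_weight n)"
  proof (rule integral_change_of_variable[OF der])
    show "inj_on S ?I"
    proof (rule inj_onI)
      fix x y assume "x \<in> ?I" "y \<in> ?I" "S x = S y"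
      then show "x = y" using mono[of x y] mono[of y x] by (cases x y rule: linorder_cases) auto
    qed
    show "S ` ?I = ?I"
    proof (intro equalityI subsetI)
      fix s assume s: "s \<in> ?I"
      then obtain t where t: "-1 \<le> t" "t \<le> 1" "S t = s"
        using IVT'[of S "-1" s 1] cont ends by auto
      moreover have "t \<noteq> 1" "t \<noteq> -1" using t s ends by auto
      ultimately show "s \<in> S ` ?I" by (intro image_eqI[of _ _ t]) auto
    next
      fix s assume "s \<in> S ` ?I"
      then show "s \<in> ?I" using mono[of "-1"] mono[of _ 1] ends by force
    qed
    fix t :: real assume t: "t \<in> ?I"
    have t2: "1 - t\<^sup>2 > 0" using t by (simp add: abs_square_less_1 abs_less_iff)
    have "\<bar>(1 - r * t) * ?D t powr (-3/2)\<bar> * zonal_weight n (S t)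
       = (1 - r * t) * (?D t powr (-3/2) * ?D t powr (- ((n - 3) / 2))) * zonal_weight n t"
      using rt[OF t] D[OF t] t2 by (simp add: zonal_weight_def w[OF t] powr_divide powr_minus_divide)
    also have "?D t powr (-3/2) * ?D t powr (- ((n - 3) / 2)) = ?D t powr (- n / 2)"
      by (simp add: powr_add[symmetric] field_simps)
    finally show "\<bar>(1 - r * t) * ?D t powr (-3/2)\<bar> * zonal_weight n (S t)
       = (1 - r * t) * ?D t powr (- n / 2) * zonal_weight n t" .
  next
    show "zonal_weight n absolutely_integrable_on ?I"
      using has_integral_zonal_weight[OF n]
      by (intro nonnegative_absolutely_integrable_1) (auto simp: integrable_on_def)
  qed
  then show ?thesis using zonal_mass(2)[OF n] by (simp add: zonal_mean_def zonal_mass_def)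
qed

text \<open>The harmonic Poisson kernel has mass \<open>1\<close>: the solid angle density splits into halves of the kernel and of
\<open>D powr (1 - n / 2)\<close>, which have the same mean by the Moebius involution.\<close>

lemma zonal_mean_poisson:
  assumes n: "n > 1" and r: "0 \<le> r" "r < 1"
  shows "zonal_mean n (\<lambda>t. (1 - r\<^sup>2) * sphere_dist2 r t powr (- n / 2)) = 1"
proof -
  note c = continuous_sphere_dist2_powr[OF r]
  define A where "A = zonal_mean n (\<lambda>t. (1 - r\<^sup>2) * sphere_dist2 r t powr (- n / 2))"
  have q: "1 - r\<^sup>2 > 0" using r by (simp add: abs_square_less_1)
  have e: "n / 2 - (n - 1) = 1 - n / 2" by simp
  have "A = (1 - r\<^sup>2) * zonal_mean n (\<lambda>t. sphere_dist2 r t powr (- n / 2))"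
    unfolding A_def by (rule zonal_mean_cmult[OF n])
  also have "\<dots> = (1 - r\<^sup>2) * (1 - r\<^sup>2) powr (- 1) * zonal_mean n (\<lambda>t. sphere_dist2 r t powr (1 - n / 2))"
    using moebius_substitution[OF n r, of "n / 2"] unfolding e by simp
  also have "(1 - r\<^sup>2) * (1 - r\<^sup>2) powr (- 1) = 1" using q by (simp add: powr_minus)
  finally have A: "A = zonal_mean n (\<lambda>t. sphere_dist2 r t powr (1 - n / 2))" by simp
  \<comment> \<open>\<open>2 (1 - r t) = (1 - r\<^sup>2) + sphere_dist2 r t\<close>\<close>
  have "2 = zonal_mean n (\<lambda>t. 2 * ((1 - r * t) * sphere_dist2 r t powr (- n / 2)))"
    using solid_angle_substitution[OF n r] by (simp add: zonal_mean_cmult[OF n])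
  also have "\<dots> = zonal_mean n (\<lambda>t. (1 - r\<^sup>2) * sphere_dist2 r t powr (- n / 2) + sphere_dist2 r t powr (1 - n / 2))"
    unfolding zonal_mean_def
  proof (rule arg_cong[where f = "\<lambda>x. x / _"], rule integral_cong)
    fix t :: real assume "t \<in> {-1<..<1}"
    then have D: "sphere_dist2 r t > 0" using sphere_dist2_pos_inside[of t r] r by auto
    have "sphere_dist2 r t powr (1 + - n / 2) = sphere_dist2 r t * sphere_dist2 r t powr (- n / 2)"
      using D by (simp only: powr_add) simp
    moreover have "2 * (1 - r * t) = (1 - r\<^sup>2) + sphere_dist2 r t"
      by (simp add: sphere_dist2_def)
    ultimately have "2 * (1 - r * t) * sphere_dist2 r t powr (- n / 2) =
        (1 - r\<^sup>2) * sphere_dist2 r t powr (- n / 2) + sphere_dist2 r t powr (1 + - n / 2)"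
      by (simp only: distrib_right)
    then have "2 * (1 - r * t) * sphere_dist2 r t powr (- n / 2) =
        (1 - r\<^sup>2) * sphere_dist2 r t powr (- n / 2) + sphere_dist2 r t powr (1 - n / 2)"
      by simp
    then show "2 * ((1 - r * t) * sphere_dist2 r t powr (- n / 2)) * zonal_weight n t =
        ((1 - r\<^sup>2) * sphere_dist2 r t powr (- n / 2) + sphere_dist2 r t powr (1 - n / 2)) * zonal_weight n t"
      by (simp only: mult.assoc)
  qed
  also have "\<dots> = A + zonal_mean n (\<lambda>t. sphere_dist2 r t powr (1 - n / 2))"
    unfolding A_def by (intro zonal_mean_add n c continuous_intros)
  finally show ?thesis using A by (simp add: A_def)
qed

section \<open>Radial limits of zonal means\<close>

lemma sphere_dist2_bounds:
  assumes "t \<in> {-1..1}" "1 / 2 \<le> r" "r \<le> 1"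
  shows "1 - t \<le> sphere_dist2 r t" "sphere_dist2 r t \<le> 4" "(r - t)\<^sup>2 \<le> sphere_dist2 r t"
proof -
  have e: "sphere_dist2 r t = (1 - r)\<^sup>2 + (2 * r) * (1 - t)"
    by (simp add: sphere_dist2_def power2_eq_square algebra_simps)
  have "1 * (1 - t) \<le> (2 * r) * (1 - t)" using assms by (intro mult_right_mono) auto
  then have "1 - t \<le> (2 * r) * (1 - t)" by (simp only: mult_1)
  then show "1 - t \<le> sphere_dist2 r t" unfolding e using zero_le_power2[of "1 - r"] by linarith
  have "r\<^sup>2 \<le> 1" "r * (-1) \<le> r * t"
    using assms mult_left_mono[of "-1" t r] by (auto simp: abs_square_le_1)
  then show "sphere_dist2 r t \<le> 4" unfolding sphere_dist2_def using assms by (simp add: mult.assoc)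
  have "t\<^sup>2 \<le> 1" using assms by (auto simp: abs_square_le_1)
  moreover have "sphere_dist2 r t = (r - t)\<^sup>2 + (1 - t\<^sup>2)"
    by (simp add: sphere_dist2_def power2_eq_square algebra_simps)
  ultimately show "(r - t)\<^sup>2 \<le> sphere_dist2 r t" by linarith
qed

lemma zonal_mean_dominated_convergence:
  assumes int: "\<And>m. (\<lambda>t. f m t * zonal_weight n t) integrable_on {-1<..<1}"
    and k: "(\<lambda>t. k t * zonal_weight n t) integrable_on {-1<..<1}"
    and le: "\<And>m t. t \<in> {-1<..<1} \<Longrightarrow> \<bar>f m t\<bar> \<le> k t"
    and lim: "\<And>t. t \<in> {-1<..<1} \<Longrightarrow> (\<lambda>m. f m t) \<longlonglongrightarrow> g t"
  shows "(\<lambda>m. zonal_mean n (f m)) \<longlonglongrightarrow> zonal_mean n g"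
proof -
  have "(\<lambda>m. integral {-1<..<1} (\<lambda>t. f m t * zonal_weight n t)) \<longlonglongrightarrow> integral {-1<..<1} (\<lambda>t. g t * zonal_weight n t)"
  proof (rule dominated_convergence(2)[OF int k])
    fix m and t :: real assume t: "t \<in> {-1<..<1}"
    show "norm (f m t * zonal_weight n t) \<le> k t * zonal_weight n t"
      using le[OF t] by (simp add: abs_mult mult_right_mono)
    show "(\<lambda>m. f m t * zonal_weight n t) \<longlonglongrightarrow> g t * zonal_weight n t"
      by (intro tendsto_mult lim t tendsto_const)
  qed
  from tendsto_mult_right[OF this, of "1 / zonal_mass n"] show ?thesis by (simp add: zonal_mean_def)
qed

lemma zonal_mean_dominated_convergence_at_left:
  assumes int: "\<And>r. r \<in> {1/2<..<1} \<Longrightarrow> (\<lambda>t. f r t * zonal_weight n t) integrable_on {-1<..<1}"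
    and k: "(\<lambda>t. k t * zonal_weight n t) integrable_on {-1<..<1}"
    and le: "\<And>r t. r \<in> {1/2<..<1} \<Longrightarrow> t \<in> {-1<..<1} \<Longrightarrow> \<bar>f r t\<bar> \<le> k t"
    and lim: "\<And>t. t \<in> {-1<..<1} \<Longrightarrow> ((\<lambda>r. f r t) \<longlongrightarrow> g t) (at_left 1)"
  shows "((\<lambda>r. zonal_mean n (f r)) \<longlongrightarrow> zonal_mean n g) (at_left (1::real))"
proof (rule tendsto_at_left_sequentially)
  show "1 / 2 < (1::real)" by simp
  fix S :: "nat \<Rightarrow> real" assume S: "\<And>m. S m < 1" "\<And>m. 1 / 2 < S m" "S \<longlonglongrightarrow> 1"
  have "filterlim S (at_left 1) sequentially"
    using S by (intro tendsto_imp_filterlim_at_left) auto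
  then have "(\<lambda>m. f (S m) t) \<longlonglongrightarrow> g t" if "t \<in> {-1<..<1}" for t
    using filterlim_compose[OF lim[OF that]] by blast
  then show "(\<lambda>m. zonal_mean n (f (S m))) \<longlonglongrightarrow> zonal_mean n g"
    using S int le by (intro zonal_mean_dominated_convergence[OF _ k]) auto
qed

text \<open>Legendre's duplication formula, carried over from the complex plane.\<close>

lemma Gamma_duplication_real:
  assumes z: "z > (0::real)"
  shows "Gamma z * Gamma (z + 1 / 2) = 2 powr (1 - 2 * z) * sqrt pi * Gamma (2 * z)"
proof -
  have nonpos: "complex_of_real x \<notin> \<int>\<^sub>\<le>\<^sub>0" if "x > 0" for x
  proof
    assume "complex_of_real x \<in> \<int>\<^sub>\<le>\<^sub>0"
    then obtain k where "complex_of_real x = of_int k" "k \<le> 0" by (elim nonpos_Ints_cases)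
    then have "x = of_int k" by (metis of_real_eq_iff of_real_of_int_eq)
    then show False using that \<open>k \<le> 0\<close> by simp
  qed
  have "complex_of_real (Gamma z * Gamma (z + 1 / 2)) = Gamma (of_real z) * Gamma (of_real z + 1 / 2)"
    using Gamma_complex_of_real[of z] Gamma_complex_of_real[of "z + 1 / 2"] by simp
  also have "\<dots> = exp ((1 - 2 * of_real z) * of_real (ln 2)) * of_real (sqrt pi) * Gamma (2 * of_real z)"
    using nonpos[of z] nonpos[of "z + 1 / 2"] z by (intro Gamma_legendre_duplication) auto
  also have "\<dots> = complex_of_real (2 powr (1 - 2 * z) * sqrt pi * Gamma (2 * z))"
    using Gamma_complex_of_real[of "2 * z"] by (simp add: powr_def exp_of_real[symmetric])
  finally show ?thesis by (simp only: of_real_eq_iff)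
qed

text \<open>The mass of the weighted kernel tends to \<open>1\<close> at the boundary. The mean is a quotient of Beta
values, and the duplication formula at \<open>(\<alpha> + 1) / 2\<close> and at \<open>(n - 1) / 2\<close> cancels it against the constant.\<close>

lemma poisson_const_normalizes:
  assumes N: "N \<ge> 2" and \<alpha>: "\<alpha> > real N - 2"
  shows "poisson_const N \<alpha> * zonal_mean N (\<lambda>t. (2 - 2 * t) powr ((\<alpha> + 2 - real N) / 2)) = 1"
proof -
  define n where "n = real N"
  define s where "s = (\<alpha> + 2 - n) / 2"
  have n: "n > 1" "n \<ge> 2" and s: "s > 0" using N \<alpha> by (auto simp: n_def s_def)
  have sp: "s + (n - 1) / 2 > 0" using n s by (intro add_pos_pos) auto
  have a0: "\<alpha> > 0" using n \<alpha> by (auto simp: n_def)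
  have g: "Gamma x \<noteq> 0" if "x > 0" for x :: real using Gamma_real_pos[OF that] by simp
  have "zonal_mean n (\<lambda>t. (2 - 2 * t) powr s)
      = 2 powr (2 * s) * Beta ((n - 1) / 2) (s + (n - 1) / 2) / Beta ((n - 1) / 2) ((n - 1) / 2)"
  proof -
    have "2 powr (2 * s + n - 2) = 2 powr (2 * s) * (2::real) powr (n - 2)"
      by (simp add: powr_add[symmetric] algebra_simps)
    then show ?thesis
      using integral_unique[OF has_integral_power_zonal_weight[OF n(1) sp]]
      by (simp add: zonal_mean_def zonal_mass(1)[OF n(1)])
  qed
  moreover have "Beta ((n - 1) / 2) (s + (n - 1) / 2) = Gamma ((n - 1) / 2) * Gamma ((\<alpha> + 1) / 2) / Gamma ((n + \<alpha>) / 2)"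
  proof -
    have "s + (n - 1) / 2 = (\<alpha> + 1) / 2" "(n - 1) / 2 + (\<alpha> + 1) / 2 = (n + \<alpha>) / 2"
      by (simp_all add: s_def field_simps)
    then show ?thesis unfolding Beta_def by (simp only:)
  qed
  moreover have "Beta ((n - 1) / 2) ((n - 1) / 2) = Gamma ((n - 1) / 2) * Gamma ((n - 1) / 2) / Gamma (n - 1)"
    by (simp add: Beta_def)
  ultimately have mean: "zonal_mean n (\<lambda>t. (2 - 2 * t) powr s)
      = 2 powr (2 * s) * (Gamma ((n - 1) / 2) * Gamma ((\<alpha> + 1) / 2) / Gamma ((n + \<alpha>) / 2))
        / (Gamma ((n - 1) / 2) * Gamma ((n - 1) / 2) / Gamma (n - 1))" by simp
  define x where "x = sqrt pi"
  have x: "x > 0" by (simp add: x_def)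
  have d1: "Gamma ((\<alpha> + 1) / 2) * Gamma (1 + \<alpha> / 2) = 2 powr (- \<alpha>) * x * Gamma (1 + \<alpha>)"
    using Gamma_duplication_real[of "(\<alpha> + 1) / 2"] a0 by (simp add: x_def add_divide_distrib add_ac)
  have d2: "Gamma ((n - 1) / 2) * Gamma (n / 2) = 2 powr (2 - n) * x * Gamma (n - 1)"
    using Gamma_duplication_real[of "(n - 1) / 2"] n by (simp add: x_def diff_divide_distrib)
  have p: "2 powr (2 * s) * 2 powr (- \<alpha>) = (2::real) powr (2 - n)"
  proof -
    have "2 * s + - \<alpha> = 2 - n" by (simp add: s_def field_simps)
    then show ?thesis by (simp only: powr_add[symmetric])
  qed
  have nz: "Gamma ((n + \<alpha>) / 2) \<noteq> 0" "Gamma (n / 2) \<noteq> 0" "Gamma (1 + \<alpha>) \<noteq> 0" "Gamma ((n - 1) / 2) \<noteq> 0" "Gamma (n - 1) \<noteq> 0"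
    using n a0 by (auto intro!: g)
  have "poisson_const N \<alpha> * zonal_mean n (\<lambda>t. (2 - 2 * t) powr s)
      = 2 powr (2 * s) * (Gamma ((\<alpha> + 1) / 2) * Gamma (1 + \<alpha> / 2)) * Gamma (n - 1)
        / (Gamma (1 + \<alpha>) * (Gamma ((n - 1) / 2) * Gamma (n / 2)))"
    unfolding mean poisson_const_def n_def[symmetric] using nz by (simp add: field_simps)
  also have "\<dots> = (2 powr (2 * s) * 2 powr (- \<alpha>)) * (x * Gamma (1 + \<alpha>) * Gamma (n - 1))
        / (2 powr (2 - n) * (x * Gamma (1 + \<alpha>) * Gamma (n - 1)))"
    unfolding d1 d2 by (simp only: mult_ac)
  also have "\<dots> = 1" unfolding p using nz x by simp
  finally show ?thesis by (simp add: n_def s_def)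
qed

text \<open>The left derivative at \<open>r = 1\<close> may be taken under the integral. By the mean value theorem the difference quotient is
bounded by a multiple of \<open>D powr (s - 1) * |\<rho> - t|\<close> with \<open>r < \<rho> < 1\<close> and \<open>D = sphere_dist2 \<rho> t\<close>, and
\<open>|\<rho> - t| \<le> sqrt D\<close>. What remains, \<open>D powr (s - 1 / 2)\<close>, has a majorant
that is integrable for every \<open>s > 0\<close> because \<open>n \<ge> 2\<close>.\<close>

lemma zonal_mean_power_derivative:
  assumes n2: "n \<ge> 2" and s: "s > 0"
  shows "((\<lambda>r. zonal_mean n (\<lambda>t. ((2 - 2 * t) powr s - sphere_dist2 r t powr s) / (1 - r)))
           \<longlongrightarrow> zonal_mean n (\<lambda>t. s * (2 - 2 * t) powr s)) (at_left 1)"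
proof -
  have n: "n > 1" using n2 by simp
  define p where "p = s - 1 / 2"
  define k where "k t = 2 * s * (4 powr p + (1 / 2) powr p * (2 - 2 * t) powr p)" for t :: real
  have sp: "p + (n - 1) / 2 > 0"
  proof -
    have "p + (n - 1) / 2 = s + (n - 2) / 2" by (simp add: p_def field_simps)
    then show ?thesis using n2 s by (simp add: add_pos_nonneg)
  qed
  show ?thesis
  proof (rule zonal_mean_dominated_convergence_at_left)
    fix r :: real assume r: "r \<in> {1/2<..<1}"
    show "(\<lambda>t. ((2 - 2 * t) powr s - sphere_dist2 r t powr s) / (1 - r) * zonal_weight n t) integrable_on {-1<..<1}"
    proof (rule integrable_continuous_mult_zonal_weight[OF n])
      show "continuous_on {-1..1} (\<lambda>t. ((2 - 2 * t) powr s - sphere_dist2 r t powr s) / (1 - r))"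
        using r s by (intro continuous_intros continuous_sphere_dist2_powr continuous_on_powr') auto
    qed
  next
    have "((\<lambda>t. 2 * s * (4 powr p * zonal_weight n t + (1 / 2) powr p * ((2 - 2 * t) powr p * zonal_weight n t))) integrable_on {-1<..<1})"
      using has_integral_power_zonal_weight[OF n sp] has_integral_zonal_weight[OF n]
      by (intro integrable_on_mult_right integrable_add) (auto simp: integrable_on_def)
    then show "(\<lambda>t. k t * zonal_weight n t) integrable_on {-1<..<1}"
      by (simp add: k_def algebra_simps)
  next
    fix r t :: real assume r: "r \<in> {1/2<..<1}" and t: "t \<in> {-1<..<1}"
    have der: "((\<lambda>\<rho>. sphere_dist2 \<rho> t powr s) has_real_derivative s * sphere_dist2 \<rho> t powr (s - 1) * (2 * (\<rho> - t))) (at \<rho>)"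
      if "0 \<le> \<rho>" for \<rho>
      using sphere_dist2_pos_off_pole[of t \<rho>] t that
      by (auto simp: sphere_dist2_def intro!: derivative_eq_intros)
    have "\<exists>\<rho>. r < \<rho> \<and> \<rho> < 1 \<and> sphere_dist2 1 t powr s - sphere_dist2 r t powr s
        = (1 - r) * (s * sphere_dist2 \<rho> t powr (s - 1) * (2 * (\<rho> - t)))"
      by (rule MVT2) (use r der in auto)
    then obtain \<rho> where \<rho>: "r < \<rho>" "\<rho> < 1" and eq: "sphere_dist2 1 t powr s - sphere_dist2 r t powr s
        = (1 - r) * (s * sphere_dist2 \<rho> t powr (s - 1) * (2 * (\<rho> - t)))" by blast
    let ?D = "sphere_dist2 \<rho> t"
    have D: "?D > 0" using sphere_dist2_pos_off_pole[of t \<rho>] t \<rho> r by auto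
    have "\<bar>\<rho> - t\<bar> \<le> ?D powr (1 / 2)"
      using sphere_dist2_bounds(3)[of t \<rho>] t \<rho> r D by (simp add: powr_half_sqrt real_le_rsqrt)
    then have "?D powr (s - 1) * \<bar>\<rho> - t\<bar> \<le> ?D powr (s - 1) * ?D powr (1 / 2)"
      by (intro mult_left_mono) auto
    also have "\<dots> = ?D powr p" by (simp add: powr_add[symmetric] p_def)
    \<comment> \<open>\<open>1 - t \<le> sphere_dist2 \<rho> t \<le> 4\<close>, and one of the two ends bounds the power, depending on the sign of \<open>p\<close>\<close>
    also have "\<dots> \<le> 4 powr p + (1 - t) powr p"
    proof (cases "p \<ge> 0")
      case True
      have "?D powr p \<le> 4 powr p"
        using True D sphere_dist2_bounds(2)[of t \<rho>] t \<rho> r by (intro powr_mono2) auto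
      then show ?thesis by (smt (verit) powr_ge_zero)
    next
      case False
      have "?D powr p \<le> (1 - t) powr p"
        using False D sphere_dist2_bounds(1)[of t \<rho>] t \<rho> r by (intro powr_mono2') auto
      then show ?thesis by (smt (verit) powr_ge_zero)
    qed
    also have "(1 - t) powr p = (1 / 2) powr p * (2 - 2 * t) powr p"
    proof -
      have "(1 - t) powr p = ((1 / 2) * (2 - 2 * t)) powr p" by (simp add: diff_divide_distrib)
      also have "\<dots> = (1 / 2) powr p * (2 - 2 * t) powr p" by (rule powr_mult)
      finally show ?thesis .
    qed
    finally have "2 * s * (?D powr (s - 1) * \<bar>\<rho> - t\<bar>) \<le> k t"
      unfolding k_def using s by (intro mult_left_mono) auto
    moreover have "((2 - 2 * t) powr s - sphere_dist2 r t powr s) / (1 - r)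
        = s * ?D powr (s - 1) * (2 * (\<rho> - t))"
    proof -
      have "sphere_dist2 1 t = 2 - 2 * t" by (simp add: sphere_dist2_def)
      then show ?thesis using eq r by simp
    qed
    moreover have "\<bar>s * ?D powr (s - 1) * (2 * (\<rho> - t))\<bar> = 2 * s * (?D powr (s - 1) * \<bar>\<rho> - t\<bar>)"
    proof -
      have "\<bar>2 * (\<rho> - t)\<bar> = 2 * \<bar>\<rho> - t\<bar>" by (simp only: abs_mult abs_numeral)
      moreover have "\<bar>s * ?D powr (s - 1)\<bar> = s * ?D powr (s - 1)" using s by simp
      ultimately show ?thesis unfolding abs_mult[of "s * ?D powr (s - 1)"] by (simp only: mult_ac)
    qed
    ultimately show "\<bar>((2 - 2 * t) powr s - sphere_dist2 r t powr s) / (1 - r)\<bar> \<le> k t" by simp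
  next
    fix t :: real assume t: "t \<in> {-1<..<1}"
    have D1: "sphere_dist2 1 t = 2 - 2 * t" by (simp add: sphere_dist2_def)
    have "((\<lambda>\<rho>. sphere_dist2 \<rho> t powr s) has_real_derivative s * sphere_dist2 1 t powr (s - 1) * (2 * (1 - t))) (at 1)"
      using sphere_dist2_pos_off_pole[of t 1] t
      by (auto simp: sphere_dist2_def intro!: derivative_eq_intros)
    moreover have "s * sphere_dist2 1 t powr (s - 1) * (2 * (1 - t)) = s * (2 - 2 * t) powr s"
    proof -
      have "(2 - 2 * t) powr (s - 1 + 1) = (2 - 2 * t) powr (s - 1) * (2 - 2 * t)"
        using t by (simp only: powr_add) simp
      then have e: "(2 - 2 * t) powr s = (2 - 2 * t) powr (s - 1) * (2 * (1 - t))" by simp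
      show ?thesis unfolding D1 e by (simp only: mult.assoc)
    qed
    ultimately have "((\<lambda>r. (sphere_dist2 r t powr s - sphere_dist2 1 t powr s) / (r - 1)) \<longlongrightarrow> s * (2 - 2 * t) powr s) (at 1)"
      by (simp only: has_field_derivative_iff)
    then have "((\<lambda>r. (sphere_dist2 r t powr s - sphere_dist2 1 t powr s) / (r - 1)) \<longlongrightarrow> s * (2 - 2 * t) powr s) (at_left 1)"
      by (rule tendsto_within_subset) simp
    moreover have "(sphere_dist2 r t powr s - sphere_dist2 1 t powr s) / (r - 1)
       = ((2 - 2 * t) powr s - sphere_dist2 r t powr s) / (1 - r)" for r
      using minus_divide_divide[of "(2 - 2 * t) powr s - sphere_dist2 r t powr s" "1 - r"] by (simp add: D1)
    ultimately show "((\<lambda>r. ((2 - 2 * t) powr s - sphere_dist2 r t powr s) / (1 - r)) \<longlongrightarrow> s * (2 - 2 * t) powr s) (at_left 1)"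
      by simp
  qed
qed

text \<open>After the Moebius substitution the mass is \<open>C\<close> times the mean of \<open>sphere_dist2 r t powr s\<close> with
\<open>s = (\<alpha> + 2 - n) / 2\<close>. Its derivative at \<open>r = 1\<close> reproduces \<open>s\<close> times the same mean, which is normalized.\<close>

lemma weighted_poisson_mass_derivative:
  assumes N: "N \<ge> 2" and \<alpha>: "\<alpha> > real N - 2"
  shows "((\<lambda>r. (1 - zonal_mean N (\<lambda>t. poisson_const N \<alpha> * ((1 - r\<^sup>2) powr (1 + \<alpha>) * sphere_dist2 r t powr (- ((real N + \<alpha>) / 2))))) / (1 - r))
          \<longlongrightarrow> \<alpha> / 2 + 1 - real N / 2) (at_left 1)"
proof -
  define s where "s = (\<alpha> + 2 - real N) / 2"
  let ?C = "poisson_const N \<alpha>"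
  have n: "real N > 1" and s: "s > 0" using N \<alpha> by (auto simp: s_def)
  have c1: "continuous_on {-1..1} (\<lambda>t::real. (2 - 2 * t) powr s)"
    using s by (intro continuous_intros continuous_on_powr') auto
  have norm1: "?C * zonal_mean N (\<lambda>t. (2 - 2 * t) powr s) = 1"
    using poisson_const_normalizes[OF N \<alpha>] by (simp add: s_def)
  have "((\<lambda>r. ?C * zonal_mean N (\<lambda>t. ((2 - 2 * t) powr s - sphere_dist2 r t powr s) / (1 - r)))
      \<longlongrightarrow> ?C * zonal_mean N (\<lambda>t. s * (2 - 2 * t) powr s)) (at_left 1)"
    using N by (intro tendsto_mult_left zonal_mean_power_derivative s) simp
  moreover have val: "?C * zonal_mean N (\<lambda>t. s * (2 - 2 * t) powr s) = \<alpha> / 2 + 1 - real N / 2"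
    using norm1 by (simp add: zonal_mean_cmult[OF n]) (simp add: s_def field_simps)
  moreover have ev: "eventually (\<lambda>r. ?C * zonal_mean N (\<lambda>t. ((2 - 2 * t) powr s - sphere_dist2 r t powr s) / (1 - r))
     = (1 - zonal_mean N (\<lambda>t. ?C * ((1 - r\<^sup>2) powr (1 + \<alpha>) * sphere_dist2 r t powr (- ((real N + \<alpha>) / 2))))) / (1 - r)) (at_left 1)"
    using eventually_at_left_real[of 0 1, simplified]
  proof eventually_elim
    case (elim r)
    have r: "0 \<le> r" "r < 1" using elim by auto
    have q: "1 - r\<^sup>2 > 0" using r by (simp add: abs_square_less_1)
    have e: "real N - 1 - 2 * ((real N + \<alpha>) / 2) = - (1 + \<alpha>)" "(real N + \<alpha>) / 2 - (real N - 1) = s"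
      by (auto simp: s_def field_simps)
    have "zonal_mean N (\<lambda>t. ?C * ((1 - r\<^sup>2) powr (1 + \<alpha>) * sphere_dist2 r t powr (- ((real N + \<alpha>) / 2))))
        = ?C * ((1 - r\<^sup>2) powr (1 + \<alpha>) * zonal_mean N (\<lambda>t. sphere_dist2 r t powr (- ((real N + \<alpha>) / 2))))"
      by (simp add: zonal_mean_cmult[OF n])
    also have "\<dots> = ?C * zonal_mean N (\<lambda>t. sphere_dist2 r t powr s)"
    proof -
      have "(1 - r\<^sup>2) powr (1 + \<alpha>) * (1 - r\<^sup>2) powr (- (1 + \<alpha>)) = 1"
        using q by (simp add: powr_add[symmetric])
      then show ?thesis
        unfolding moebius_substitution[OF n r, of "(real N + \<alpha>) / 2"] e
        by (simp add: mult.assoc[symmetric])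
    qed
    finally have 1: "zonal_mean N (\<lambda>t. ?C * ((1 - r\<^sup>2) powr (1 + \<alpha>) * sphere_dist2 r t powr (- ((real N + \<alpha>) / 2))))
        = ?C * zonal_mean N (\<lambda>t. sphere_dist2 r t powr s)" .
    have "zonal_mean N (\<lambda>t. ((2 - 2 * t) powr s - sphere_dist2 r t powr s) / (1 - r))
        = zonal_mean N (\<lambda>t. 1 / (1 - r) * ((2 - 2 * t) powr s + (- 1) * sphere_dist2 r t powr s))"
      by simp
    also have "\<dots> = 1 / (1 - r) * (zonal_mean N (\<lambda>t. (2 - 2 * t) powr s) + (- 1) * zonal_mean N (\<lambda>t. sphere_dist2 r t powr s))"
      unfolding zonal_mean_cmult[OF n]
      by (subst zonal_mean_add[OF n c1])
         (auto intro!: continuous_intros continuous_sphere_dist2_powr r simp only: zonal_mean_cmult[OF n])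
    finally have 2: "zonal_mean N (\<lambda>t. ((2 - 2 * t) powr s - sphere_dist2 r t powr s) / (1 - r))
        = (zonal_mean N (\<lambda>t. (2 - 2 * t) powr s) - zonal_mean N (\<lambda>t. sphere_dist2 r t powr s)) / (1 - r)"
      by simp
    show ?case using norm1 unfolding 1 2 by (simp add: right_diff_distrib)
  qed
  ultimately show ?thesis unfolding val tendsto_cong[OF ev] by blast
qed

text \<open>A factor vanishing near the pole removes the singularity of the kernel. The factor \<open>1 + r\<close> is what is left of
\<open>1 - r\<^sup>2\<close> after division by \<open>1 - r\<close>.\<close>

lemma poisson_truncated_limit:
  assumes n: "n > 1" and \<psi>: "\<psi> \<in> borel_measurable borel" and B: "\<And>t. \<bar>\<psi> t\<bar> \<le> B"
    and z: "\<And>t. t \<ge> 1 / 2 \<Longrightarrow> \<psi> t = 0"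
  shows "((\<lambda>r. zonal_mean n (\<lambda>t. (1 + r) * sphere_dist2 r t powr (- n / 2) * \<psi> t))
     \<longlongrightarrow> zonal_mean n (\<lambda>t. 2 * (2 - 2 * t) powr (- n / 2) * \<psi> t)) (at_left 1)"
proof (rule zonal_mean_dominated_convergence_at_left)
  define K where "K = 2 * (1 / 2) powr (- n / 2) * B"
  have bound: "\<bar>(1 + r) * sphere_dist2 r t powr (- n / 2) * \<psi> t\<bar> \<le> K"
    if r: "r \<in> {1/2<..<1}" and t: "t \<in> {-1<..<1}" for r t
  proof (cases "t \<ge> 1 / 2")
    case True
    have "B \<ge> 0" using B[of 0] by linarith
    then show ?thesis using z[OF True] by (simp add: K_def)
  next
    case False
    have "1 / 2 \<le> sphere_dist2 r t" using sphere_dist2_bounds(1)[of t r] t r False by auto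
    then have "sphere_dist2 r t powr (- n / 2) \<le> (1 / 2) powr (- n / 2)"
      using n by (intro powr_mono2') auto
    then show ?thesis unfolding abs_mult K_def using B[of t] r by (intro mult_mono) auto
  qed
  show "(\<lambda>t. (1 + r) * sphere_dist2 r t powr (- n / 2) * \<psi> t * zonal_weight n t) integrable_on {-1<..<1}"
    if r: "r \<in> {1/2<..<1}" for r
  proof (rule integrable_mult_zonal_weight[OF n _ bound[OF r]])
    show "(\<lambda>t. (1 + r) * sphere_dist2 r t powr (- n / 2) * \<psi> t) \<in> borel_measurable borel"
      using \<psi> unfolding sphere_dist2_def by measurable
  qed
  show "(\<lambda>t. K * zonal_weight n t) integrable_on {-1<..<1}"
    by (rule integrable_continuous_mult_zonal_weight[OF n]) (intro continuous_intros)
  show "\<bar>(1 + r) * sphere_dist2 r t powr (- n / 2) * \<psi> t\<bar> \<le> K"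
    if "r \<in> {1/2<..<1}" "t \<in> {-1<..<1}" for r t by (rule bound[OF that])
  fix t :: real assume t: "t \<in> {-1<..<1}"
  have "((\<lambda>r. (1 + r) * (1 + r\<^sup>2 - 2 * r * t) powr (- n / 2) * \<psi> t) \<longlongrightarrow>
      (1 + 1) * (1 + 1\<^sup>2 - 2 * 1 * t) powr (- n / 2) * \<psi> t) (at_left 1)"
    using t by (intro tendsto_intros) auto
  then show "((\<lambda>r. (1 + r) * sphere_dist2 r t powr (- n / 2) * \<psi> t) \<longlongrightarrow> 2 * (2 - 2 * t) powr (- n / 2) * \<psi> t) (at_left 1)"
    by (simp add: sphere_dist2_def)
qed

lemma zonal_mean_sign:
  assumes n: "n > 1"
  shows "zonal_mean n (\<lambda>t. if t \<le> 0 then - 1 else 1) = 0"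
proof -
  let ?I = "{-1<..<1::real}"
  define f where "f t = (if t \<le> 0 then - 1 else 1) * zonal_weight n t" for t
  have f: "f absolutely_integrable_on ?I"
    unfolding f_def by (rule absolutely_integrable_mult_zonal_weight[OF n, of _ 1]) auto
  have "integral ?I (\<lambda>t. f (- t)) = integral ?I f"
    by (rule integral_change_of_variable[of uminus "\<lambda>t. - 1"]) (use f in \<open>auto intro!: derivative_eq_intros\<close>)
  moreover have "integral ?I (\<lambda>t. f (- t)) = integral ?I (\<lambda>t. - f t)"
    by (rule integral_spike[of "{0}"]) (auto simp: f_def zonal_weight_def)
  ultimately have "integral ?I f = 0" by simp
  then show ?thesis unfolding zonal_mean_def f_def by (simp only: div_0)
qed

text \<open>The kernel \<open>P\<close> is increasing in \<open>t\<close>, so it is below its equatorial value \<open>p\<close> exactly for \<open>t \<le> 0\<close>, and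
\<open>P - |P - p|\<close> is \<open>2 P - p\<close> there and \<open>p\<close> elsewhere. The two occurrences of \<open>p\<close> cancel in the mean.\<close>

lemma zonal_mean_poisson_deviation:
  assumes n: "n > 1" and r: "0 \<le> r" "r < 1"
  shows "zonal_mean n (\<lambda>t. \<bar>(1 - r\<^sup>2) * sphere_dist2 r t powr (- n / 2) - (1 - r\<^sup>2) * (1 + r\<^sup>2) powr (- n / 2)\<bar>)
       = 1 - (1 - r) * zonal_mean n (\<lambda>t. (1 + r) * sphere_dist2 r t powr (- n / 2) * (if t \<le> 0 then 2 else 0))"
proof -
  let ?I = "{-1<..<1::real}"
  define P where "P t = (1 - r\<^sup>2) * sphere_dist2 r t powr (- n / 2)" for t
  define p where "p = (1 - r\<^sup>2) * (1 + r\<^sup>2) powr (- n / 2)"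
  have q: "1 - r\<^sup>2 > 0" using r by (simp add: abs_square_less_1)
  have cP: "continuous_on {-1..1} P" unfolding P_def by (intro continuous_intros continuous_sphere_dist2_powr r)
  have eq: "\<bar>P t - p\<bar> = P t - (1 - r) * ((1 + r) * sphere_dist2 r t powr (- n / 2) * (if t \<le> 0 then 2 else 0))
     - p * (if t \<le> 0 then - 1 else 1)" if t: "t \<in> ?I" for t
  proof (cases "t \<le> 0")
    case True
    then have "1 + r\<^sup>2 \<le> sphere_dist2 r t" using r by (simp add: sphere_dist2_def mult_nonneg_nonpos)
    moreover have "0 < 1 + r\<^sup>2" by (simp add: add_pos_nonneg)
    ultimately have "sphere_dist2 r t powr (- n / 2) \<le> (1 + r\<^sup>2) powr (- n / 2)"
      using n by (intro powr_mono2') auto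
    then have "P t \<le> p" unfolding P_def p_def using q by (intro mult_left_mono) auto
    moreover have "(1 - r) * ((1 + r) * sphere_dist2 r t powr (- n / 2) * 2) = 2 * P t"
      by (simp add: P_def power2_eq_square algebra_simps)
    ultimately show ?thesis using True by simp
  next
    case False
    then have "sphere_dist2 r t \<le> 1 + r\<^sup>2" "0 < sphere_dist2 r t"
      using r t sphere_dist2_pos_inside[of t r] by (auto simp: sphere_dist2_def)
    then have "(1 + r\<^sup>2) powr (- n / 2) \<le> sphere_dist2 r t powr (- n / 2)"
      using n by (intro powr_mono2') auto
    then have "p \<le> P t" unfolding P_def p_def using q by (intro mult_left_mono) auto
    then show ?thesis using False by simp
  qed
  define a where "a t = P t * zonal_weight n t" for t
  define b where "b t = (1 + r) * sphere_dist2 r t powr (- n / 2) * (if t \<le> 0 then 2 else 0) * zonal_weight n t" for t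
  define c where "c t = (if t \<le> 0 then - 1 else 1) * zonal_weight n t" for t
  have ia: "a integrable_on ?I" unfolding a_def by (rule integrable_continuous_mult_zonal_weight[OF n cP])
  have ic: "c integrable_on ?I" unfolding c_def by (rule integrable_mult_zonal_weight[OF n, of _ 1]) auto
  have ib: "b integrable_on ?I" unfolding b_def
  proof (rule integrable_mult_zonal_weight[OF n, where B = "(1 + r) * 1 * 2"])
    show "(\<lambda>t. (1 + r) * sphere_dist2 r t powr (- n / 2) * (if t \<le> 0 then 2 else 0)) \<in> borel_measurable borel"
      unfolding sphere_dist2_def by measurable
    fix t :: real assume t: "t \<in> ?I"
    show "\<bar>(1 + r) * sphere_dist2 r t powr (- n / 2) * (if t \<le> 0 then 2 else 0)\<bar> \<le> (1 + r) * 1 * 2"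
    proof (cases "t \<le> 0")
      case True
      then have "2 * r * t \<le> 0" using r by (simp add: mult_nonneg_nonpos)
      then have "1 \<le> sphere_dist2 r t" unfolding sphere_dist2_def using zero_le_power2[of r] by linarith
      then have "sphere_dist2 r t powr (- n / 2) \<le> 1 powr (- n / 2)" using n by (intro powr_mono2') auto
      then show ?thesis unfolding abs_mult using r True by (intro mult_mono) auto
    qed (use r in auto)
  qed
  have "integral ?I (\<lambda>t. \<bar>P t - p\<bar> * zonal_weight n t) = integral ?I (\<lambda>t. a t - (1 - r) * b t - p * c t)"
    by (intro integral_cong) (simp only: a_def b_def c_def eq left_diff_distrib mult.assoc)
  also have "\<dots> = integral ?I a - (1 - r) * integral ?I b - p * integral ?I c"
    by (subst integral_diff integral_mult_right | intro integrable_diff integrable_on_mult_right ia ib ic)+ simp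
  finally have "zonal_mean n (\<lambda>t. \<bar>P t - p\<bar>) = zonal_mean n P - (1 - r) * (integral ?I b / zonal_mass n) - p * (integral ?I c / zonal_mass n)"
    unfolding zonal_mean_def a_def[symmetric] by (simp add: diff_divide_distrib)
  moreover have "integral ?I c / zonal_mass n = 0"
    using zonal_mean_sign[OF n] unfolding zonal_mean_def c_def .
  moreover have "zonal_mean n P = 1" using zonal_mean_poisson[OF n r] unfolding P_def .
  ultimately show ?thesis unfolding P_def p_def b_def by (simp add: zonal_mean_def)
qed

section \<open>The hypergeometric constant\<close>

lemma positive_not_nonpos_Int:
  fixes x :: real
  assumes "x > 0"
  shows "x \<notin> \<int>\<^sub>\<le>\<^sub>0"
  using assms by (auto elim!: nonpos_Ints_cases)

lemma has_integral_power_times_power: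
  assumes "c > (1::real)"
  shows "((\<lambda>t. t ^ k * (1 - t) powr (c - 2)) has_integral fact k / ((c - 1) * pochhammer c k)) {0<..<1}"
proof -
  have "((\<lambda>t. t powr (real (k + 1) - 1) * (1 - t) powr ((c - 1) - 1)) has_integral Beta (real (k + 1)) (c - 1)) {0..1}"
    using assms by (intro has_integral_Beta_real) auto
  then have "((\<lambda>t. t powr (real (k + 1) - 1) * (1 - t) powr ((c - 1) - 1)) has_integral Beta (real (k + 1)) (c - 1)) {0<..<1}"
    by (simp add: has_integral_Icc_iff_Ioo)
  moreover have "Beta (real (k + 1)) (c - 1) = fact k / ((c - 1) * pochhammer c k)"
  proof -
    have "pochhammer (c - 1) (k + 1) = Gamma (c - 1 + real (k + 1)) / Gamma (c - 1)"
      using positive_not_nonpos_Int[of "c - 1"] assms by (intro pochhammer_Gamma) auto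
    moreover have "pochhammer (c - 1) (k + 1) = (c - 1) * pochhammer c k"
      by (simp add: pochhammer_rec)
    moreover have "Gamma (real (k + 1)) = fact k" using Gamma_fact[of k, where 'a = real] by (simp add: add_ac)
    moreover have "Gamma (c - 1) > 0" "Gamma (c - 1 + real (k + 1)) > 0" using assms by (auto intro!: Gamma_real_pos)
    moreover have "G = X * G0" if "P = G / G0" "P = X" "G0 > 0" for P G X G0 :: real using that by simp
    ultimately have "Gamma (c - 1 + real (k + 1)) = (c - 1) * pochhammer c k * Gamma (c - 1)"
      and "Gamma (real (k + 1)) = fact k" "Gamma (c - 1) \<noteq> 0" by (blast, blast, simp)
    then show ?thesis unfolding Beta_def add.commute[of "real (k + 1)"] by simp
  qed
  ultimately show ?thesis
    by (subst has_integral_cong[where g = "\<lambda>t. t powr (real (k + 1) - 1) * (1 - t) powr ((c - 1) - 1)"])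
       (auto simp: powr_realpow)
qed

text \<open>Euler's integral with \<open>b = 1\<close> at the argument \<open>- 1\<close>. The power \<open>(1 + t) powr (- 1 / 2)\<close> is expanded by the binomial series and integrated
termwise; the partial sums are dominated by the expansion of \<open>(1 - t) powr (- 1 / 2)\<close>, whose coefficients are the absolute values.\<close>

lemma has_integral_hypergeometric:
  assumes c: "c > (3/2::real)"
  shows "((\<lambda>t. (1 - t) powr (c - 2) * (1 + t) powr (- 1 / 2)) has_integral
    hypergeometric (1 / 2) 1 c (- 1) / (c - 1)) {0<..<1}"
proof -
  let ?J = "{0<..<1::real}"
  define q :: "nat \<Rightarrow> real" where "q k = pochhammer (1/2) k / fact k" for k :: nat
  have q0: "q k \<ge> 0" for k using pochhammer_pos[of "1/2::real" k] by (simp add: q_def less_imp_le)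
  define f where "f N t = (\<Sum>k<N. (- 1) ^ k * q k * (t ^ k * (1 - t) powr (c - 2)))" for N t
  define g where "g t = (1 - t) powr (c - 2) * (1 + t) powr (- 1 / 2)" for t :: real
  define a :: "nat \<Rightarrow> real" where "a k = pochhammer (1/2) k * pochhammer 1 k / pochhammer c k * (- 1) ^ k / fact k" for k :: nat
  have f_eq: "f N t = (\<Sum>k<N. (- 1) ^ k * q k * t ^ k) * (1 - t) powr (c - 2)" for N t
    unfolding f_def sum_distrib_right by (simp only: mult.assoc)
  have binom: "(\<lambda>k. (- 1) ^ k * q k * t ^ k) sums (1 + t) powr (- 1 / 2)" if t: "\<bar>t\<bar> < 1" for t
  proof -
    have "(\<lambda>k. ((- 1 / 2) gchoose k) * t ^ k) sums (1 + t) powr (- 1 / 2)"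
      using gen_binomial_real[OF t, of "- 1 / 2"] .
    moreover have "(- 1 / 2 :: real) gchoose k = (- 1) ^ k * q k" for k
      by (simp add: q_def gbinomial_pochhammer)
    ultimately show ?thesis by simp
  qed
  have hf: "(f N has_integral (\<Sum>k<N. a k) / (c - 1)) ?J" for N
  proof -
    have "(f N has_integral (\<Sum>k<N. (- 1) ^ k * q k * (fact k / ((c - 1) * pochhammer c k)))) ?J"
      unfolding f_def
      by (intro has_integral_sum has_integral_mult_right has_integral_power_times_power) (use c in auto)
    moreover have "(- 1) ^ k * q k * (fact k / ((c - 1) * pochhammer c k)) = a k / (c - 1)" for k
      by (simp add: q_def a_def pochhammer_fact[symmetric] mult_ac)
    ultimately show ?thesis by (simp add: sum_divide_distrib)
  qed
  have dom: "(\<lambda>t. (1 - t) powr (c - 5 / 2)) integrable_on ?J"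
    using has_integral_power_times_power[of "c - 1 / 2" 0] c by (auto simp: integrable_on_def algebra_simps)
  have le: "norm (f N t) \<le> (1 - t) powr (c - 5 / 2)" if t: "t \<in> ?J" for N t
  proof -
    have "(- 1) ^ k * q k * (- t) ^ k = q k * t ^ k" for k
      by (cases "even k") simp_all
    then have e: "(\<lambda>k. (- 1) ^ k * q k * (- t) ^ k) = (\<lambda>k. q k * t ^ k)" by (rule ext)
    have sums: "(\<lambda>k. q k * t ^ k) sums (1 - t) powr (- 1 / 2)"
      using binom[of "- t"] t unfolding e by simp
    then have s: "(\<Sum>k<N. q k * t ^ k) \<le> (1 - t) powr (- 1 / 2)"
      unfolding sums_unique[OF sums] using t q0
      by (intro sum_le_suminf[OF sums_summable[OF sums]]) auto
    have "\<bar>\<Sum>k<N. (- 1) ^ k * q k * t ^ k\<bar> \<le> (\<Sum>k<N. \<bar>(- 1) ^ k * q k * t ^ k\<bar>)" by (rule sum_abs)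
    also have "\<dots> = (\<Sum>k<N. q k * t ^ k)" using t q0 by (simp add: abs_mult power_abs)
    finally have "\<bar>f N t\<bar> \<le> (1 - t) powr (- 1 / 2) * (1 - t) powr (c - 2)"
      unfolding f_eq abs_mult using s by (intro mult_mono) auto
    then show ?thesis by (simp add: powr_add[symmetric])
  qed
  have conv: "(\<lambda>N. f N t) \<longlonglongrightarrow> g t" if t: "t \<in> ?J" for t
    using tendsto_mult_right[OF binom[of t, unfolded sums_def], of "(1 - t) powr (c - 2)"] t
    by (simp add: f_eq g_def mult.commute)
  note dc = dominated_convergence[of f ?J "\<lambda>t. (1 - t) powr (c - 5 / 2)" g]
  have ig: "g integrable_on ?J" and lim: "(\<lambda>N. integral ?J (f N)) \<longlonglongrightarrow> integral ?J g"
    using dc hf dom le conv by (auto simp: integrable_on_def)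
  have "(\<lambda>N. (\<Sum>k<N. a k) / (c - 1)) \<longlonglongrightarrow> integral ?J g"
    using lim integral_unique[OF hf] by simp
  from tendsto_mult_right[OF this, of "c - 1"] have "a sums (integral ?J g * (c - 1))"
    using c by (simp add: sums_def)
  then have "hypergeometric (1 / 2) 1 c (- 1) = integral ?J g * (c - 1)"
    unfolding hypergeometric_def a_def by (rule sums_unique[symmetric])
  then have "(g has_integral hypergeometric (1 / 2) 1 c (- 1) / (c - 1)) ?J"
    using ig c by (simp add: has_integral_integral)
  then show ?thesis unfolding g_def .
qed

text \<open>The integral behind the harmonic constant differs from a multiple of Euler's integral for \<open>c = (n + 3) / 2\<close> by
the integral of an exact derivative.\<close>

lemma has_integral_cap:
  assumes n: "n \<ge> (2::real)"
  shows "((\<lambda>t. (1 + t) powr (- 3 / 2) * (1 - t) powr ((n - 3) / 2)) has_integral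
    n * (1 + n - (n - 2) * hypergeometric (1 / 2) 1 ((n + 3) / 2) (- 1)) / (2 * (n - 1) * (n + 1))) {0<..<1}"
proof -
  define F where "F = hypergeometric (1 / 2) 1 ((n + 3) / 2) (- 1)"
  define m where "m = (n - 3) / 2"
  \<comment> \<open>\<open>\<kappa>\<close> is chosen such that, with \<open>y = 1 + t\<close>, the derivative of \<open>G\<close> is \<open>(1 - t) powr m * y powr (- 3 / 2)\<close> times \<open>1 + \<mu> * (2 - y) * y\<close>\<close>
  define \<kappa> where "\<kappa> = (n - 2) / (2 * (n - 1))"
  define \<mu> where "\<mu> = (n - 2) * n / (4 * (n - 1))"
  define G where "G t = (1 - t) powr (m + 1) * (\<kappa> * (1 + t) powr (1 / 2) - (1 + t) powr (- 1 / 2))" for t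
  have m1: "m + 1 > 0" using n by (simp add: m_def field_simps)
  let ?i = "\<lambda>t. (1 + t) powr (- 3 / 2) * (1 - t) powr m"
  let ?j = "\<lambda>t. (1 - t) powr (m + 1) * (1 + t) powr (- 1 / 2)"
  have "((\<lambda>t. ?i t + \<mu> * ?j t) has_integral (G 1 - G 0)) {0..1}"
  proof (rule fundamental_theorem_of_calculus_interior)
    show "continuous_on {0..1} G"
      unfolding G_def using m1 by (intro continuous_intros continuous_on_powr') auto
    fix t :: real assume t: "t \<in> {0<..<1}"
    define y where "y = 1 + t"
    have y: "y > 0" "1 - t = 2 - y" "2 - y > 0" using t by (auto simp: y_def)
    have "(G has_real_derivative
        ((m + 1) * (1 - t) powr (m + 1 - 1) * (- 1)) * (\<kappa> * (1 + t) powr (1 / 2) - (1 + t) powr (- 1 / 2))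
        + (\<kappa> * ((1 / 2) * (1 + t) powr (1 / 2 - 1)) - (- 1 / 2) * (1 + t) powr (- 1 / 2 - 1)) * (1 - t) powr (m + 1)) (at t)"
      unfolding G_def using t by (intro DERIV_mult) (auto intro!: derivative_eq_intros)
    moreover have p: "(1 + t) powr (1 / 2) = y\<^sup>2 * y powr (- 3 / 2)" "(1 + t) powr (1 / 2 - 1) = y * y powr (- 3 / 2)"
      "(1 + t) powr (- 1 / 2) = y * y powr (- 3 / 2)" "(1 + t) powr (- 1 / 2 - 1) = y powr (- 3 / 2)"
      "(1 - t) powr (m + 1) = (2 - y) * (1 - t) powr m" "(1 - t) powr (m + 1 - 1) = (1 - t) powr m"
    proof -
      have a: "y powr (2 + - 3 / 2) = y\<^sup>2 * y powr (- 3 / 2)" "y powr (1 + - 3 / 2) = y * y powr (- 3 / 2)"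
        unfolding powr_add using y by simp_all
      show "(1 + t) powr (1 / 2) = y\<^sup>2 * y powr (- 3 / 2)" "(1 + t) powr (1 / 2 - 1) = y * y powr (- 3 / 2)"
       "(1 + t) powr (- 1 / 2) = y * y powr (- 3 / 2)" "(1 + t) powr (- 1 / 2 - 1) = y powr (- 3 / 2)"
        using a by (simp_all add: y_def)
      show "(1 - t) powr (m + 1) = (2 - y) * (1 - t) powr m" unfolding powr_add using y by simp
    qed simp
    moreover have "((m + 1) * A * (- 1)) * (\<kappa> * (y\<^sup>2 * B) - y * B) + (\<kappa> * ((1 / 2) * (y * B)) - (- 1 / 2) * B) * ((2 - y) * A)
        = B * A + \<mu> * ((2 - y) * A * (y * B))" for A B
    proof -
      have l1: "\<mu> = \<kappa> * (m + 3 / 2)" and l2: "2 * \<mu> = m + 1 / 2 + \<kappa>"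
        using n by (simp_all add: \<mu>_def \<kappa>_def m_def field_simps)
      have "((m + 1) * A * (- 1)) * (\<kappa> * (y\<^sup>2 * B) - y * B) + (\<kappa> * ((1 / 2) * (y * B)) - (- 1 / 2) * B) * ((2 - y) * A)
         = A * B * (1 + y * (m + 1 / 2 + \<kappa>) - y\<^sup>2 * (\<kappa> * (m + 3 / 2)))"
        by (simp add: field_simps power2_eq_square)
      also have "\<dots> = A * B * (1 + y * (2 * \<mu>) - y\<^sup>2 * \<mu>)" by (simp only: l1[symmetric] l2[symmetric])
      also have "\<dots> = B * A + \<mu> * ((2 - y) * A * (y * B))" by (simp add: algebra_simps power2_eq_square)
      finally show ?thesis .
    qed
    ultimately have "(G has_real_derivative ?i t + \<mu> * ?j t) (at t)"
      unfolding y_def[symmetric] by (simp only:) 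
    then show "(G has_vector_derivative ?i t + \<mu> * ?j t) (at t)"
      by (simp add: has_real_derivative_iff_has_vector_derivative)
  qed simp
  then have "((\<lambda>t. ?i t + \<mu> * ?j t) has_integral (1 - \<kappa>)) {0<..<1}"
    using m1 by (simp add: G_def has_integral_Icc_iff_Ioo)
  moreover have "(?j has_integral F / ((n + 1) / 2)) {0<..<1}"
  proof -
    have e: "(n + 3) / 2 - 2 = m + 1" "(n + 3) / 2 - 1 = (n + 1) / 2" by (simp_all add: m_def field_simps)
    show ?thesis using has_integral_hypergeometric[of "(n + 3) / 2"] n unfolding e F_def by simp
  qed
  ultimately have "((\<lambda>t. ?i t + \<mu> * ?j t - \<mu> * ?j t) has_integral (1 - \<kappa>) - \<mu> * (F / ((n + 1) / 2))) {0<..<1}"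
    by (intro has_integral_diff has_integral_mult_right)
  moreover have "(1 - \<kappa>) - \<mu> * (F / ((n + 1) / 2)) = n * (1 + n - (n - 2) * F) / (2 * (n - 1) * (n + 1))"
  proof -
    define p where "p = n - 1"
    define q where "q = n + 1"
    have pq: "p > 0" "q > 0" using n by (auto simp: p_def q_def)
    have "1 - \<kappa> = n / (2 * p)"
      unfolding \<kappa>_def p_def[symmetric] using pq by (simp add: field_simps) (simp add: p_def)
    moreover have "\<mu> * (F / ((n + 1) / 2)) = (n - 2) * n * F / (2 * p * q)"
      unfolding \<mu>_def p_def[symmetric] q_def[symmetric] by simp
    moreover have "n / (2 * p) = n * q / (2 * p * q)" using pq by simp
    ultimately have "(1 - \<kappa>) - \<mu> * (F / ((n + 1) / 2)) = (n * q - (n - 2) * n * F) / (2 * p * q)"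
      by (simp add: diff_divide_distrib)
    moreover have "n * q - (n - 2) * n * F = n * (1 + n - (n - 2) * F)"
      by (simp add: q_def algebra_simps)
    ultimately show ?thesis by (simp add: p_def q_def)
  qed
  ultimately show ?thesis by (simp add: m_def F_def)
qed

text \<open>For \<open>t < 0\<close> the integrand, including the weight, is \<open>4 * 2 powr (- n / 2) * (1 - t) powr (- 3 / 2) * (1 + t) powr ((n - 3) / 2)\<close>, so reflection
reduces the mean to the preceding integral.\<close>

lemma zonal_mean_cap_eq_harmonic_const:
  assumes N: "N \<ge> 2"
  shows "zonal_mean N (\<lambda>t. 2 * (2 - 2 * t) powr (- real N / 2) * (if t \<le> 0 then 2 else 0)) = harmonic_boundary_const N"
proof -
  define n where "n = real N"
  have n: "n \<ge> 2" "n > 1" using N by (auto simp: n_def)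
  define E where "E = 1 + n - (n - 2) * hypergeometric (1 / 2) 1 ((n + 3) / 2) (- 1)"
  define I where "I = n * E / (2 * (n - 1) * (n + 1))"
  let ?h = "\<lambda>t. 2 * (2 - 2 * t) powr (- n / 2) * (if t \<le> 0 then 2 else 0) * zonal_weight n t"
  let ?c = "\<lambda>t. (1 + t) powr (- 3 / 2) * (1 - t) powr ((n - 3) / 2)"
  have "(?c has_integral I) {0..1}"
    using has_integral_cap[OF n(1)] by (simp add: has_integral_Icc_iff_Ioo I_def E_def)
  then have "((\<lambda>t. ?c (- t)) has_integral I) {-1..-0}"
    by (rule iffD2[OF has_integral_reflect_real[where f = ?c]])
  then have "((\<lambda>t. ?c (- t)) has_integral I) {-1<..<0}"
    by (simp add: has_integral_Icc_iff_Ioo)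
  then have "((\<lambda>t. 4 * 2 powr (- n / 2) * ?c (- t)) has_integral 4 * 2 powr (- n / 2) * I) {-1<..<0}"
    by (rule has_integral_mult_right)
  then have "((\<lambda>t. if t \<in> {-1<..<0} then 4 * 2 powr (- n / 2) * ?c (- t) else 0) has_integral 4 * 2 powr (- n / 2) * I) {-1<..<1}"
    by (subst has_integral_restrict) auto
  then have "(?h has_integral 4 * 2 powr (- n / 2) * I) {-1<..<1}"
  proof (rule has_integral_spike_finite[of "{0}", rotated 2])
    fix t :: real assume t: "t \<in> {-1<..<1} - {0}"
    show "?h t = (if t \<in> {-1<..<0} then 4 * 2 powr (- n / 2) * ?c (- t) else 0)"
    proof (cases "t < 0")
      case True
      have p1: "(2 - 2 * t) powr (- n / 2) = 2 powr (- n / 2) * (1 - t) powr (- n / 2)"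
      proof -
        have "2 - 2 * t = 2 * (1 - t)" by simp
        then show ?thesis using t powr_mult[of 2 "1 - t"] by (simp del: right_diff_distrib_numeral)
      qed
      have p2: "zonal_weight n t = (1 - t) powr ((n - 3) / 2) * (1 + t) powr ((n - 3) / 2)"
      proof -
        have "1 - t\<^sup>2 = (1 - t) * (1 + t)" by (simp add: power2_eq_square algebra_simps)
        then show ?thesis using t powr_mult[of "1 - t" "1 + t"] by (simp add: zonal_weight_def)
      qed
      have p3: "(1 - t) powr (- n / 2) * (1 - t) powr ((n - 3) / 2) = (1 - t) powr (- 3 / 2)"
      proof -
        have "- n / 2 + (n - 3) / 2 = - 3 / 2" by (simp add: field_simps)
        then show ?thesis by (simp only: powr_add[symmetric])
      qed
      have "?h t = 4 * 2 powr (- n / 2) * (((1 - t) powr (- n / 2) * (1 - t) powr ((n - 3) / 2)) * (1 + t) powr ((n - 3) / 2))"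
        unfolding p1 p2 using True by simp
      then show ?thesis unfolding p3 using True t by simp
    qed (use t in auto)
  qed simp
  then have mean: "zonal_mean n (\<lambda>t. 2 * (2 - 2 * t) powr (- n / 2) * (if t \<le> 0 then 2 else 0)) = 4 * 2 powr (- n / 2) * I / zonal_mass n"
    unfolding zonal_mean_def by (simp only: integral_unique)
  define g where "g = Gamma ((n - 1) / 2)"
  have g: "g > 0" using n by (simp add: g_def)
  obtain M where M: "N = M + 2" using N by (metis add.commute le_Suc_ex)
  have fac: "fact N = n * (n - 1) * (fact M :: real)" and Gm: "Gamma (n - 1) = fact M"
  proof -
    show "fact N = n * (n - 1) * (fact M :: real)" unfolding n_def M by (simp add: algebra_simps)
    have "n - 1 = 1 + real M" by (simp add: n_def M)
    then show "Gamma (n - 1) = fact M" using Gamma_fact[of M, where 'a = real] by simp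
  qed
  have W: "zonal_mass n = 2 powr (n - 2) * (g * g / fact M)"
    using zonal_mass(1)[OF n(2)] by (simp add: Beta_def g_def Gm)
  have G1: "Gamma ((n + 1) / 2) = (n - 1) / 2 * g"
  proof -
    have e: "(n + 1) / 2 = (n - 1) / 2 + 1" by (simp add: field_simps)
    show ?thesis unfolding e g_def using n by (intro Gamma_plus1 positive_not_nonpos_Int) simp
  qed
  have G2: "Gamma ((n + 3) / 2) = (n + 1) / 2 * ((n - 1) / 2 * g)"
  proof -
    have e: "(n + 3) / 2 = (n + 1) / 2 + 1" by (simp add: field_simps)
    show ?thesis unfolding e G1[symmetric] using n by (intro Gamma_plus1 positive_not_nonpos_Int) simp
  qed
  \<comment> \<open>the powers of two in the mean and in the total mass of the weight\<close>
  have two: "4 * 2 powr (- n / 2) / 2 powr (n - 2) = 16 / 2 powr (3 * n / 2)"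
  proof -
    have "4 * 2 powr (- n / 2) / 2 powr (n - 2) = (2::real) powr 2 * 2 powr (- n / 2) * 2 powr (2 - n)"
      by (simp add: powr_diff)
    also have "\<dots> = 2 powr (4 - 3 * n / 2)"
    proof -
      have "2 + - n / 2 + (2 - n) = 4 - 3 * n / 2" by (simp add: field_simps)
      then show ?thesis by (simp only: powr_add[symmetric])
    qed
    also have "\<dots> = 16 / 2 powr (3 * n / 2)" by (simp add: powr_diff)
    finally show ?thesis .
  qed
  have arith: "16 / T * (n * E / (2 * p * q) * f / (g * g)) = n * p * f * E / (T * (p / 2 * g) * (q / 2 * (p / 2 * g)))"
    if "p > 0" "q > 0" "T > 0" for p q T f :: real
    using that g by (simp add: field_simps)
  have "4 * 2 powr (- n / 2) * I / zonal_mass n = (4 * 2 powr (- n / 2) / 2 powr (n - 2)) * (I * fact M / (g * g))"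
    unfolding W by simp
  also have "\<dots> = harmonic_boundary_const N"
    unfolding two harmonic_boundary_const_def n_def[symmetric] G1 G2 fac E_def[symmetric] I_def
    using n by (intro arith) auto
  finally show ?thesis using mean by (simp add: n_def)
qed

section \<open>Lower bounds for the boundary growth\<close>

lemma poisson_kernel_zonal:
  fixes \<zeta> \<eta> :: "real ^ 'n"
  assumes \<zeta>: "norm \<zeta> = 1" and \<eta>: "norm \<eta> = 1" and r: "0 \<le> r" "r < 1"
  shows "poisson_kernel \<alpha> (r *\<^sub>R \<zeta>) \<eta> = poisson_const CARD('n) \<alpha> *
    ((1 - r\<^sup>2) powr (1 + \<alpha>) * sphere_dist2 r (\<eta> \<bullet> \<zeta>) powr (- ((real CARD('n) + \<alpha>) / 2)))"
proof -
  let ?p = "real CARD('n) + \<alpha>"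
  define d where "d = norm (r *\<^sub>R \<zeta> - \<eta>)"
  have d2: "d\<^sup>2 = sphere_dist2 r (\<eta> \<bullet> \<zeta>)"
    using \<zeta> \<eta> unfolding d_def power2_norm_eq_inner
    by (simp add: inner_diff_left inner_diff_right norm_eq_1 sphere_dist2_def inner_commute power2_eq_square)
  have "d > 0"
  proof -
    have "norm (r *\<^sub>R \<zeta>) \<noteq> norm \<eta>" using \<zeta> \<eta> r by simp
    then show ?thesis by (auto simp: d_def)
  qed
  then have "(d\<^sup>2) powr (q / 2) = d powr q" for q
    by (simp add: powr_powr powr_numeral[symmetric] del: powr_numeral)
  then have "d powr ?p = (d\<^sup>2) powr (?p / 2)" by (simp only:)
  then have "d powr ?p = sphere_dist2 r (\<eta> \<bullet> \<zeta>) powr (?p / 2)" by (simp only: d2)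
  then show ?thesis
    using \<zeta> by (simp add: poisson_kernel_def d_def[symmetric] powr_minus_divide)
qed

lemma poisson_const_0:
  assumes "N > 0"
  shows "poisson_const N 0 = 1"
proof -
  have "Gamma (real N / 2) > 0" using assms by (intro Gamma_real_pos) simp
  then show ?thesis by (simp add: poisson_const_def)
qed

lemma poisson_kernel_harmonic_zonal:
  fixes \<zeta> \<eta> :: "real ^ 'n"
  assumes "norm \<zeta> = 1" "norm \<eta> = 1" "0 \<le> r" "r < 1"
  shows "poisson_kernel 0 (r *\<^sub>R \<zeta>) \<eta> = (1 - r\<^sup>2) * sphere_dist2 r (\<eta> \<bullet> \<zeta>) powr (- real CARD('n) / 2)"
proof -
  have "1 - r\<^sup>2 > 0" using assms by (simp add: abs_square_less_1)
  then show ?thesis using poisson_kernel_zonal[OF assms, of 0] by (simp add: poisson_const_0)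
qed

lemma continuous_poisson_kernel:
  assumes "norm x < 1"
  shows "continuous_on (sphere 0 1) (poisson_kernel \<alpha> (x :: real ^ 'n))"
  unfolding poisson_kernel_def using assms
  by (intro continuous_intros continuous_on_powr') auto

lemma dirichlet_solution_vec_inner:
  fixes \<sigma> :: "(real ^ 'n) measure"
  assumes \<sigma>: "normalized_rotation_invariant \<sigma>" and \<phi>: "sphere_self_map \<phi>" and x: "norm x < 1"
  shows "dirichlet_solution_vec \<sigma> \<alpha> \<phi> x \<bullet> v = (\<integral>\<eta>. poisson_kernel \<alpha> x \<eta> * (\<phi> \<eta> \<bullet> v) \<partial>\<sigma>)"
proof -
  have int: "integrable \<sigma> (\<lambda>\<eta>. poisson_kernel \<alpha> x \<eta> * \<phi> \<eta> $ i)" for i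
    using \<phi> by (intro integrable_continuous_sphere[OF \<sigma>] continuous_intros continuous_poisson_kernel x)
                (simp add: sphere_self_map_def)
  have "dirichlet_solution_vec \<sigma> \<alpha> \<phi> x \<bullet> v = (\<Sum>i\<in>UNIV. (\<integral>\<eta>. poisson_kernel \<alpha> x \<eta> * \<phi> \<eta> $ i \<partial>\<sigma>) * v $ i)"
    using x by (simp add: dirichlet_solution_vec_def dirichlet_solution_def inner_vec_def)
  also have "\<dots> = (\<Sum>i\<in>UNIV. \<integral>\<eta>. poisson_kernel \<alpha> x \<eta> * \<phi> \<eta> $ i * v $ i \<partial>\<sigma>)" by simp
  also have "\<dots> = (\<integral>\<eta>. (\<Sum>i\<in>UNIV. poisson_kernel \<alpha> x \<eta> * \<phi> \<eta> $ i * v $ i) \<partial>\<sigma>)"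
    by (intro Bochner_Integration.integral_sum[symmetric] integrable_mult_left int)
  also have "\<dots> = (\<integral>\<eta>. poisson_kernel \<alpha> x \<eta> * (\<phi> \<eta> \<bullet> v) \<partial>\<sigma>)"
    by (simp add: inner_vec_def sum_distrib_left mult.assoc)
  finally show ?thesis .
qed

lemma norm_le_if_inner_le:
  fixes y :: "'a :: real_inner"
  assumes "\<And>v. norm v = 1 \<Longrightarrow> y \<bullet> v \<le> B" "B \<ge> 0"
  shows "norm y \<le> B"
proof (cases "y = 0")
  case False
  then have "y \<bullet> (y /\<^sub>R norm y) = norm y" by (simp add: power2_norm_eq_inner[symmetric] power2_eq_square)
  then show ?thesis using assms(1)[of "y /\<^sub>R norm y"] False by simp
qed (use assms in simp)

lemma norm_dirichlet_solution_vec_le: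
  fixes \<sigma> :: "(real ^ 'n) measure"
  assumes n: "CARD('n) \<ge> 2" and \<sigma>: "normalized_rotation_invariant \<sigma>" and \<phi>: "sphere_self_map \<phi>"
    and \<zeta>: "norm \<zeta> = 1" and r: "0 \<le> r" "r < 1" and c: "poisson_const CARD('n) \<alpha> \<ge> 0"
  shows "norm (dirichlet_solution_vec \<sigma> \<alpha> \<phi> (r *\<^sub>R \<zeta>)) \<le>
    zonal_mean CARD('n) (\<lambda>t. poisson_const CARD('n) \<alpha> *
      ((1 - r\<^sup>2) powr (1 + \<alpha>) * sphere_dist2 r t powr (- ((real CARD('n) + \<alpha>) / 2))))"
    (is "_ \<le> zonal_mean _ ?h")
proof (rule norm_le_if_inner_le)
  have h: "continuous_on {-1..1} ?h" by (intro continuous_intros continuous_sphere_dist2_powr r)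
  have x: "norm (r *\<^sub>R \<zeta>) < 1" using \<zeta> r by simp
  have P: "poisson_kernel \<alpha> (r *\<^sub>R \<zeta>) \<eta> = ?h (\<eta> \<bullet> \<zeta>)" if "\<eta> \<in> space \<sigma>" for \<eta>
    using poisson_kernel_zonal[OF \<zeta> _ r] that by (simp add: rotation_invariant_space(1)[OF \<sigma>])
  have P0: "poisson_kernel \<alpha> (r *\<^sub>R \<zeta>) \<eta> \<ge> 0" for \<eta> using c by (simp add: poisson_kernel_def)
  have iP: "(\<integral>\<eta>. poisson_kernel \<alpha> (r *\<^sub>R \<zeta>) \<eta> \<partial>\<sigma>) = zonal_mean CARD('n) ?h"
    unfolding zonal_integral[OF n \<sigma> \<zeta> h, symmetric] by (rule Bochner_Integration.integral_cong[OF refl P])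
  show "zonal_mean CARD('n) ?h \<ge> 0"
    unfolding iP[symmetric] by (rule Bochner_Integration.integral_nonneg[OF P0])
  fix v :: "real ^ 'n" assume v: "norm v = 1"
  have "dirichlet_solution_vec \<sigma> \<alpha> \<phi> (r *\<^sub>R \<zeta>) \<bullet> v = (\<integral>\<eta>. poisson_kernel \<alpha> (r *\<^sub>R \<zeta>) \<eta> * (\<phi> \<eta> \<bullet> v) \<partial>\<sigma>)"
    by (rule dirichlet_solution_vec_inner[OF \<sigma> \<phi> x])
  also have "\<dots> \<le> (\<integral>\<eta>. poisson_kernel \<alpha> (r *\<^sub>R \<zeta>) \<eta> \<partial>\<sigma>)"
  proof (rule integral_mono)
    show "integrable \<sigma> (\<lambda>\<eta>. poisson_kernel \<alpha> (r *\<^sub>R \<zeta>) \<eta> * (\<phi> \<eta> \<bullet> v))"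
      using \<phi> by (intro integrable_continuous_sphere[OF \<sigma>] continuous_intros continuous_poisson_kernel x)
                  (simp add: sphere_self_map_def)
    show "integrable \<sigma> (poisson_kernel \<alpha> (r *\<^sub>R \<zeta>))"
      by (intro integrable_continuous_sphere[OF \<sigma>] continuous_poisson_kernel x)
    fix \<eta> assume "\<eta> \<in> space \<sigma>"
    then have "\<phi> \<eta> \<bullet> v \<le> 1"
      using \<phi> inner_sphere_interval[of "\<phi> \<eta>" v] v
      by (auto simp: rotation_invariant_space(1)[OF \<sigma>] sphere_self_map_def)
    then show "poisson_kernel \<alpha> (r *\<^sub>R \<zeta>) \<eta> * (\<phi> \<eta> \<bullet> v) \<le> poisson_kernel \<alpha> (r *\<^sub>R \<zeta>) \<eta>"
      using mult_left_mono[OF _ P0] by fastforce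
  qed
  finally show "dirichlet_solution_vec \<sigma> \<alpha> \<phi> (r *\<^sub>R \<zeta>) \<bullet> v \<le> zonal_mean CARD('n) ?h" by (simp only: iP)
qed

text \<open>The condition at the centre says that \<open>\<phi>\<close> has mean zero, so the kernel may be replaced by \<open>P - p\<close> for any constant
\<open>p\<close>. The equatorial value makes the resulting bound optimal.\<close>

lemma norm_harmonic_solution_vec_le:
  fixes \<sigma> :: "(real ^ 'n) measure"
  assumes n: "CARD('n) \<ge> 2" and \<sigma>: "normalized_rotation_invariant \<sigma>" and \<phi>: "sphere_self_map \<phi>"
    and \<zeta>: "norm \<zeta> = 1" and r: "0 \<le> r" "r < 1" and z: "dirichlet_solution_vec \<sigma> 0 \<phi> 0 = 0"
  shows "norm (dirichlet_solution_vec \<sigma> 0 \<phi> (r *\<^sub>R \<zeta>)) \<le>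
    1 - (1 - r) * zonal_mean CARD('n) (\<lambda>t. (1 + r) * sphere_dist2 r t powr (- real CARD('n) / 2) * (if t \<le> 0 then 2 else 0))"
proof -
  let ?n = "real CARD('n)"
  define p where "p = (1 - r\<^sup>2) * (1 + r\<^sup>2) powr (- ?n / 2)"
  define h where "h t = \<bar>(1 - r\<^sup>2) * sphere_dist2 r t powr (- ?n / 2) - p\<bar>" for t
  have n1: "?n > 1" using n by simp
  have h: "continuous_on {-1..1} h" unfolding h_def by (intro continuous_intros continuous_sphere_dist2_powr r)
  have x: "norm (r *\<^sub>R \<zeta>) < 1" using \<zeta> r by simp
  let ?P = "poisson_kernel 0 (r *\<^sub>R \<zeta>)"
  have cP: "continuous_on (sphere 0 1) ?P" by (rule continuous_poisson_kernel[OF x])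
  have c\<phi>: "continuous_on (sphere 0 1) \<phi>" using \<phi> by (simp add: sphere_self_map_def)
  have P: "\<bar>?P \<eta> - p\<bar> = h (\<eta> \<bullet> \<zeta>)" if "\<eta> \<in> space \<sigma>" for \<eta>
    using poisson_kernel_harmonic_zonal[OF \<zeta> _ r] that by (simp add: rotation_invariant_space(1)[OF \<sigma>] h_def)
  have iP: "(\<integral>\<eta>. \<bar>?P \<eta> - p\<bar> \<partial>\<sigma>) = zonal_mean ?n h"
    unfolding zonal_integral[OF n \<sigma> \<zeta> h, symmetric] by (rule Bochner_Integration.integral_cong[OF refl P])
  have "norm (dirichlet_solution_vec \<sigma> 0 \<phi> (r *\<^sub>R \<zeta>)) \<le> zonal_mean ?n h"
  proof (rule norm_le_if_inner_le)
    show "zonal_mean ?n h \<ge> 0" unfolding iP[symmetric] by (rule Bochner_Integration.integral_nonneg) simp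
    fix v :: "real ^ 'n" assume v: "norm v = 1"
    have i1: "integrable \<sigma> (\<lambda>\<eta>. ?P \<eta> * (\<phi> \<eta> \<bullet> v))"
      by (intro integrable_continuous_sphere[OF \<sigma>] continuous_intros cP c\<phi>)
    have i2: "integrable \<sigma> (\<lambda>\<eta>. \<phi> \<eta> \<bullet> v)"
      by (intro integrable_continuous_sphere[OF \<sigma>] continuous_intros c\<phi>)
    have "(\<integral>\<eta>. \<phi> \<eta> \<bullet> v \<partial>\<sigma>) = (\<integral>\<eta>. poisson_kernel 0 0 \<eta> * (\<phi> \<eta> \<bullet> v) \<partial>\<sigma>)"
      by (rule Bochner_Integration.integral_cong[OF refl])
         (simp add: poisson_kernel_def poisson_const_0 rotation_invariant_space(1)[OF \<sigma>])
    also have "\<dots> = 0" using dirichlet_solution_vec_inner[OF \<sigma> \<phi>, of 0 0 v] z by simp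
    finally have zero: "(\<integral>\<eta>. \<phi> \<eta> \<bullet> v \<partial>\<sigma>) = 0" .
    have "dirichlet_solution_vec \<sigma> 0 \<phi> (r *\<^sub>R \<zeta>) \<bullet> v = (\<integral>\<eta>. ?P \<eta> * (\<phi> \<eta> \<bullet> v) \<partial>\<sigma>) - p * (\<integral>\<eta>. \<phi> \<eta> \<bullet> v \<partial>\<sigma>)"
      unfolding zero using dirichlet_solution_vec_inner[OF \<sigma> \<phi> x] by simp
    also have "\<dots> = (\<integral>\<eta>. ?P \<eta> * (\<phi> \<eta> \<bullet> v) - p * (\<phi> \<eta> \<bullet> v) \<partial>\<sigma>)"
      using i1 i2 by simp
    also have "\<dots> \<le> (\<integral>\<eta>. \<bar>?P \<eta> - p\<bar> \<partial>\<sigma>)"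
    proof (rule integral_mono)
      show "integrable \<sigma> (\<lambda>\<eta>. ?P \<eta> * (\<phi> \<eta> \<bullet> v) - p * (\<phi> \<eta> \<bullet> v))" using i1 i2 by simp
      show "integrable \<sigma> (\<lambda>\<eta>. \<bar>?P \<eta> - p\<bar>)"
        by (intro integrable_continuous_sphere[OF \<sigma>] continuous_intros cP)
      fix \<eta> assume "\<eta> \<in> space \<sigma>"
      then have "\<bar>\<phi> \<eta> \<bullet> v\<bar> \<le> 1"
        using \<phi> inner_sphere_interval[of "\<phi> \<eta>" v] v
        by (auto simp: rotation_invariant_space(1)[OF \<sigma>] sphere_self_map_def)
      then have "\<bar>?P \<eta> - p\<bar> * \<bar>\<phi> \<eta> \<bullet> v\<bar> \<le> \<bar>?P \<eta> - p\<bar> * 1" by (intro mult_left_mono) auto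
      moreover have "?P \<eta> * (\<phi> \<eta> \<bullet> v) - p * (\<phi> \<eta> \<bullet> v) \<le> \<bar>?P \<eta> - p\<bar> * \<bar>\<phi> \<eta> \<bullet> v\<bar>"
        unfolding abs_mult[symmetric] left_diff_distrib[symmetric] by (rule abs_ge_self)
      ultimately show "?P \<eta> * (\<phi> \<eta> \<bullet> v) - p * (\<phi> \<eta> \<bullet> v) \<le> \<bar>?P \<eta> - p\<bar>" by simp
    qed
    finally show "dirichlet_solution_vec \<sigma> 0 \<phi> (r *\<^sub>R \<zeta>) \<bullet> v \<le> zonal_mean ?n h" by (simp only: iP)
  qed
  also have "zonal_mean ?n h = 1 - (1 - r) * zonal_mean CARD('n) (\<lambda>t. (1 + r) * sphere_dist2 r t powr (- ?n / 2) * (if t \<le> 0 then 2 else 0))"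
    unfolding h_def p_def by (rule zonal_mean_poisson_deviation[OF n1 r])
  finally show ?thesis .
qed

text \<open>By the reverse triangle inequality it suffices to know how fast \<open>|f|\<close> leaves \<open>1\<close> along the radius.\<close>

lemma boundary_liminf_ge:
  fixes f :: "real ^ 'n \<Rightarrow> real ^ 'n"
  assumes "norm (f \<zeta>) = 1" and le: "\<And>r. 0 < r \<Longrightarrow> r < 1 \<Longrightarrow> norm (f (r *\<^sub>R \<zeta>)) \<le> u r"
    and lim: "((\<lambda>r. (1 - u r) / (1 - r)) \<longlongrightarrow> L) (at_left 1)"
  shows "boundary_liminf f \<zeta> \<ge> ereal L"
proof -
  have "ereal L = Liminf (at_left 1) (\<lambda>r. ereal ((1 - u r) / (1 - r)))"
    using lim by (intro lim_imp_Liminf[symmetric]) auto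
  also have "\<dots> \<le> boundary_liminf f \<zeta>"
    unfolding boundary_liminf_def
  proof (rule Liminf_mono)
    show "eventually (\<lambda>r. ereal ((1 - u r) / (1 - r)) \<le> ereal (norm (f \<zeta> - f (r *\<^sub>R \<zeta>)) / (1 - r))) (at_left 1)"
      using eventually_at_left_real[of 0 1, simplified]
    proof eventually_elim
      case (elim r)
      then have "1 - u r \<le> norm (f \<zeta> - f (r *\<^sub>R \<zeta>))"
        using le[of r] norm_triangle_ineq2[of "f \<zeta>" "f (r *\<^sub>R \<zeta>)"] assms(1) by simp
      then show ?case using elim by (simp add: divide_right_mono)
    qed
  qed
  finally show ?thesis .
qed

section \<open>Nearly extremal maps\<close>

text \<open>The pole is \<open>axis k 1\<close>. Outside the belt \<open>|\<eta> $ k| < \<epsilon>\<close> only the polar component is left. At the equator, where that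
component vanishes, the others do not, so the field has no zero on the sphere and can be normalized. It
commutes with changes of sign of the coordinates.\<close>

definition extremal_field :: "real \<Rightarrow> 'n \<Rightarrow> real ^ 'n \<Rightarrow> real ^ 'n" where
  "extremal_field \<epsilon> k \<eta> = (\<chi> i. if i = k then \<eta> $ k else max 0 (\<epsilon> - \<bar>\<eta> $ k\<bar>) * \<eta> $ i)"

definition extremal_map :: "real \<Rightarrow> 'n \<Rightarrow> real ^ 'n \<Rightarrow> real ^ 'n" where
  "extremal_map \<epsilon> k \<eta> = extremal_field \<epsilon> k \<eta> /\<^sub>R norm (extremal_field \<epsilon> k \<eta>)"

text \<open>The polar component of the normalized field at latitude \<open>t\<close>.\<close>

definition extremal_height :: "real \<Rightarrow> real \<Rightarrow> real" where
  "extremal_height \<epsilon> t = t / sqrt (t\<^sup>2 + (max 0 (\<epsilon> - \<bar>t\<bar>))\<^sup>2 * (1 - t\<^sup>2))"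

lemma norm_extremal_field:
  fixes \<eta> :: "real ^ 'n"
  assumes "norm \<eta> = 1"
  shows "norm (extremal_field \<epsilon> k \<eta>) = sqrt ((\<eta> $ k)\<^sup>2 + (max 0 (\<epsilon> - \<bar>\<eta> $ k\<bar>))\<^sup>2 * (1 - (\<eta> $ k)\<^sup>2))"
proof -
  let ?m = "max 0 (\<epsilon> - \<bar>\<eta> $ k\<bar>)"
  have "(\<Sum>i\<in>UNIV. (\<eta> $ i)\<^sup>2) = 1"
    using assms by (simp add: norm_eq_1 inner_vec_def power2_eq_square)
  then have rest: "(\<Sum>i\<in>UNIV-{k}. (\<eta> $ i)\<^sup>2) = 1 - (\<eta> $ k)\<^sup>2"
    by (simp add: sum.remove[of UNIV k])
  have "extremal_field \<epsilon> k \<eta> \<bullet> extremal_field \<epsilon> k \<eta> = (\<Sum>i\<in>UNIV. (extremal_field \<epsilon> k \<eta> $ i)\<^sup>2)"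
    by (simp add: inner_vec_def power2_eq_square)
  also have "\<dots> = (\<eta> $ k)\<^sup>2 + (\<Sum>i\<in>UNIV-{k}. ?m\<^sup>2 * (\<eta> $ i)\<^sup>2)"
    by (simp add: sum.remove[of UNIV k] extremal_field_def power_mult_distrib)
  also have "\<dots> = (\<eta> $ k)\<^sup>2 + ?m\<^sup>2 * (1 - (\<eta> $ k)\<^sup>2)"
    by (simp add: sum_distrib_left[symmetric] rest)
  finally show ?thesis by (simp add: norm_eq_sqrt_inner)
qed

lemma extremal_denominator_pos:
  fixes t :: real
  assumes "0 < \<epsilon>" "\<epsilon> \<le> 1"
  shows "t\<^sup>2 + (max 0 (\<epsilon> - \<bar>t\<bar>))\<^sup>2 * (1 - t\<^sup>2) > 0" "t\<^sup>2 \<le> t\<^sup>2 + (max 0 (\<epsilon> - \<bar>t\<bar>))\<^sup>2 * (1 - t\<^sup>2)"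
proof -
  have nn: "(max 0 (\<epsilon> - \<bar>t\<bar>))\<^sup>2 * (1 - t\<^sup>2) \<ge> 0"
  proof (cases "\<bar>t\<bar> \<le> 1")
    case True
    then show ?thesis by (intro mult_nonneg_nonneg) (auto simp: abs_square_le_1)
  qed (use assms in auto)
  then show "t\<^sup>2 \<le> t\<^sup>2 + (max 0 (\<epsilon> - \<bar>t\<bar>))\<^sup>2 * (1 - t\<^sup>2)" by simp
  show "t\<^sup>2 + (max 0 (\<epsilon> - \<bar>t\<bar>))\<^sup>2 * (1 - t\<^sup>2) > 0"
  proof (cases "t = 0")
    case False
    then show ?thesis using nn by (intro add_pos_nonneg) auto
  qed (use assms in auto)
qed

lemma extremal_height_bound:
  assumes "0 < \<epsilon>" "\<epsilon> \<le> 1"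
  shows "\<bar>extremal_height \<epsilon> t\<bar> \<le> 1"
proof -
  let ?d = "t\<^sup>2 + (max 0 (\<epsilon> - \<bar>t\<bar>))\<^sup>2 * (1 - t\<^sup>2)"
  have "\<bar>t\<bar> \<le> sqrt ?d"
    using extremal_denominator_pos(2)[OF assms, of t] by (metis real_sqrt_abs real_sqrt_le_mono)
  moreover have "sqrt ?d > 0" using extremal_denominator_pos(1)[OF assms, of t] by simp
  ultimately show ?thesis by (simp add: extremal_height_def)
qed

lemma extremal_height_sgn:
  assumes "0 < \<epsilon>" "\<epsilon> \<le> \<bar>t\<bar>"
  shows "extremal_height \<epsilon> t = sgn t"
  using assms by (simp add: extremal_height_def real_sgn_eq)

lemma continuous_extremal_height:
  assumes "0 < \<epsilon>" "\<epsilon> \<le> 1"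
  shows "continuous_on A (extremal_height \<epsilon>)"
proof -
  have "sqrt (t\<^sup>2 + (max 0 (\<epsilon> - \<bar>t\<bar>))\<^sup>2 * (1 - t\<^sup>2)) \<noteq> 0" for t
    using extremal_denominator_pos(1)[OF assms, of t] by simp
  then show ?thesis
    unfolding extremal_height_def[abs_def] by (intro continuous_intros ballI)
qed

lemma extremal_map_sphere_self_map:
  assumes "0 < \<epsilon>" "\<epsilon> \<le> 1"
  shows "sphere_self_map (extremal_map \<epsilon> (k :: 'n :: finite))"
proof -
  have nz: "norm (extremal_field \<epsilon> k \<eta>) \<noteq> 0" if "norm \<eta> = 1" for \<eta>
    using extremal_denominator_pos(1)[OF assms, of "\<eta> $ k"] norm_extremal_field[OF that, of \<epsilon> k] by simp
  have "continuous_on (sphere 0 1) (\<lambda>\<eta>. extremal_field \<epsilon> k \<eta> $ i)" for i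
    unfolding extremal_field_def by (cases "i = k") (auto intro!: continuous_intros)
  then have "continuous_on (sphere 0 1) (\<lambda>\<eta>. \<chi> i. extremal_field \<epsilon> k \<eta> $ i)"
    by (intro continuous_on_vec_lambda)
  then have "continuous_on (sphere 0 1) (extremal_field \<epsilon> k)" by simp
  then have "continuous_on (sphere 0 1) (extremal_map \<epsilon> k)"
    unfolding extremal_map_def[abs_def] using nz by (intro continuous_intros) auto
  then show ?thesis using nz by (auto simp: sphere_self_map_def extremal_map_def)
qed

text \<open>Both vectors are unit vectors, so their distance is a function of the latitude alone.\<close>

lemma extremal_map_distance:
  fixes k :: "'n :: finite"
  assumes \<epsilon>: "0 < \<epsilon>" "\<epsilon> \<le> 1" and \<eta>: "norm \<eta> = 1"
  shows "norm (axis k 1 - extremal_map \<epsilon> k \<eta>) = sqrt (2 - 2 * extremal_height \<epsilon> (\<eta> $ k))"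
proof -
  have "norm (extremal_map \<epsilon> k \<eta>) = 1"
    using extremal_map_sphere_self_map[OF \<epsilon>, of k] \<eta> by (simp add: sphere_self_map_def)
  then have 1: "extremal_map \<epsilon> k \<eta> \<bullet> extremal_map \<epsilon> k \<eta> = 1" by (simp add: norm_eq_1)
  have 2: "axis k 1 \<bullet> extremal_map \<epsilon> k \<eta> = extremal_height \<epsilon> (\<eta> $ k)"
  proof -
    have "axis k 1 \<bullet> extremal_map \<epsilon> k \<eta> = extremal_field \<epsilon> k \<eta> $ k / norm (extremal_field \<epsilon> k \<eta>)"
      by (simp add: inner_axis' extremal_map_def divide_inverse mult.commute)
    also have "extremal_field \<epsilon> k \<eta> $ k = \<eta> $ k" by (simp add: extremal_field_def)
    finally show ?thesis unfolding norm_extremal_field[OF \<eta>] extremal_height_def .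
  qed
  have "(axis k 1 - extremal_map \<epsilon> k \<eta>) \<bullet> (axis k 1 - extremal_map \<epsilon> k \<eta>) = 2 - 2 * extremal_height \<epsilon> (\<eta> $ k)"
    using 1 2 by (simp add: inner_diff_left inner_diff_right inner_commute[of "extremal_map \<epsilon> k \<eta>" "axis k 1"] inner_axis_axis)
  then show ?thesis by (simp add: norm_eq_sqrt_inner)
qed

lemma extremal_map_pole:
  fixes k :: "'n :: finite"
  assumes "0 < \<epsilon>" "\<epsilon> \<le> 1"
  shows "extremal_map \<epsilon> k (axis k 1) = axis k 1"
  using extremal_map_distance[OF assms, of "axis k 1" k] extremal_height_sgn[of \<epsilon> 1] assms by simp

text \<open>For \<open>j \<noteq> i\<close> the change of sign of the coordinates \<open>i\<close> and \<open>j\<close> has determinant \<open>1\<close>, and it reverses the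
\<open>i\<close>-th component of the map.\<close>

lemma extremal_map_centred:
  fixes \<sigma> :: "(real ^ 'n) measure"
  assumes n: "CARD('n) \<ge> 2" and \<sigma>: "normalized_rotation_invariant \<sigma>" and \<epsilon>: "0 < \<epsilon>" "\<epsilon> \<le> 1"
  shows "dirichlet_solution_vec \<sigma> 0 (extremal_map \<epsilon> k) 0 = 0"
proof -
  let ?\<phi> = "extremal_map \<epsilon> k"
  have "dirichlet_solution \<sigma> 0 (\<lambda>\<eta>. ?\<phi> \<eta> $ i) 0 = 0" for i
  proof -
    obtain j where j: "j \<noteq> i"
    proof -
      have "UNIV \<noteq> {i}"
      proof
        assume "UNIV = {i}"
        then have "CARD('n) = card {i}" by (rule arg_cong)
        then show False using n by simp
      qed
      then show ?thesis using that by blast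
    qed
    define s :: "'n \<Rightarrow> real" where "s a = (if a = i \<or> a = j then - 1 else 1)" for a
    define R :: "real ^ 'n ^ 'n" where "R = (\<chi> a b. if a = b then s a else 0)"
    have s2: "s a * s a = 1" for a by (simp add: s_def)
    have Rx: "(R *v x) $ a = s a * x $ a" for x a
      by (simp add: R_def matrix_vector_mult_def if_distrib[where f = "\<lambda>z. z * _"] cong: if_cong)
    have "det R = (\<Prod>a\<in>UNIV. s a)"
      by (subst det_diagonal) (auto simp: R_def)
    also have "\<dots> = (\<Prod>a\<in>{i, j}. s a)"
      by (rule prod.mono_neutral_right) (auto simp: s_def)
    also have "\<dots> = 1" using j by (simp add: s_def)
    finally have "det R = 1" .
    moreover have "orthogonal_matrix R"
      unfolding orthogonal_matrix_def
    proof
      show "transpose R ** R = mat 1" "R ** transpose R = mat 1"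
        by (auto simp: vec_eq_iff matrix_matrix_mult_def transpose_def R_def mat_def s2
            if_distrib[where f = "\<lambda>z. z * _"] if_distrib[where f = "\<lambda>z. _ * z"] cong: if_cong)
    qed
    ultimately have R: "rotation_matrix R" by (simp add: rotation_matrix_def)
    \<comment> \<open>the belt is unchanged, as \<open>R\<close> preserves \<open>|\<eta> $ k|\<close>\<close>
    have F: "extremal_field \<epsilon> k (R *v \<eta>) = R *v extremal_field \<epsilon> k \<eta>" for \<eta>
      by (simp add: vec_eq_iff extremal_field_def Rx) (simp add: s_def)
    have "?\<phi> (R *v \<eta>) $ i = - ?\<phi> \<eta> $ i" for \<eta>
      using rotation_matrix_norm(1)[OF R] by (simp add: extremal_map_def F Rx) (simp add: s_def)
    moreover have "(\<integral>\<eta>. ?\<phi> (R *v \<eta>) $ i \<partial>\<sigma>) = (\<integral>\<eta>. ?\<phi> \<eta> $ i \<partial>\<sigma>)"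
      using extremal_map_sphere_self_map[OF \<epsilon>, of k]
      by (intro integral_rotation_invariant[OF \<sigma> _ R, of "\<lambda>\<eta>. ?\<phi> \<eta> $ i"] continuous_on_component)
         (simp add: sphere_self_map_def)
    ultimately have "(\<integral>\<eta>. ?\<phi> \<eta> $ i \<partial>\<sigma>) = 0" by simp
    moreover have "(\<integral>\<eta>. poisson_kernel 0 0 \<eta> * ?\<phi> \<eta> $ i \<partial>\<sigma>) = (\<integral>\<eta>. ?\<phi> \<eta> $ i \<partial>\<sigma>)"
      by (rule Bochner_Integration.integral_cong[OF refl])
         (simp add: poisson_kernel_def poisson_const_0 rotation_invariant_space(1)[OF \<sigma>])
    ultimately show ?thesis by (simp add: dirichlet_solution_def)
  qed
  then show ?thesis by (simp add: dirichlet_solution_vec_def vec_eq_iff)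
qed

text \<open>As the kernel has mass \<open>1\<close>, the distance of \<open>\<zeta>\<close> and \<open>f (r \<zeta>)\<close> is at most the mean of \<open>|\<zeta> - \<phi>|\<close> with respect to the
kernel. This function is zonal and vanishes around \<open>\<zeta>\<close>.\<close>

lemma extremal_map_boundary_liminf_le:
  fixes \<sigma> :: "(real ^ 'n) measure"
  assumes n: "CARD('n) \<ge> 2" and \<sigma>: "normalized_rotation_invariant \<sigma>" and \<epsilon>: "0 < \<epsilon>" "\<epsilon> \<le> 1 / 2"
  shows "boundary_liminf (dirichlet_solution_vec \<sigma> 0 (extremal_map \<epsilon> k)) (axis k 1) \<le>
    ereal (zonal_mean CARD('n) (\<lambda>t. 2 * (2 - 2 * t) powr (- real CARD('n) / 2) * sqrt (2 - 2 * extremal_height \<epsilon> t)))"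
proof -
  let ?n = "real CARD('n)" and ?\<phi> = "extremal_map \<epsilon> k"
  define \<zeta> :: "real ^ 'n" where "\<zeta> = axis k 1"
  have \<zeta>: "norm \<zeta> = 1" "\<eta> \<bullet> \<zeta> = \<eta> $ k" for \<eta> by (simp_all add: \<zeta>_def inner_axis)
  have \<epsilon>1: "\<epsilon> \<le> 1" using \<epsilon> by simp
  have n1: "?n > 1" using n by simp
  note hb = extremal_height_bound[OF \<epsilon>(1) \<epsilon>1]
  define \<psi> where "\<psi> t = sqrt (2 - 2 * extremal_height \<epsilon> t)" for t
  have \<psi>c: "continuous_on A \<psi>" for A
    unfolding \<psi>_def by (intro continuous_intros continuous_extremal_height \<epsilon> \<epsilon>1)
  define u where "u r = zonal_mean ?n (\<lambda>t. (1 + r) * sphere_dist2 r t powr (- ?n / 2) * \<psi> t)" for r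
  have lim: "(u \<longlongrightarrow> zonal_mean ?n (\<lambda>t. 2 * (2 - 2 * t) powr (- ?n / 2) * \<psi> t)) (at_left 1)"
    unfolding u_def
  proof (rule poisson_truncated_limit[OF n1, where B = 2])
    show "\<psi> \<in> borel_measurable borel" by (rule borel_measurable_continuous_onI[OF \<psi>c])
    show "\<bar>\<psi> t\<bar> \<le> 2" for t
      using hb[of t] by (auto simp: \<psi>_def abs_le_iff intro!: real_le_lsqrt)
    show "\<psi> t = 0" if "t \<ge> 1 / 2" for t
      using extremal_height_sgn[OF \<epsilon>(1), of t] that \<epsilon> by (simp add: \<psi>_def)
  qed
  have c\<phi>: "continuous_on (sphere 0 1) ?\<phi>"
    using extremal_map_sphere_self_map[OF \<epsilon>(1) \<epsilon>1, of k] by (simp add: sphere_self_map_def)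
  have pole: "dirichlet_solution_vec \<sigma> 0 ?\<phi> \<zeta> = \<zeta>"
    using \<zeta>(1) extremal_map_pole[OF \<epsilon>(1) \<epsilon>1, of k]
    by (simp add: vec_eq_iff dirichlet_solution_vec_def dirichlet_solution_def \<zeta>_def)
  have bound: "norm (\<zeta> - dirichlet_solution_vec \<sigma> 0 ?\<phi> (r *\<^sub>R \<zeta>)) \<le> (1 - r) * u r" if r: "0 \<le> r" "r < 1" for r
  proof -
    have x: "norm (r *\<^sub>R \<zeta>) < 1" using \<zeta> r by simp
    let ?P = "poisson_kernel 0 (r *\<^sub>R \<zeta>)"
    define h where "h t = (1 - r\<^sup>2) * sphere_dist2 r t powr (- ?n / 2)" for t
    have h: "continuous_on {-1..1} h" unfolding h_def by (intro continuous_intros continuous_sphere_dist2_powr r)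
    have cP: "continuous_on (sphere 0 1) ?P" by (rule continuous_poisson_kernel[OF x])
    have P: "?P \<eta> = h (\<eta> \<bullet> \<zeta>)" if "\<eta> \<in> space \<sigma>" for \<eta>
      using poisson_kernel_harmonic_zonal[OF \<zeta>(1) _ r] that by (simp add: rotation_invariant_space(1)[OF \<sigma>] h_def)
    have P0: "?P \<eta> \<ge> 0" for \<eta> by (simp add: poisson_kernel_def poisson_const_0)
    have mass: "(\<integral>\<eta>. ?P \<eta> \<partial>\<sigma>) = 1"
    proof -
      have "(\<integral>\<eta>. ?P \<eta> \<partial>\<sigma>) = (\<integral>\<eta>. h (\<eta> \<bullet> \<zeta>) \<partial>\<sigma>)" by (rule Bochner_Integration.integral_cong[OF refl P])
      also have "\<dots> = zonal_mean ?n h" by (rule zonal_integral[OF n \<sigma> \<zeta>(1) h])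
      also have "\<dots> = 1" unfolding h_def by (rule zonal_mean_poisson[OF n1 r])
      finally show ?thesis .
    qed
    have total: "(\<integral>\<eta>. ?P \<eta> * norm (\<zeta> - ?\<phi> \<eta>) \<partial>\<sigma>) = (1 - r) * u r"
    proof -
      have "(\<integral>\<eta>. ?P \<eta> * norm (\<zeta> - ?\<phi> \<eta>) \<partial>\<sigma>) = (\<integral>\<eta>. h (\<eta> \<bullet> \<zeta>) * \<psi> (\<eta> \<bullet> \<zeta>) \<partial>\<sigma>)"
      proof (rule Bochner_Integration.integral_cong[OF refl])
        fix \<eta> assume "\<eta> \<in> space \<sigma>"
        then show "?P \<eta> * norm (\<zeta> - ?\<phi> \<eta>) = h (\<eta> \<bullet> \<zeta>) * \<psi> (\<eta> \<bullet> \<zeta>)"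
          using P[of \<eta>] extremal_map_distance[OF \<epsilon>(1) \<epsilon>1, of \<eta> k]
          by (simp add: rotation_invariant_space(1)[OF \<sigma>] \<zeta>(2) \<psi>_def) (simp add: \<zeta>_def)
      qed
      also have "\<dots> = zonal_mean ?n (\<lambda>t. h t * \<psi> t)"
        by (rule zonal_integral[OF n \<sigma> \<zeta>(1)]) (intro continuous_intros h \<psi>c)
      also have "\<dots> = zonal_mean ?n (\<lambda>t. (1 - r) * ((1 + r) * sphere_dist2 r t powr (- ?n / 2) * \<psi> t))"
        by (simp add: h_def power2_eq_square algebra_simps)
      also have "\<dots> = (1 - r) * u r" unfolding u_def by (rule zonal_mean_cmult[OF n1])
      finally show ?thesis .
    qed
    show ?thesis
    proof (rule norm_le_if_inner_le)
      show "(1 - r) * u r \<ge> 0"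
        unfolding total[symmetric] by (rule Bochner_Integration.integral_nonneg) (simp add: P0)
      fix v :: "real ^ 'n" assume v: "norm v = 1"
      have i0: "integrable \<sigma> ?P" by (rule integrable_continuous_sphere[OF \<sigma> cP])
      have i1: "integrable \<sigma> (\<lambda>\<eta>. ?P \<eta> * (?\<phi> \<eta> \<bullet> v))"
        by (intro integrable_continuous_sphere[OF \<sigma>] continuous_intros cP c\<phi>)
      have "(\<zeta> - dirichlet_solution_vec \<sigma> 0 ?\<phi> (r *\<^sub>R \<zeta>)) \<bullet> v
          = (\<integral>\<eta>. ?P \<eta> * (\<zeta> \<bullet> v) \<partial>\<sigma>) - (\<integral>\<eta>. ?P \<eta> * (?\<phi> \<eta> \<bullet> v) \<partial>\<sigma>)"
        using dirichlet_solution_vec_inner[OF \<sigma> extremal_map_sphere_self_map[OF \<epsilon>(1) \<epsilon>1] x] mass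
        by (simp add: inner_diff_left)
      also have "\<dots> = (\<integral>\<eta>. ?P \<eta> * (\<zeta> \<bullet> v) - ?P \<eta> * (?\<phi> \<eta> \<bullet> v) \<partial>\<sigma>)"
        using i0 i1 by simp
      also have "\<dots> \<le> (\<integral>\<eta>. ?P \<eta> * norm (\<zeta> - ?\<phi> \<eta>) \<partial>\<sigma>)"
      proof (rule integral_mono)
        show "integrable \<sigma> (\<lambda>\<eta>. ?P \<eta> * (\<zeta> \<bullet> v) - ?P \<eta> * (?\<phi> \<eta> \<bullet> v))" using i0 i1 by simp
        show "integrable \<sigma> (\<lambda>\<eta>. ?P \<eta> * norm (\<zeta> - ?\<phi> \<eta>))"
          by (intro integrable_continuous_sphere[OF \<sigma>] continuous_intros cP c\<phi>)
        fix \<eta>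
        have "(\<zeta> - ?\<phi> \<eta>) \<bullet> v \<le> norm (\<zeta> - ?\<phi> \<eta>)"
          using norm_cauchy_schwarz[of "\<zeta> - ?\<phi> \<eta>" v] v by simp
        then have "?P \<eta> * ((\<zeta> - ?\<phi> \<eta>) \<bullet> v) \<le> ?P \<eta> * norm (\<zeta> - ?\<phi> \<eta>)"
          by (rule mult_left_mono[OF _ P0])
        then show "?P \<eta> * (\<zeta> \<bullet> v) - ?P \<eta> * (?\<phi> \<eta> \<bullet> v) \<le> ?P \<eta> * norm (\<zeta> - ?\<phi> \<eta>)"
          by (simp only: inner_diff_left right_diff_distrib)
      qed
      finally show "(\<zeta> - dirichlet_solution_vec \<sigma> 0 ?\<phi> (r *\<^sub>R \<zeta>)) \<bullet> v \<le> (1 - r) * u r"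
        by (simp only: total)
    qed
  qed
  have "boundary_liminf (dirichlet_solution_vec \<sigma> 0 ?\<phi>) \<zeta> \<le> Liminf (at_left 1) (\<lambda>r. ereal (u r))"
    unfolding boundary_liminf_def pole
  proof (rule Liminf_mono)
    show "eventually (\<lambda>r. ereal (norm (\<zeta> - dirichlet_solution_vec \<sigma> 0 ?\<phi> (r *\<^sub>R \<zeta>)) / (1 - r)) \<le> ereal (u r)) (at_left 1)"
      using eventually_at_left_real[of 0 1, simplified]
      by eventually_elim (use bound in \<open>simp add: pos_divide_le_eq mult.commute\<close>)
  qed
  also have "\<dots> = ereal (zonal_mean ?n (\<lambda>t. 2 * (2 - 2 * t) powr (- ?n / 2) * \<psi> t))"
    using lim by (intro lim_imp_Liminf) auto
  finally show ?thesis by (simp add: \<psi>_def \<zeta>_def)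
qed

text \<open>As the belt shrinks, the distance tends to \<open>2\<close> on the lower and to \<open>0\<close> on the upper hemisphere. On the equator it is
\<open>sqrt 2\<close> for every belt, which the mean does not see.\<close>

lemma extremal_constants_tendsto:
  assumes n: "n > 1"
  shows "(\<lambda>m. zonal_mean n (\<lambda>t. 2 * (2 - 2 * t) powr (- n / 2) * sqrt (2 - 2 * extremal_height (1 / (real m + 2)) t)))
    \<longlonglongrightarrow> zonal_mean n (\<lambda>t. 2 * (2 - 2 * t) powr (- n / 2) * (if t \<le> 0 then 2 else 0))"
proof -
  define \<epsilon> where "\<epsilon> m = 1 / (real m + 2)" for m
  have \<epsilon>: "\<epsilon> m > 0" "\<epsilon> m \<le> 1 / 2" "\<epsilon> m \<le> 1" for m by (simp_all add: \<epsilon>_def field_simps)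
  have \<epsilon>0: "\<epsilon> \<longlonglongrightarrow> 0" unfolding \<epsilon>_def
    using LIMSEQ_ignore_initial_segment[OF lim_1_over_n[where 'a = real], of 2] by (simp add: add.commute)
  define \<psi> where "\<psi> m t = sqrt (2 - 2 * extremal_height (\<epsilon> m) t)" for m t
  define g where "g t = 2 * (2 - 2 * t) powr (- n / 2) * (if t < 0 then 2 else if t = 0 then sqrt 2 else 0)" for t :: real
  have bound: "\<bar>2 * (2 - 2 * t) powr (- n / 2) * \<psi> m t\<bar> \<le> 4" for m t
  proof (cases "t \<ge> 1 / 2")
    case True
    then have "\<psi> m t = 0"
      using extremal_height_sgn[OF \<epsilon>(1)[of m], of t] \<epsilon>(2)[of m] by (simp add: \<psi>_def)
    then show ?thesis by simp
  next
    case False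
    then have "(2 - 2 * t) powr (- n / 2) \<le> 1 powr (- n / 2)" using n by (intro powr_mono2') auto
    moreover have "\<bar>\<psi> m t\<bar> \<le> 2"
      using extremal_height_bound[OF \<epsilon>(1,3), of m t] by (auto simp: \<psi>_def abs_le_iff intro!: real_le_lsqrt)
    ultimately have "2 * ((2 - 2 * t) powr (- n / 2) * \<bar>\<psi> m t\<bar>) \<le> 2 * (1 * 2)"
      by (intro mult_left_mono mult_mono) auto
    then show ?thesis by (simp add: abs_mult)
  qed
  have "(\<lambda>m. zonal_mean n (\<lambda>t. 2 * (2 - 2 * t) powr (- n / 2) * \<psi> m t)) \<longlonglongrightarrow> zonal_mean n g"
  proof (rule zonal_mean_dominated_convergence)
    show "(\<lambda>t. 2 * (2 - 2 * t) powr (- n / 2) * \<psi> m t * zonal_weight n t) integrable_on {-1<..<1}" for m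
    proof (rule integrable_mult_zonal_weight[OF n _ bound])
      have "extremal_height (\<epsilon> m) \<in> borel_measurable borel"
        by (rule borel_measurable_continuous_onI[OF continuous_extremal_height[OF \<epsilon>(1,3)]])
      then show "(\<lambda>t. 2 * (2 - 2 * t) powr (- n / 2) * \<psi> m t) \<in> borel_measurable borel"
        unfolding \<psi>_def by measurable
    qed
    show "(\<lambda>t. 4 * zonal_weight n t) integrable_on {-1<..<1}"
      by (rule integrable_continuous_mult_zonal_weight[OF n]) (intro continuous_intros)
    show "\<bar>2 * (2 - 2 * t) powr (- n / 2) * \<psi> m t\<bar> \<le> 4" for m t by (rule bound)
    fix t :: real
    have "eventually (\<lambda>m. \<psi> m t = (if t < 0 then 2 else if t = 0 then sqrt 2 else 0)) sequentially"
    proof (cases "t = 0")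
      case True
      then show ?thesis by (simp add: \<psi>_def extremal_height_def)
    next
      case False
      then have "eventually (\<lambda>m. \<epsilon> m < \<bar>t\<bar>) sequentially"
        using order_tendstoD(2)[OF \<epsilon>0] by simp
      then show ?thesis
        by eventually_elim (use False \<epsilon>(1) in \<open>simp add: \<psi>_def extremal_height_sgn\<close>)
    qed
    then have "eventually (\<lambda>m. 2 * (2 - 2 * t) powr (- n / 2) * \<psi> m t = g t) sequentially"
      by eventually_elim (simp add: g_def)
    then show "(\<lambda>m. 2 * (2 - 2 * t) powr (- n / 2) * \<psi> m t) \<longlonglongrightarrow> g t"
      by (rule tendsto_eventually)
  qed
  moreover have "zonal_mean n g = zonal_mean n (\<lambda>t. 2 * (2 - 2 * t) powr (- n / 2) * (if t \<le> 0 then 2 else 0))"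
    unfolding zonal_mean_def
    by (rule arg_cong[where f = "\<lambda>x. x / _"], rule integral_spike[of "{0}"]) (auto simp: g_def)
  ultimately show ?thesis by (simp add: \<psi>_def \<epsilon>_def)
qed

section \<open>Boundary Schwarz inequalities\<close>

theorem theorem2p3:
  fixes \<sigma> :: "(real ^ 'n) measure"
  assumes "CARD('n) \<ge> 2"
    and "normalized_rotation_invariant \<sigma>"
  shows
    "(\<forall>\<phi> \<alpha>. sphere_self_map \<phi> \<longrightarrow> \<alpha> \<ge> 0 \<longrightarrow>
        (\<alpha> = 0 \<and> dirichlet_solution_vec \<sigma> \<alpha> \<phi> 0 = 0 \<longrightarrow>
          (\<forall>\<zeta>. norm \<zeta> = 1 \<longrightarrow>
            boundary_liminf (dirichlet_solution_vec \<sigma> \<alpha> \<phi>) \<zeta> \<ge> ereal (harmonic_boundary_const CARD('n)))) \<and>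
        (\<alpha> > real CARD('n) - 2 \<longrightarrow>
          (\<forall>\<zeta>. norm \<zeta> = 1 \<longrightarrow>
            boundary_liminf (dirichlet_solution_vec \<sigma> \<alpha> \<phi>) \<zeta> \<ge> ereal (\<alpha> / 2 + 1 - real CARD('n) / 2)))) \<and>
     (\<forall>c > harmonic_boundary_const CARD('n).
        \<exists>\<phi> \<zeta>. sphere_self_map \<phi> \<and> dirichlet_solution_vec \<sigma> 0 \<phi> 0 = 0 \<and> norm \<zeta> = 1 \<and>
          boundary_liminf (dirichlet_solution_vec \<sigma> 0 \<phi>) \<zeta> < ereal c)"
proof (intro conjI allI impI)
  note n = assms(1) and \<sigma> = assms(2)
  let ?n = "real CARD('n)"
  have n1: "?n > 1" using n by simp
  have unit: "norm (dirichlet_solution_vec \<sigma> \<alpha> \<phi> \<zeta>) = 1" if "sphere_self_map \<phi>" "norm \<zeta> = 1" for \<alpha> \<phi> \<zeta>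
  proof -
    have "dirichlet_solution_vec \<sigma> \<alpha> \<phi> \<zeta> = \<phi> \<zeta>"
      using that by (simp add: vec_eq_iff dirichlet_solution_vec_def dirichlet_solution_def)
    then show ?thesis using that by (simp add: sphere_self_map_def)
  qed
  {
    fix \<phi> :: "real ^ 'n \<Rightarrow> real ^ 'n" and \<alpha> :: real and \<zeta> :: "real ^ 'n"
    assume \<phi>: "sphere_self_map \<phi>" and h: "\<alpha> = 0 \<and> dirichlet_solution_vec \<sigma> \<alpha> \<phi> 0 = 0" and \<zeta>: "norm \<zeta> = 1"
    have a0: "\<alpha> = 0" and h0: "dirichlet_solution_vec \<sigma> 0 \<phi> 0 = 0" using h by auto
    define U where "U r = zonal_mean ?n (\<lambda>t. (1 + r) * sphere_dist2 r t powr (- ?n / 2) * (if t \<le> 0 then 2 else 0))" for r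
    have "(U \<longlongrightarrow> zonal_mean ?n (\<lambda>t. 2 * (2 - 2 * t) powr (- ?n / 2) * (if t \<le> 0 then 2 else 0))) (at_left 1)"
      unfolding U_def by (rule poisson_truncated_limit[OF n1, where B = 2]) auto
    then have "(U \<longlongrightarrow> harmonic_boundary_const CARD('n)) (at_left 1)"
      by (simp only: zonal_mean_cap_eq_harmonic_const[OF n])
    moreover have "eventually (\<lambda>r. (1 - (1 - (1 - r) * U r)) / (1 - r) = U r) (at_left 1)"
      using eventually_at_left_real[of 0 1, simplified] by eventually_elim simp
    ultimately have lim: "((\<lambda>r. (1 - (1 - (1 - r) * U r)) / (1 - r)) \<longlongrightarrow> harmonic_boundary_const CARD('n)) (at_left 1)"
      by (simp only: tendsto_cong)
    show "boundary_liminf (dirichlet_solution_vec \<sigma> \<alpha> \<phi>) \<zeta> \<ge> ereal (harmonic_boundary_const CARD('n))"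
    proof (rule boundary_liminf_ge[where f = "dirichlet_solution_vec \<sigma> \<alpha> \<phi>" and \<zeta> = \<zeta> and u = "\<lambda>r. 1 - (1 - r) * U r", OF unit[OF \<phi> \<zeta>, of \<alpha>] _ lim])
      fix r :: real assume "0 < r" "r < 1"
      then show "norm (dirichlet_solution_vec \<sigma> \<alpha> \<phi> (r *\<^sub>R \<zeta>)) \<le> 1 - (1 - r) * U r"
        using norm_harmonic_solution_vec_le[OF n \<sigma> \<phi> \<zeta> _ _ h0, of r] a0 by (simp add: U_def)
    qed
  }
  {
    fix \<phi> :: "real ^ 'n \<Rightarrow> real ^ 'n" and \<alpha> :: real and \<zeta> :: "real ^ 'n"
    assume \<phi>: "sphere_self_map \<phi>" and a0: "\<alpha> \<ge> 0" and \<alpha>: "\<alpha> > ?n - 2" and \<zeta>: "norm \<zeta> = 1"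
    have "poisson_const CARD('n) \<alpha> > 0"
      using a0 n unfolding poisson_const_def
      by (intro divide_pos_pos mult_pos_pos Gamma_real_pos) auto
    then have c: "poisson_const CARD('n) \<alpha> \<ge> 0" by simp
    show "boundary_liminf (dirichlet_solution_vec \<sigma> \<alpha> \<phi>) \<zeta> \<ge> ereal (\<alpha> / 2 + 1 - ?n / 2)"
      by (rule boundary_liminf_ge[where f = "dirichlet_solution_vec \<sigma> \<alpha> \<phi>" and \<zeta> = \<zeta> and u = "\<lambda>r. zonal_mean ?n (\<lambda>t. poisson_const CARD('n) \<alpha> *
              ((1 - r\<^sup>2) powr (1 + \<alpha>) * sphere_dist2 r t powr (- ((?n + \<alpha>) / 2))))",
            OF unit[OF \<phi> \<zeta>, of \<alpha>] _ weighted_poisson_mass_derivative[OF n \<alpha>]])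
         (rule norm_dirichlet_solution_vec_le[OF n \<sigma> \<phi> \<zeta> _ _ c], auto)
  }
  \<comment> \<open>a sufficiently narrow belt brings the bound of the nearly extremal map below \<open>c\<close>\<close>
  fix c assume "c > harmonic_boundary_const CARD('n)"
  then have "eventually (\<lambda>m. zonal_mean ?n (\<lambda>t. 2 * (2 - 2 * t) powr (- ?n / 2) * sqrt (2 - 2 * extremal_height (1 / (real m + 2)) t)) < c) sequentially"
    using order_tendstoD(2)[OF extremal_constants_tendsto[OF n1]] by (simp only: zonal_mean_cap_eq_harmonic_const[OF n])
  then obtain m where m: "zonal_mean ?n (\<lambda>t. 2 * (2 - 2 * t) powr (- ?n / 2) * sqrt (2 - 2 * extremal_height (1 / (real m + 2)) t)) < c"
    using eventually_happens'[OF sequentially_bot] by blast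
  define \<epsilon> where "\<epsilon> = 1 / (real m + 2)"
  have \<epsilon>: "\<epsilon> > 0" "\<epsilon> \<le> 1 / 2" "\<epsilon> \<le> 1" by (simp_all add: \<epsilon>_def field_simps)
  define k :: 'n where "k = undefined"
  have "boundary_liminf (dirichlet_solution_vec \<sigma> 0 (extremal_map \<epsilon> k)) (axis k 1) < ereal c"
    using extremal_map_boundary_liminf_le[OF n \<sigma> \<epsilon>(1,2), of k] m
    by (auto simp: \<epsilon>_def[symmetric] intro: le_less_trans)
  then show "\<exists>\<phi> \<zeta>. sphere_self_map \<phi> \<and> dirichlet_solution_vec \<sigma> 0 \<phi> 0 = 0 \<and> norm \<zeta> = 1 \<and>
          boundary_liminf (dirichlet_solution_vec \<sigma> 0 \<phi>) \<zeta> < ereal c"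
    using extremal_map_sphere_self_map[OF \<epsilon>(1,3), of k] extremal_map_centred[OF n \<sigma> \<epsilon>(1,3), of k]
    by (intro exI[of _ "extremal_map \<epsilon> k"] exI[of _ "axis k 1"]) auto
qed

end
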